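(* Let $\alpha=(\alpha_1,\alpha_2)\in(0,1]\times(0,1]$, $A=(a_{ij})\in\mathbb R^{2\times2}$, let $\Omega\subset\mathbb R^2$ be open with $0\in\Omega$, and let $f:\Omega\to\mathbb R^2$ be locally Lipschitz continuous at the origin with $f(0)=0$ and $\lim_{r\to0}l_f(r)=0$, where $$l_f(r):=\sup_{x,y\in B(0,r),\,x\ne y}\frac{\|f(x)-f(y)\|}{\|x-y\|}.$$ Consider the initial value problem $${}^CD^{\alpha}_{0^+}x(t)=Ax(t)+f(x(t))\quad(t>0),\qquad x(0)=x^0\in\Omega. \qquad(\ast)$$ Suppose that all zeros of the characteristic function $Q(s)=s^{\alpha_1+\alpha_2}-a_{11}s^{\alpha_2}-a_{22}s^{\alpha_1}+\det A$ lie in the open left half of the complex plane. Then the trivial solution of the differential equation in $(\ast)$ is Mittag-Leffler stable. More precisely, there exist constants $\delta,\varepsilon>0$ such that for any $x^0$ with $\|x^0\|<\delta$ the unique solution $\varphi(\cdot,x^0)$ of $(\ast)$ exists globally on $[0,\infty)$ and $\sup_{t\ge1}t^{\nu}\|\varphi(t,x^0)\|\le\varepsilon$, where $\nu=\min\{\alpha_1,\alpha_2\}$.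
   Context: On $\mathbb R^2$ use $\|x\|=\max\{|x_1|,|x_2|\}$, and $B(0,r)=\{x\in\mathbb R^2:\|x\|\le r\}$. "Locally Lipschitz continuous at the origin" means that $f$ is Lipschitz continuous on some ball $B(0,\varepsilon_0)\subset\Omega$, $\varepsilon_0>0$. For $0<\kappa<1$ the Riemann–Liouville integral is $I^{\kappa}_{0^+}g(t)=\frac{1}{\Gamma(\kappa)}\int_0^t(t-s)^{\kappa-1}g(s)\,ds$, and the Caputo derivative of order $\kappa\in(0,1)$ is ${}^CD^{\kappa}_{0^+}g(t)=\frac{d}{dt}I^{1-\kappa}_{0^+}(g(t)-g(0))$, $t>0$; for $\kappa=1$ it is the usual derivative. For $x=(x_1,x_2)$, ${}^CD^{\alpha}_{0^+}x=({}^CD^{\alpha_1}_{0^+}x_1,{}^CD^{\alpha_2}_{0^+}x_2)$. A solution is a continuous function $x$ with values in $\Omega$, $x(0)=x^0$, satisfying the differential equations for $t>0$. Powers $s^{\kappa}$ of complex $s\ne0$ use the principal branch, $\arg s\in(-\pi,\pi]$, and $0^\kappa=0$ for $\kappa>0$. Definition (Mittag-Leffler stability): the trivial solution is Mittag-Leffler stable if there exist positive constants $\gamma,m,\delta$ such that for any initial condition $x^0\in B(0,\delta)$ the solution $\varphi(\cdot,x^0)$ of the initial value problem exists globally on $[0,\infty)$ and $\max\{\sup_{t\in[0,1]}\|\varphi(t,x^0)\|,\ \sup_{t\ge1}t^{\gamma}\|\varphi(t,x^0)\|\}\le m$. *)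

theory Defs
  imports "HOL-Analysis.Analysis"
begin

text \<open>The norm on \<open>real ^ 2\<close> is the maximum norm, i.e. the library's \<^const>\<open>infnorm\<close>,
  not the Euclidean \<^const>\<open>norm\<close>.\<close>

lemma infnorm_real_2: "infnorm (x :: real ^ 2) = max \<bar>x $ 1\<bar> \<bar>x $ 2\<bar>"
proof -
  have "{\<bar>x $ i\<bar> | i. i \<in> UNIV} = {\<bar>x $ 1\<bar>, \<bar>x $ 2\<bar>}"
    by (auto simp: set_eq_iff) (metis exhaust_2)+
  then show ?thesis
    by (simp add: infnorm_cart cSup_eq_Max)
qed

definition max_ball :: "real \<Rightarrow> (real ^ 2) set" where
  "max_ball r = {x. infnorm x \<le> r}"

definition locally_lipschitz_at_origin :: "(real ^ 2) set \<Rightarrow> (real ^ 2 \<Rightarrow> real ^ 2) \<Rightarrow> bool" where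
  "locally_lipschitz_at_origin \<Omega> f \<longleftrightarrow>
     (\<exists>\<epsilon>\<^sub>0 > 0. max_ball \<epsilon>\<^sub>0 \<subseteq> \<Omega> \<and>
       (\<exists>L \<ge> 0. \<forall>x \<in> max_ball \<epsilon>\<^sub>0. \<forall>y \<in> max_ball \<epsilon>\<^sub>0. infnorm (f x - f y) \<le> L * infnorm (x - y)))"

text \<open>The supremum is taken in the extended reals, so it is infinite when the difference quotients
  are unbounded. Only small \<open>r > 0\<close> matter, for which the ball lies in the domain of \<open>f\<close>.\<close>

definition lip_const :: "(real ^ 2 \<Rightarrow> real ^ 2) \<Rightarrow> real \<Rightarrow> ereal" where
  "lip_const f r =
     (SUP (x, y) \<in> {(x, y). x \<in> max_ball r \<and> y \<in> max_ball r \<and> x \<noteq> y}.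
        ereal (infnorm (f x - f y) / infnorm (x - y)))"

definition RL_integral :: "real \<Rightarrow> (real \<Rightarrow> real) \<Rightarrow> real \<Rightarrow> real" where
  "RL_integral \<kappa> g t = 1 / Gamma \<kappa> * (LBINT s:{0..t}. (t - s) powr (\<kappa> - 1) * g s)"

text \<open>A relation rather than a function, so that it includes existence of the derivative.\<close>

definition has_caputo_derivative :: "real \<Rightarrow> (real \<Rightarrow> real) \<Rightarrow> real \<Rightarrow> real \<Rightarrow> bool" where
  "has_caputo_derivative \<kappa> g D t \<longleftrightarrow>
     (if \<kappa> = 1 then (g has_real_derivative D) (at t)
      else (RL_integral (1 - \<kappa>) (\<lambda>s. g s - g 0) has_real_derivative D) (at t))"

text \<open>\<open>x\<close> solves \<open>D\<^sup>\<alpha> x = F x\<close>, \<open>x 0 = x\<^sub>0\<close> on \<open>[0, T)\<close>, where \<open>T = \<infinity>\<close> means globally; values of \<open>x\<close>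
  outside \<open>[0, T)\<close> are irrelevant.\<close>

definition caputo_solution ::
  "real ^ 2 \<Rightarrow> (real ^ 2) set \<Rightarrow> (real ^ 2 \<Rightarrow> real ^ 2) \<Rightarrow> real ^ 2 \<Rightarrow> ereal \<Rightarrow> (real \<Rightarrow> real ^ 2) \<Rightarrow> bool" where
  "caputo_solution \<alpha> \<Omega> F x\<^sub>0 T x \<longleftrightarrow>
     continuous_on {t. 0 \<le> t \<and> ereal t < T} x \<and>
     (\<forall>t. 0 \<le> t \<and> ereal t < T \<longrightarrow> x t \<in> \<Omega>) \<and>
     x 0 = x\<^sub>0 \<and>
     (\<forall>t. 0 < t \<and> ereal t < T \<longrightarrow>
        (\<forall>i. has_caputo_derivative (\<alpha> $ i) (\<lambda>\<tau>. x \<tau> $ i) (F (x t) $ i) t))"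

text \<open>Uniqueness is also required against solutions on bounded intervals.\<close>

definition unique_global_solution ::
  "real ^ 2 \<Rightarrow> (real ^ 2) set \<Rightarrow> (real ^ 2 \<Rightarrow> real ^ 2) \<Rightarrow> real ^ 2 \<Rightarrow> (real \<Rightarrow> real ^ 2) \<Rightarrow> bool" where
  "unique_global_solution \<alpha> \<Omega> F x\<^sub>0 \<phi> \<longleftrightarrow>
     caputo_solution \<alpha> \<Omega> F x\<^sub>0 \<infinity> \<phi> \<and>
     (\<forall>T > 0. \<forall>\<psi>. caputo_solution \<alpha> \<Omega> F x\<^sub>0 T \<psi> \<longrightarrow>
        (\<forall>t. 0 \<le> t \<and> ereal t < T \<longrightarrow> \<psi> t = \<phi> t))"

definition mittag_leffler_stable ::
  "real ^ 2 \<Rightarrow> (real ^ 2) set \<Rightarrow> (real ^ 2 \<Rightarrow> real ^ 2) \<Rightarrow> bool" where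
  "mittag_leffler_stable \<alpha> \<Omega> F \<longleftrightarrow>
     (\<exists>\<gamma> > 0. \<exists>m > 0. \<exists>\<delta> > 0. \<forall>x\<^sub>0 \<in> max_ball \<delta>. \<exists>\<phi>.
        unique_global_solution \<alpha> \<Omega> F x\<^sub>0 \<phi> \<and>
        max (SUP t \<in> {0..1}. ereal (infnorm (\<phi> t)))
            (SUP t \<in> {1..}. ereal (t powr \<gamma> * infnorm (\<phi> t))) \<le> ereal m)"

text \<open>Complex \<^const>\<open>powr\<close> is the principal branch and satisfies \<open>0 powr w = 0\<close>.\<close>

definition char_fun :: "real ^ 2 \<Rightarrow> real ^ 2 ^ 2 \<Rightarrow> complex \<Rightarrow> complex" where
  "char_fun \<alpha> A s =
     s powr of_real (\<alpha> $ 1 + \<alpha> $ 2) - of_real (A $ 1 $ 1) * s powr of_real (\<alpha> $ 2)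
       - of_real (A $ 2 $ 2) * s powr of_real (\<alpha> $ 1) + of_real (det A)"

end

theory Submission
  imports Defs "HOL-Complex_Analysis.Cauchy_Integral_Formula"
begin

text \<open>
  Let \<open>R(s) = (diag(s\<^sup>\<alpha>) - A)\<^sup>-\<^sup>1\<close>, whose entries have denominator \<open>Q(s)\<close>. Since \<open>Q\<close> has no zero in the
  closed right half plane and grows at infinity, by compactness it has none in a slightly larger sector,
  so \<open>R\<close> is the Laplace transform of a kernel \<open>K\<close> given by an integral along the two boundary rays of
  that sector. The Hoelder bound \<open>R(s) - R(0) = O(|s|\<^sup>\<nu>)\<close> yields \<open>K(t) = O(t\<^bsup>-1-\<nu>\<^esup>)\<close>, and \<open>K\<close> is integrable at \<open>0\<close>.
  The initial value problem is then equivalent to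
  \<open>x(t) = x\<^sub>0 + \<integral>\<^sub>0\<^sup>t K(t - s) (A x\<^sub>0 + f(x(s))) ds\<close>. As \<open>\<integral> K = R(0) = - A\<^sup>-\<^sup>1\<close>, the part that is linear in \<open>x\<^sub>0\<close>
  equals \<open>- \<integral>\<^sub>t\<^sup>\<infinity> K A x\<^sub>0 = O(t\<^bsup>-\<nu>\<^esup>)\<close>, and convolution with \<open>K\<close> preserves the weight \<open>(1 + t)\<^bsup>-\<nu>\<^esup>\<close>. Hence the
  right hand side is a contraction on a small ball of the weighted space of bounded continuous functions.
  That its fixed point solves the Volterra form of the problem is seen on the Laplace side, by
  Lerch's theorem. Uniqueness is a Gronwall argument with the weight \<open>e\<^bsup>-pt\<^esup>\<close> for large \<open>p\<close>.
\<close>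

section \<open>Convolution on the half-line\<close>

text \<open>The increment \<open>z = x - x\<^sub>0\<close> starts at \<open>0\<close> and solves
  \<open>D z = A z + (A x\<^sub>0 + f x)\<close>. Hence one matrix kernel serves the linear and the
  nonlinear part, and the transform \<open>s^(\<alpha> - 1) R(s)\<close> of the homogeneous solution
  never has to be inverted. The price is the forcing term \<open>A x\<^sub>0\<close>, which does not
  decay in time; it is balanced by \<open>x\<^sub>0\<close> only through the exact value of the
  integral of \<open>K\<close>.

  Unequal orders rule out the scalar Mittag-Leffler function of a matrix, so everything about
  \<open>K\<close> is read off from bounds on \<open>R\<close>. The rays have to lie strictly inside
  the left half plane, since otherwise \<open>exp (s t)\<close> would not decay along them. The
  branch point at \<open>0\<close> limits the regularity of \<open>R\<close> there to a Hoelder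
  condition, and this exponent is the rate \<open>\<nu>\<close> of the theorem. At small
  \<open>t\<close> a crude bound is enough, because only integrability matters there.

  Laplace transforms occur at real arguments only: the kernel is written down as a ray integral and
  its transform is computed from Cauchy's formula, so no inversion formula along a vertical line
  enters.\<close>

definition conv :: "(real \<Rightarrow> real) \<Rightarrow> (real \<Rightarrow> real) \<Rightarrow> real \<Rightarrow> real" where
  "conv k g t = (LBINT s:{0..t}. k (t - s) * g s)"

text \<open>The change of variables \<open>(x, y) -> (x, y - x)\<close> keeps a product integrable.
  This is what permits the exchange of integrals both in the associativity of \<open>conv\<close>
  and in the Laplace transform of a convolution.\<close>

lemma integrable_shear:
  fixes f g :: "real \<Rightarrow> real"
  assumes f: "integrable lborel f" and g: "integrable lborel g"
  shows "integrable (lborel \<Otimes>\<^sub>M lborel) (\<lambda>(x, y). g x * f (y - x))"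
proof (rule lborel_pair.Fubini_integrable)
  have [measurable]: "f \<in> borel_measurable borel" "g \<in> borel_measurable borel"
    using f g by (auto dest: borel_measurable_integrable)
  show "(\<lambda>(x, y). g x * f (y - x)) \<in> borel_measurable (lborel \<Otimes>\<^sub>M lborel)"
    by measurable
  have f': "integrable lborel (\<lambda>y. f (y - x))" for x
    using lborel_integrable_real_affine[OF f, of 1 "-x"] by simp
  have n: "(\<integral>y. \<bar>f (y - x)\<bar> \<partial>lborel) = (\<integral>y. \<bar>f y\<bar> \<partial>lborel)" for x
    using lborel_integral_real_affine[of 1 "\<lambda>y. \<bar>f y\<bar>" "-x"] by simp
  show "AE x in lborel. integrable lborel (\<lambda>y. case (x, y) of (x, y) \<Rightarrow> g x * f (y - x))"
    using f' by simp
  show "integrable lborel (\<lambda>x. LINT y|lborel. norm (case (x, y) of (x, y) \<Rightarrow> g x * f (y - x)))"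
    using g by (simp add: abs_mult n)
qed

lemma conv_commute: "conv k g t = conv g k t"
proof -
  have "conv k g t = (\<integral>s. indicator {0..t} s *\<^sub>R (k (t - s) * g s) \<partial>lborel)"
    by (simp add: conv_def set_lebesgue_integral_def)
  also have "\<dots> = (\<integral>s. indicator {0..t} (t - s) *\<^sub>R (k s * g (t - s)) \<partial>lborel)"
    by (subst lborel_integral_real_affine[of "-1" _ t]) auto
  also have "\<dots> = conv g k t"
    unfolding conv_def set_lebesgue_integral_def
    by (intro Bochner_Integration.integral_cong) (auto simp: indicator_def)
  finally show ?thesis .
qed

lemma conv_cong: "(\<And>s. 0 \<le> s \<Longrightarrow> s \<le> t \<Longrightarrow> g s = h s) \<Longrightarrow> conv k g t = conv k h t"
  unfolding conv_def by (intro set_lebesgue_integral_cong) auto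

lemma continuous_on_Icc_bound:
  fixes h :: "real \<Rightarrow> real"
  assumes "continuous_on {a..b} h"
  obtains B where "\<And>s. s \<in> {a..b} \<Longrightarrow> \<bar>h s\<bar> \<le> B"
proof -
  have "bounded (h ` {a..b})"
    using assms by (intro compact_imp_bounded compact_continuous_image) auto
  then obtain B where "\<forall>x\<in>h ` {a..b}. norm x \<le> B" unfolding bounded_iff ..
  then show ?thesis by (intro that[of B]) auto
qed

lemma conv_integrable:
  fixes k h :: "real \<Rightarrow> real"
  assumes k: "set_integrable lborel {0..t} k" and h: "continuous_on {0..t} h"
  shows "set_integrable lborel {0..t} (\<lambda>s. k (t - s) * h s)"
proof -
  define K where "K = (\<lambda>s. indicator {0..t} s * k s)"
  define H where "H = (\<lambda>s. indicator {0..t} s * h s)"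
  have K: "integrable lborel K"
    using k by (simp add: set_integrable_def K_def)
  have H: "H \<in> borel_measurable lborel"
    using borel_measurable_continuous_on_indicator[OF _ h] by (simp add: H_def)
  obtain B where B: "\<And>s. s \<in> {0..t} \<Longrightarrow> \<bar>h s\<bar> \<le> B"
    using continuous_on_Icc_bound[OF h] by blast
  have BH: "\<bar>H s\<bar> \<le> \<bar>B\<bar>" for s using B[of s] by (auto simp: H_def indicator_def)
  have "integrable lborel (\<lambda>s. H s *\<^sub>R K (t - s))"
  proof (rule Bochner_Integration.integrable_bound)
    show "integrable lborel (\<lambda>s. B * K (t - s))"
      using lborel_integrable_real_affine[OF K, of "-1" t] by simp
    show "(\<lambda>s. H s *\<^sub>R K (t - s)) \<in> borel_measurable lborel"
      using H borel_measurable_integrable[OF lborel_integrable_real_affine[OF K, of "-1" t]] by simp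
    show "AE x in lborel. norm (H x *\<^sub>R K (t - x)) \<le> norm (B * K (t - x))"
      using BH by (auto simp: abs_mult intro!: mult_right_mono)
  qed
  also have "(\<lambda>s. H s *\<^sub>R K (t - s)) = (\<lambda>s. indicator {0..t} s *\<^sub>R (k (t - s) * h s))"
    by (auto simp: H_def K_def indicator_def)
  finally show ?thesis by (simp add: set_integrable_def)
qed

lemma conv_add:
  assumes "set_integrable lborel {0..t} k" "continuous_on {0..t} g" "continuous_on {0..t} h"
  shows "conv k (\<lambda>s. g s + h s) t = conv k g t + conv k h t"
  unfolding conv_def using assms
  by (simp add: distrib_left conv_integrable)

lemma conv_diff:
  assumes "set_integrable lborel {0..t} k" "continuous_on {0..t} g" "continuous_on {0..t} h"
  shows "conv k (\<lambda>s. g s - h s) t = conv k g t - conv k h t"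
  unfolding conv_def using assms
  by (simp add: right_diff_distrib conv_integrable)

lemma conv_cmult: "conv k (\<lambda>s. c * g s) t = c * conv k g t"
  unfolding conv_def by (simp add: mult.left_commute)

lemma conv_bound:
  assumes k: "set_integrable lborel {0..t} k" and h: "continuous_on {0..t} h" and g: "continuous_on {0..t} g"
   and kk: "set_integrable lborel {0..t} k'"
   and le: "\<And>s. 0 \<le> s \<Longrightarrow> s \<le> t \<Longrightarrow> \<bar>h s\<bar> \<le> g s" "\<And>s. 0 \<le> s \<Longrightarrow> s \<le> t \<Longrightarrow> \<bar>k s\<bar> \<le> k' s"
  shows "\<bar>conv k h t\<bar> \<le> conv k' g t"
proof -
  have "\<bar>conv k h t\<bar> \<le> (LBINT s:{0..t}. \<bar>k (t - s) * h s\<bar>)"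
    unfolding conv_def using set_integral_norm_bound[OF conv_integrable[OF k h]] by simp
  also have "\<dots> \<le> conv k' g t" unfolding conv_def
  proof (rule set_integral_mono)
    show "set_integrable lborel {0..t} (\<lambda>s. \<bar>k (t - s) * h s\<bar>)"
      using set_integrable_abs[OF conv_integrable[OF k h]] .
    show "set_integrable lborel {0..t} (\<lambda>s. k' (t - s) * g s)" by (rule conv_integrable[OF kk g])
    show "\<bar>k (t - s) * h s\<bar> \<le> k' (t - s) * g s" if "s \<in> {0..t}" for s
      unfolding abs_mult using that le(1)[of s] le(2)[of "t - s"] by (intro mult_mono) auto
  qed
  finally show ?thesis .
qed

text \<open>After the factors are cut off to \<open>{0..t}\<close> and extended by zero, the
  triangle \<open>0 \<le> u \<le> s \<le> t\<close> is encoded in the integrand, and associativity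
  becomes a change of the order of integration over the plane. Both kernels may be singular; the
  third factor is bounded, so the sheared product of the kernels dominates.\<close>

lemma conv_assoc:
  assumes k1: "set_integrable lborel {0..t} k1" and k2: "set_integrable lborel {0..t} k2"
    and h: "continuous_on {0..t} h"
  shows "conv k1 (conv k2 h) t = conv (conv k1 k2) h t"
proof -
  define K1 where "K1 = (\<lambda>s. indicator {0..t} s * k1 s)"
  define K2 where "K2 = (\<lambda>s. indicator {0..t} s * k2 s)"
  define H where "H = (\<lambda>s. indicator {0..t} s * h s)"
  have K1: "integrable lborel K1" and K2: "integrable lborel K2"
    using k1 k2 by (simp_all add: set_integrable_def K1_def K2_def)
  have H: "H \<in> borel_measurable borel"
    using borel_measurable_continuous_on_indicator[OF _ h] by (simp add: H_def)
  obtain B where B: "\<And>s. s \<in> {0..t} \<Longrightarrow> \<bar>h s\<bar> \<le> B"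
    using continuous_on_Icc_bound[OF h] by blast
  have BH: "\<bar>H s\<bar> \<le> \<bar>B\<bar>" for s using B[of s] by (auto simp: H_def indicator_def)
  have [measurable]: "K1 \<in> borel_measurable borel" "K2 \<in> borel_measurable borel" "H \<in> borel_measurable borel"
    using K1 K2 H by (auto dest: borel_measurable_integrable)
  have int: "integrable (lborel \<Otimes>\<^sub>M lborel) (\<lambda>(s, u). K1 (t - s) * K2 (s - u))"
    using integrable_shear[of "\<lambda>x. K2 (- x)" "\<lambda>s. K1 (t - s)"]
      lborel_integrable_real_affine[OF K1, of "-1" t] lborel_integrable_real_affine[OF K2, of "-1" 0]
    by simp
  have "integrable (lborel \<Otimes>\<^sub>M lborel) (\<lambda>(s, u). K1 (t - s) * K2 (s - u) * H u)"
  proof (rule Bochner_Integration.integrable_bound)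
    show "integrable (lborel \<Otimes>\<^sub>M lborel) (\<lambda>x. B * (case x of (s, u) \<Rightarrow> K1 (t - s) * K2 (s - u)))"
      using int by simp
    show "AE x in lborel \<Otimes>\<^sub>M lborel. norm (case x of (s, u) \<Rightarrow> K1 (t - s) * K2 (s - u) * H u)
         \<le> norm (B * (case x of (s, u) \<Rightarrow> K1 (t - s) * K2 (s - u)))"
    proof (rule AE_I2, clarsimp simp: abs_mult)
      fix s u
      show "\<bar>K1 (t - s)\<bar> * \<bar>K2 (s - u)\<bar> * \<bar>H u\<bar> \<le> \<bar>B\<bar> * (\<bar>K1 (t - s)\<bar> * \<bar>K2 (s - u)\<bar>)"
        using mult_left_mono[OF BH[of u], of "\<bar>K1 (t - s)\<bar> * \<bar>K2 (s - u)\<bar>"] by (simp add: mult_ac)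
    qed
  qed measurable
  from lborel_pair.Fubini_integral[OF this]
  have F: "(\<integral>u. \<integral>s. K1 (t - s) * K2 (s - u) * H u \<partial>lborel \<partial>lborel)
         = (\<integral>s. \<integral>u. K1 (t - s) * K2 (s - u) * H u \<partial>lborel \<partial>lborel)" .
  have L: "conv k1 (conv k2 h) t = (\<integral>s. \<integral>u. K1 (t - s) * K2 (s - u) * H u \<partial>lborel \<partial>lborel)"
    unfolding conv_def set_lebesgue_integral_def
  proof (intro Bochner_Integration.integral_cong refl)
    fix s
    have "(\<integral>u. K1 (t - s) * K2 (s - u) * H u \<partial>lborel) = K1 (t - s) * (\<integral>u. K2 (s - u) * H u \<partial>lborel)"
      by (simp add: mult.assoc)
    also have "\<dots> = indicator {0..t} s *\<^sub>R (k1 (t - s) * (\<integral>u. indicator {0..s} u *\<^sub>R (k2 (s - u) * h u) \<partial>lborel))"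
    proof (cases "s \<in> {0..t}")
      case True
      have "(\<integral>u. K2 (s - u) * H u \<partial>lborel) = (\<integral>u. indicator {0..s} u *\<^sub>R (k2 (s - u) * h u) \<partial>lborel)"
        using True by (intro Bochner_Integration.integral_cong) (auto simp: K2_def H_def indicator_def)
      then show ?thesis using True by (simp add: K1_def)
    qed (auto simp: K1_def indicator_def)
    finally show "indicator {0..t} s *\<^sub>R (k1 (t - s) * (\<integral>u. indicator {0..s} u *\<^sub>R (k2 (s - u) * h u) \<partial>lborel))
       = (\<integral>u. K1 (t - s) * K2 (s - u) * H u \<partial>lborel)" ..
  qed
  have R: "conv (conv k1 k2) h t = (\<integral>u. \<integral>s. K1 (t - s) * K2 (s - u) * H u \<partial>lborel \<partial>lborel)"
    unfolding conv_def set_lebesgue_integral_def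
  proof (intro Bochner_Integration.integral_cong refl)
    fix u
    have "(\<integral>s. K1 (t - s) * K2 (s - u) * H u \<partial>lborel) = (\<integral>s. K1 (t - s) * K2 (s - u) \<partial>lborel) * H u"
      by simp
    also have "(\<integral>s. K1 (t - s) * K2 (s - u) \<partial>lborel) = (\<integral>s. K1 (t - u - s) * K2 s \<partial>lborel)"
      by (subst lborel_integral_real_affine[of 1 _ u]) (simp_all add: algebra_simps)
    also have "\<dots> * H u = indicator {0..t} u *\<^sub>R ((\<integral>s. indicator {0..t - u} s *\<^sub>R (k1 (t - u - s) * k2 s) \<partial>lborel) * h u)"
    proof (cases "u \<in> {0..t}")
      case True
      have "(\<integral>s. K1 (t - u - s) * K2 s \<partial>lborel) = (\<integral>s. indicator {0..t - u} s *\<^sub>R (k1 (t - u - s) * k2 s) \<partial>lborel)"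
        using True by (intro Bochner_Integration.integral_cong) (auto simp: K1_def K2_def indicator_def)
      then show ?thesis using True by (simp add: H_def)
    qed (auto simp: H_def)
    finally show "indicator {0..t} u *\<^sub>R ((\<integral>s. indicator {0..t - u} s *\<^sub>R (k1 (t - u - s) * k2 s) \<partial>lborel) * h u) =
       (\<integral>s. K1 (t - s) * K2 (s - u) * H u \<partial>lborel)" ..
  qed
  show ?thesis using F L R by simp
qed

text \<open>The kernel is merely integrable, so the moving argument is put on the continuous factor,
  and dominated convergence applies with a multiple of the kernel as majorant.\<close>

lemma continuous_on_conv:
  assumes k: "set_integrable lborel {0..b} k" and h: "continuous_on {0..b} h"
  shows "continuous_on {0..b} (conv k h)"
  unfolding continuous_on_sequentially comp_def
proof (intro allI ballI impI, elim conjE)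
  fix x a assume a: "a \<in> {0..b}" and x: "\<forall>n. x n \<in> {0..b}" and lim: "x \<longlonglongrightarrow> a"
  define K where "K = (\<lambda>s. indicator {0..b} s * k s)"
  define H where "H = (\<lambda>s. indicator {0..b} s * h s)"
  have K: "integrable lborel K"
    using k by (simp add: set_integrable_def K_def)
  have [measurable]: "H \<in> borel_measurable borel" "K \<in> borel_measurable borel"
    using borel_measurable_continuous_on_indicator[OF _ h] K by (auto simp: H_def dest: borel_measurable_integrable)
  obtain B where B: "\<And>s. s \<in> {0..b} \<Longrightarrow> \<bar>h s\<bar> \<le> B"
    using continuous_on_Icc_bound[OF h] by blast
  have BH: "\<bar>H s\<bar> \<le> \<bar>B\<bar>" for s using B[of s] by (auto simp: H_def indicator_def)
  have eq: "conv k h t = (\<integral>s. K s * H (t - s) \<partial>lborel)" if "t \<in> {0..b}" for t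
  proof -
    have "conv k h t = conv h k t" by (rule conv_commute)
    also have "\<dots> = (\<integral>s. K s * H (t - s) \<partial>lborel)"
      unfolding conv_def set_lebesgue_integral_def using that
      by (intro Bochner_Integration.integral_cong) (auto simp: K_def H_def indicator_def)
    finally show ?thesis .
  qed
  have "(\<lambda>n. \<integral>s. K s * H (x n - s) \<partial>lborel) \<longlonglongrightarrow> (\<integral>s. K s * H (a - s) \<partial>lborel)"
  proof (rule integral_dominated_convergence[where w="\<lambda>s. \<bar>B\<bar> * \<bar>K s\<bar>"])
    show "integrable lborel (\<lambda>s. \<bar>B\<bar> * \<bar>K s\<bar>)" using K by simp
    \<comment> \<open>The cut-off function \<open>H\<close> jumps at \<open>0\<close>, so
      convergence of \<open>H (x n - s)\<close> can fail at \<open>s = a\<close>, a null set. The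
      jump at \<open>b\<close> does no harm, since \<open>x n - s \<le> b\<close> whenever
      \<open>s \<ge> 0\<close>.\<close>
    have "AE s in lborel. s \<noteq> a" by (rule AE_lborel_singleton)
    then show "AE s in lborel. (\<lambda>n. K s * H (x n - s)) \<longlonglongrightarrow> K s * H (a - s)"
    proof (rule AE_mp, intro AE_I2 impI)
      fix s assume "s \<noteq> a"
      show "(\<lambda>n. K s * H (x n - s)) \<longlonglongrightarrow> K s * H (a - s)"
      proof (cases "s \<in> {0..b}")
        case False then show ?thesis by (simp add: K_def)
      next
        case s: True
        have lim': "(\<lambda>n. x n - s) \<longlonglongrightarrow> a - s" using lim by (intro tendsto_intros)
        show ?thesis
        proof (intro tendsto_intros, cases "s < a")
          case True
          then have "\<forall>\<^sub>F n in sequentially. 0 < x n - s"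
            using order_tendstoD(1)[OF lim', of 0] by simp
          then have ev: "\<forall>\<^sub>F n in sequentially. x n - s \<in> {0..b}"
            using x s by (auto elim!: eventually_mono) (metis add_mono diff_le_eq order_trans le_add_same_cancel1)
          have as: "a - s \<in> {0..b}" using True a s by auto
          have "(\<lambda>n. h (x n - s)) \<longlonglongrightarrow> h (a - s)"
            by (rule continuous_on_tendsto_compose[OF h lim' as ev])
          moreover have "\<forall>\<^sub>F n in sequentially. h (x n - s) = H (x n - s)"
            using ev by eventually_elim (simp add: H_def)
          ultimately show "(\<lambda>n. H (x n - s)) \<longlonglongrightarrow> H (a - s)"
            using as by (simp add: H_def tendsto_cong)
        next
          case False
          with \<open>s \<noteq> a\<close> have "a - s < 0" by simp
          then have "\<forall>\<^sub>F n in sequentially. x n - s < 0"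
            using order_tendstoD(2)[OF lim', of 0] by simp
          then have "\<forall>\<^sub>F n in sequentially. H (x n - s) = 0"
            by eventually_elim (simp add: H_def)
          then show "(\<lambda>n. H (x n - s)) \<longlonglongrightarrow> H (a - s)"
            using \<open>a - s < 0\<close> by (simp add: tendsto_eventually H_def)
        qed
      qed
    qed
    show "AE s in lborel. norm (K s * H (x i - s)) \<le> \<bar>B\<bar> * \<bar>K s\<bar>" for i
    proof (rule AE_I2)
      fix s show "norm (K s * H (x i - s)) \<le> \<bar>B\<bar> * \<bar>K s\<bar>"
        using mult_right_mono[OF BH[of "x i - s"], of "\<bar>K s\<bar>"] by (simp add: abs_mult mult.commute)
    qed
  qed measurable
  then show "(\<lambda>n. conv k h (x n)) \<longlonglongrightarrow> conv k h a"
    using eq x a by simp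
qed

section \<open>Riemann--Liouville kernels and the Caputo derivative\<close>

definition rl_kernel :: "real \<Rightarrow> real \<Rightarrow> real" where
  "rl_kernel \<kappa> s = s powr (\<kappa> - 1) / Gamma \<kappa>"

lemma RL_integral_eq_conv: "RL_integral \<kappa> g t = conv (rl_kernel \<kappa>) g t"
  by (simp add: RL_integral_def conv_def rl_kernel_def)

lemma rl_kernel_nonneg: "\<kappa> > 0 \<Longrightarrow> rl_kernel \<kappa> s \<ge> 0"
  by (simp add: rl_kernel_def Gamma_real_pos less_imp_le)

lemma laplace_rl_kernel:
  assumes \<kappa>: "\<kappa> > 0" and l: "p > 0"
  shows "set_integrable lborel {0..} (\<lambda>s. exp (- p * s) * rl_kernel \<kappa> s)" (is ?I)
    and "(LBINT s:{0..}. exp (- p * s) * rl_kernel \<kappa> s) = p powr (- \<kappa>)" (is ?V)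
proof -
  define F where "F = (\<lambda>x::real. indicator {0..} x * (x powr (\<kappa> - 1) / exp x))"
  have nn: "F x \<ge> 0" for x by (simp add: F_def indicator_def)
  have m: "F \<in> borel_measurable borel" unfolding F_def by measurable
  have "integral\<^sup>N lborel F = Gamma \<kappa>"
    using nn_integral_has_integral_lebesgue[OF _ Gamma_integral_real[OF \<kappa>]] by (simp add: F_def)
  then have hb: "has_bochner_integral lborel F (Gamma \<kappa>)"
    using nn m Gamma_real_pos[OF \<kappa>] by (intro has_bochner_integral_nn_integral) auto
  have eq: "indicator {0..} s *\<^sub>R (exp (- p * s) * rl_kernel \<kappa> s) = p powr (1 - \<kappa>) / Gamma \<kappa> * F (p * s)" for s
  proof (cases "s \<ge> 0")
    case True
    then have "p * s \<ge> 0" using l by simp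
    with True have "p powr (1 - \<kappa>) / Gamma \<kappa> * F (p * s)
       = (p powr (1 - \<kappa>) * p powr (\<kappa> - 1)) * (s powr (\<kappa> - 1) / exp (p * s) / Gamma \<kappa>)"
      using l by (simp add: F_def powr_mult mult_ac)
    also have "p powr (1 - \<kappa>) * p powr (\<kappa> - 1) = 1"
      using l by (simp flip: powr_add)
    finally show ?thesis using True by (simp add: rl_kernel_def exp_minus field_simps)
  next
    case False
    then show ?thesis using l by (auto simp: F_def indicator_def zero_le_mult_iff)
  qed
  have int: "integrable lborel (\<lambda>s. F (p * s))"
    using lborel_integrable_real_affine[of F p 0] hb l by (simp add: has_bochner_integral_iff)
  show ?I unfolding set_integrable_def eq using int by simp
  have "Gamma \<kappa> = p * (\<integral>s. F (p * s) \<partial>lborel)"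
    using lborel_integral_real_affine[of p F 0] hb l by (simp add: has_bochner_integral_iff)
  then have "(\<integral>s. F (p * s) \<partial>lborel) = Gamma \<kappa> / p" using l by (simp add: field_simps)
  moreover have "p powr (1 - \<kappa>) / p = p powr (- \<kappa>)"
    using l powr_diff[of p "1 - \<kappa>" 1] by simp
  ultimately show ?V unfolding set_lebesgue_integral_def eq using Gamma_real_pos[OF \<kappa>] by simp
qed

lemma rl_kernel_measurable [measurable]: "rl_kernel \<kappa> \<in> borel_measurable borel"
  unfolding rl_kernel_def[abs_def] by measurable

lemma rl_kernel_integrable:
  assumes \<kappa>: "\<kappa> > 0" shows "set_integrable lborel {0..b} (rl_kernel \<kappa>)"
  unfolding set_integrable_def
proof (rule Bochner_Integration.integrable_bound[OF _ _ AE_I2])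
  show "integrable lborel (\<lambda>s. exp b * (indicator {0..} s *\<^sub>R (exp (- 1 * s) * rl_kernel \<kappa> s)))"
    using laplace_rl_kernel(1)[OF \<kappa>, of 1] by (simp add: set_integrable_def)
  show "norm (indicator {0..b} s *\<^sub>R rl_kernel \<kappa> s) \<le> norm (exp b * (indicator {0..} s *\<^sub>R (exp (- 1 * s) * rl_kernel \<kappa> s)))" for s
  proof (cases "s \<in> {0..b}")
    case True
    then have "1 * rl_kernel \<kappa> s \<le> (exp b * exp (- s)) * rl_kernel \<kappa> s"
      using rl_kernel_nonneg[OF \<kappa>] by (intro mult_right_mono) (auto simp flip: exp_add)
    then show ?thesis using True rl_kernel_nonneg[OF \<kappa>, of s] by (simp add: abs_mult mult.assoc)
  qed auto
qed measurable

text \<open>The value of \<open>k\<close> at \<open>0\<close> is left free because the kernels in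
  question take the value \<open>0\<close> there: \<open>0 powr 0 = 0\<close> gives
  \<open>rl_kernel 1 0 = 0\<close>, and a convolution of two kernels vanishes at
  \<open>0\<close>.\<close>

lemma conv_eq_integral:
  assumes k: "\<And>s. 0 < s \<Longrightarrow> s \<le> t \<Longrightarrow> k s = 1" and h: "continuous_on {0..t} h"
  shows "conv k h t = integral {0..t} h"
proof -
  have "(\<integral>s. indicator {0..t} s *\<^sub>R (k (t - s) * h s) \<partial>lborel) = (\<integral>s. indicator {0..t} s *\<^sub>R h s \<partial>lborel)"
  proof (cases "t \<ge> 0")
    case False then show ?thesis by simp
  next
    case True
    have ne: "AE s in lborel. s \<noteq> t" by (rule AE_lborel_singleton)
    define H where "H = (\<lambda>s. indicator {0..t} s *\<^sub>R h s)"
    define H' where "H' = (\<lambda>s. if s = t then k 0 * h t else H s)"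
    have [measurable]: "H \<in> borel_measurable borel"
      unfolding H_def using borel_measurable_continuous_on_indicator[OF _ h] by simp
    have eq: "(\<lambda>s. indicator {0..t} s *\<^sub>R (k (t - s) * h s)) = H'"
      using k True by (auto simp: H'_def H_def fun_eq_iff indicator_def)
    have "integral\<^sup>L lborel H' = integral\<^sup>L lborel H"
    proof (rule integral_cong_AE)
      show "H' \<in> borel_measurable lborel" unfolding H'_def by measurable
      show "AE x in lborel. H' x = H x" using ne by eventually_elim (simp add: H'_def)
    qed measurable
    then show ?thesis unfolding eq H_def .
  qed
  then have "conv k h t = (LBINT s:{0..t}. h s)"
    by (simp add: conv_def set_lebesgue_integral_def)
  also have "\<dots> = integral {0..t} h"
    using borel_integrable_atLeastAtMost'[OF h] by (rule set_borel_integral_eq_integral)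
  finally show ?thesis .
qed

text \<open>Substituting \<open>s = t x\<close> produces \<open>Beta (1 - \<kappa>) \<kappa> = Gamma
  \<kappa> * Gamma (1 - \<kappa>)\<close>. The two powers of \<open>t\<close> have total degree
  \<open>-1\<close> and cancel against the Jacobian, so no \<open>t\<close> is left.\<close>

lemma conv_rl_kernel_complement:
  assumes \<kappa>: "0 < \<kappa>" "\<kappa> < 1" and t: "t > 0"
  shows "conv (rl_kernel \<kappa>) (rl_kernel (1 - \<kappa>)) t = 1"
proof -
  have G: "Gamma \<kappa> > 0" "Gamma (1 - \<kappa>) > 0" using \<kappa> by (auto intro: Gamma_real_pos)
  have "(LBINT x:{0..1}. x powr (1 - \<kappa> - 1) * (1 - x) powr (\<kappa> - 1)) = Beta (1 - \<kappa>) \<kappa>"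
    using set_borel_integral_eq_integral(2)[OF integrable_Beta[of "1 - \<kappa>" \<kappa>]]
      has_integral_Beta_real[of "1 - \<kappa>" \<kappa>] \<kappa> by (simp add: integral_unique)
  also have "\<dots> = Gamma \<kappa> * Gamma (1 - \<kappa>)" by (simp add: Beta_def)
  finally have B: "(\<integral>x. indicator {0..1} x *\<^sub>R (x powr (1 - \<kappa> - 1) * (1 - x) powr (\<kappa> - 1)) \<partial>lborel) = Gamma \<kappa> * Gamma (1 - \<kappa>)"
    by (simp add: set_lebesgue_integral_def)
  have "conv (rl_kernel \<kappa>) (rl_kernel (1 - \<kappa>)) t = (\<integral>s. indicator {0..t} s *\<^sub>R (rl_kernel \<kappa> (t - s) * rl_kernel (1 - \<kappa>) s) \<partial>lborel)"
    by (simp add: conv_def set_lebesgue_integral_def)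
  also have "\<dots> = t * (\<integral>x. indicator {0..t} (t * x) *\<^sub>R (rl_kernel \<kappa> (t - t * x) * rl_kernel (1 - \<kappa>) (t * x)) \<partial>lborel)"
    using t by (subst lborel_integral_real_affine[of t _ 0]) auto
  also have "(\<lambda>x. indicator {0..t} (t * x) *\<^sub>R (rl_kernel \<kappa> (t - t * x) * rl_kernel (1 - \<kappa>) (t * x)))
     = (\<lambda>x. (1 / t / (Gamma \<kappa> * Gamma (1 - \<kappa>))) * (indicator {0..1} x *\<^sub>R (x powr (1 - \<kappa> - 1) * (1 - x) powr (\<kappa> - 1))))"
  proof
    fix x
    show "indicator {0..t} (t * x) *\<^sub>R (rl_kernel \<kappa> (t - t * x) * rl_kernel (1 - \<kappa>) (t * x))
     = (1 / t / (Gamma \<kappa> * Gamma (1 - \<kappa>))) * (indicator {0..1} x *\<^sub>R (x powr (1 - \<kappa> - 1) * (1 - x) powr (\<kappa> - 1)))"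
    proof (cases "x \<in> {0..1}")
      case True
      have "rl_kernel \<kappa> (t - t * x) = t powr (\<kappa> - 1) * (1 - x) powr (\<kappa> - 1) / Gamma \<kappa>"
        using True t powr_mult[of t "1 - x" "\<kappa> - 1"] by (simp add: rl_kernel_def right_diff_distrib)
      moreover have "rl_kernel (1 - \<kappa>) (t * x) = t powr (- \<kappa>) * x powr (- \<kappa>) / Gamma (1 - \<kappa>)"
        using True t by (simp add: rl_kernel_def powr_mult)
      moreover have "t powr (\<kappa> - 1) * t powr (- \<kappa>) = 1 / t"
        using t powr_add[of t "\<kappa> - 1" "- \<kappa>"] by (simp add: powr_minus_divide)
      ultimately have "rl_kernel \<kappa> (t - t * x) * rl_kernel (1 - \<kappa>) (t * x) =
         (1 / t) * (x powr (- \<kappa>) * (1 - x) powr (\<kappa> - 1)) / (Gamma \<kappa> * Gamma (1 - \<kappa>))"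
        by (metis (no_types, lifting) times_divide_times_eq mult.assoc mult.commute mult.left_commute)
      then show ?thesis using True t by (simp add: mult_le_cancel_left1)
    next
      case False
      then have "t * x \<notin> {0..t}" using t by (auto simp: zero_le_mult_iff mult_le_cancel_left1)
      then show ?thesis using False by simp
    qed
  qed
  also have "t * (\<integral>x. (1 / t / (Gamma \<kappa> * Gamma (1 - \<kappa>))) * (indicator {0..1} x *\<^sub>R (x powr (1 - \<kappa> - 1) * (1 - x) powr (\<kappa> - 1))) \<partial>lborel) = 1"
    unfolding integral_mult_right_zero B using G t by simp
  finally show ?thesis .
qed

lemma conv_rl_kernel_conv_rl_kernel:
  assumes \<kappa>: "0 < \<kappa>" "\<kappa> < 1" and h: "continuous_on {0..t} h"
  shows "conv (rl_kernel (1 - \<kappa>)) (conv (rl_kernel \<kappa>) h) t = integral {0..t} h"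
proof -
  have "conv (rl_kernel (1 - \<kappa>)) (conv (rl_kernel \<kappa>) h) t = conv (conv (rl_kernel (1 - \<kappa>)) (rl_kernel \<kappa>)) h t"
    using \<kappa> h by (intro conv_assoc rl_kernel_integrable) auto
  also have "\<dots> = integral {0..t} h"
    using conv_rl_kernel_complement[of "1 - \<kappa>"] \<kappa> by (intro conv_eq_integral h) auto
  finally show ?thesis .
qed

lemma conv_rl_kernel_1: "continuous_on {0..t} h \<Longrightarrow> conv (rl_kernel 1) h t = integral {0..t} h"
  by (rule conv_eq_integral) (auto simp: rl_kernel_def)

lemma conv_0 [simp]: "conv k h 0 = 0"
proof -
  have "AE s::real in lborel. s \<noteq> 0" by (rule AE_lborel_singleton)
  then have "AE s in lborel. indicator {0..0} s *\<^sub>R (k (0 - s) * h s) = 0"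
    by eventually_elim auto
  then show ?thesis unfolding conv_def set_lebesgue_integral_def by (rule integral_eq_zero_AE)
qed

lemma integral_has_derivative_interior:
  fixes h :: "real \<Rightarrow> real"
  assumes h: "continuous_on {0..b} h" and t: "0 < t" "t < b"
  shows "((\<lambda>x. integral {0..x} h) has_real_derivative h t) (at t)"
  using integral_has_real_derivative[OF h, of t] t at_within_Icc_at[of 0 t b] by simp

text \<open>Convolution with the kernel of order \<open>1 - \<kappa>\<close> completes the integral
  of order \<open>\<kappa>\<close> to the ordinary integral of \<open>h\<close>, which the
  fundamental theorem differentiates.\<close>

lemma caputo_of_volterra:
  assumes \<kappa>: "0 < \<kappa>" "\<kappa> \<le> 1" and h: "continuous_on {0..} h"
    and g: "\<And>t. 0 \<le> t \<Longrightarrow> g t = c + conv (rl_kernel \<kappa>) h t" and t: "0 < t"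
  shows "has_caputo_derivative \<kappa> g (h t) t"
proof -
  have hb: "continuous_on {0..b} h" for b using h by (rule continuous_on_subset) auto
  have g0: "g 0 = c" using g[of 0] by simp
  have D: "((\<lambda>x. integral {0..x} h) has_real_derivative h t) (at t)"
    using integral_has_derivative_interior[OF hb, of t "t + 1"] t by simp
  have ev: "\<forall>\<^sub>F x in nhds t. x > 0"
    using t by (intro eventually_nhds_in_open[of "{0<..}" t, simplified]) auto
  show ?thesis
  proof (cases "\<kappa> = 1")
    case True
    have "\<forall>\<^sub>F x in nhds t. g x = c + integral {0..x} h"
      using ev by eventually_elim (use g True conv_rl_kernel_1[OF hb] in auto)
    then have "(g has_real_derivative h t) (at t) \<longleftrightarrow> ((\<lambda>x. c + integral {0..x} h) has_real_derivative h t) (at t)"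
      by (intro DERIV_cong_ev) auto
    then show ?thesis using D True by (auto simp: has_caputo_derivative_def intro!: derivative_eq_intros)
  next
    case False
    with \<kappa> have k1: "\<kappa> < 1" by simp
    have "\<forall>\<^sub>F x in nhds t. RL_integral (1 - \<kappa>) (\<lambda>s. g s - g 0) x = integral {0..x} h"
      using ev
    proof eventually_elim
      case (elim x)
      have "RL_integral (1 - \<kappa>) (\<lambda>s. g s - g 0) x = conv (rl_kernel (1 - \<kappa>)) (conv (rl_kernel \<kappa>) h) x"
        unfolding RL_integral_eq_conv using g g0 by (intro conv_cong) auto
      then show ?case using conv_rl_kernel_conv_rl_kernel[OF \<kappa>(1) k1 hb] by simp
    qed
    then have "(RL_integral (1 - \<kappa>) (\<lambda>s. g s - g 0) has_real_derivative h t) (at t)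
       \<longleftrightarrow> ((\<lambda>x. integral {0..x} h) has_real_derivative h t) (at t)"
      by (intro DERIV_cong_ev) auto
    then show ?thesis using D False by (simp add: has_caputo_derivative_def)
  qed
qed

text \<open>For \<open>u = g - g 0\<close> the hypothesis determines only the integral of
  \<open>u\<close> of order \<open>1 - \<kappa>\<close>, namely as the ordinary integral of
  \<open>h\<close>. A further integration of order \<open>\<kappa>\<close> turns this into an
  equality of the ordinary integrals of \<open>u\<close> and of
  \<open>conv (rl_kernel \<kappa>) h\<close>. Both integrands are continuous, so differentiation
  removes the integral signs.\<close>

lemma volterra_of_caputo:
  assumes \<kappa>: "0 < \<kappa>" "\<kappa> \<le> 1" and h: "continuous_on {0..b} h" and g: "continuous_on {0..b} g"
    and D: "\<And>t. 0 < t \<Longrightarrow> t < b \<Longrightarrow> has_caputo_derivative \<kappa> g (h t) t"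
    and t: "0 \<le> t" "t \<le> b"
  shows "g t = g 0 + conv (rl_kernel \<kappa>) h t"
proof (cases "0 < b")
  case False
  with t have "t = 0" by simp
  then show ?thesis by simp
next
  case b: True
  have FTC: "G x - G 0 = integral {0..x} h"
    if "continuous_on {0..b} G" "\<And>t. 0 < t \<Longrightarrow> t < b \<Longrightarrow> (G has_real_derivative h t) (at t)" "0 \<le> x" "x \<le> b" for G x
    using that by (intro integral_unique[symmetric] fundamental_theorem_of_calculus_interior)
      (auto simp flip: has_real_derivative_iff_has_vector_derivative intro: continuous_on_subset)
  show ?thesis
  proof (cases "\<kappa> = 1")
    case True
    have "g t - g 0 = integral {0..t} h"
      using D True t by (intro FTC g) (auto simp: has_caputo_derivative_def)
    moreover have "conv (rl_kernel \<kappa>) h t = integral {0..t} h"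
      unfolding True using t by (intro conv_rl_kernel_1 continuous_on_subset[OF h]) auto
    ultimately show ?thesis by simp
  next
    case False
    with \<kappa> have k1: "\<kappa> < 1" by simp
    define u where "u = (\<lambda>s. g s - g 0)"
    define G where "G = conv (rl_kernel (1 - \<kappa>)) u"
    have u: "continuous_on {0..b} u" unfolding u_def by (intro continuous_intros g)
    have G: "continuous_on {0..b} G"
      unfolding G_def using k1 by (intro continuous_on_conv rl_kernel_integrable u) auto
    have h': "continuous_on {0..x} h" and u': "continuous_on {0..x} u" if "x \<le> b" for x
      using that by (auto intro: continuous_on_subset[OF h] continuous_on_subset[OF u])
    have "RL_integral (1 - \<kappa>) u = G" unfolding G_def by (rule ext) (rule RL_integral_eq_conv)
    then have GI: "G x = conv (\<lambda>_. 1) h x" if "0 \<le> x" "x \<le> b" for x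
      using FTC[OF G _ that] D False that conv_eq_integral[OF _ h'[OF that(2)], of "\<lambda>_. 1"]
      by (auto simp: has_caputo_derivative_def u_def G_def)
    have kh: "continuous_on {0..b} (conv (rl_kernel \<kappa>) h)"
      using \<kappa> by (intro continuous_on_conv rl_kernel_integrable h) auto
    have one: "set_integrable lborel {0..x} (\<lambda>_::real. 1::real)" for x::real
      by (rule borel_integrable_atLeastAtMost') simp
    have eq: "integral {0..x} u = integral {0..x} (conv (rl_kernel \<kappa>) h)" if x: "x \<in> {0..b}" for x
    proof -
      have "integral {0..x} u = conv (rl_kernel \<kappa>) G x"
        unfolding G_def using conv_rl_kernel_conv_rl_kernel[of "1 - \<kappa>" x u] \<kappa> k1 x u' by simp
      also have "\<dots> = conv (rl_kernel \<kappa>) (conv (\<lambda>_. 1) h) x"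
        using GI x by (intro conv_cong) auto
      also have "\<dots> = conv (conv (rl_kernel \<kappa>) (\<lambda>_. 1)) h x"
        using \<kappa> x h' by (intro conv_assoc rl_kernel_integrable one) auto
      also have "conv (rl_kernel \<kappa>) (\<lambda>_. 1) = conv (\<lambda>_. 1) (rl_kernel \<kappa>)"
        by (rule ext) (rule conv_commute)
      also have "conv (conv (\<lambda>_. 1) (rl_kernel \<kappa>)) h x = conv (\<lambda>_. 1) (conv (rl_kernel \<kappa>) h) x"
        using \<kappa> x h' by (intro conv_assoc[symmetric] rl_kernel_integrable one) auto
      also have "\<dots> = integral {0..x} (conv (rl_kernel \<kappa>) h)"
        using x by (intro conv_eq_integral continuous_on_subset[OF kh]) auto
      finally show ?thesis .
    qed
    have "((\<lambda>x. integral {0..x} u) has_vector_derivative u t) (at t within {0..b})"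
      using integral_has_vector_derivative[OF u] t by simp
    moreover have "((\<lambda>x. integral {0..x} u) has_vector_derivative conv (rl_kernel \<kappa>) h t) (at t within {0..b})"
      by (rule has_vector_derivative_transform[OF _ eq integral_has_vector_derivative[OF kh]])
        (use t in auto)
    ultimately have "u t = conv (rl_kernel \<kappa>) h t"
      using vector_derivative_unique_within_closed_interval[OF b, of t] t by auto
    then show ?thesis by (simp add: u_def)
  qed
qed

section \<open>Exponential weights and a fractional Gronwall inequality\<close>

lemma conv_rl_kernel_exp_le:
  assumes \<kappa>: "\<kappa> > 0" and "p > 0"
  shows "conv (rl_kernel \<kappa>) (\<lambda>s. exp (p * s)) t \<le> exp (p * t) * p powr (- \<kappa>)"
proof -
  have "conv (rl_kernel \<kappa>) (\<lambda>s. exp (p * s)) t = conv (\<lambda>s. exp (p * s)) (rl_kernel \<kappa>) t" by (rule conv_commute)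
  also have "\<dots> = exp (p * t) * (LBINT s:{0..t}. exp (- p * s) * rl_kernel \<kappa> s)"
    unfolding conv_def by (simp add: right_diff_distrib exp_diff exp_minus field_simps flip: set_integral_mult_right)
  also have "(LBINT s:{0..t}. exp (- p * s) * rl_kernel \<kappa> s) \<le> (LBINT s:{0..}. exp (- p * s) * rl_kernel \<kappa> s)"
    unfolding set_lebesgue_integral_def
  proof (rule integral_mono)
    show "integrable lborel (\<lambda>s. indicator {0..} s *\<^sub>R (exp (- p * s) * rl_kernel \<kappa> s))"
      using laplace_rl_kernel(1)[OF assms] by (simp add: set_integrable_def)
    show "integrable lborel (\<lambda>s. indicator {0..t} s *\<^sub>R (exp (- p * s) * rl_kernel \<kappa> s))"
      using set_integrable_subset[OF laplace_rl_kernel(1)[OF assms], of "{0..t}"] by (simp add: set_integrable_def)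
  qed (use rl_kernel_nonneg[OF \<kappa>] in \<open>auto simp: indicator_def\<close>)
  also have "\<dots> = p powr (- \<kappa>)" by (rule laplace_rl_kernel(2)[OF assms])
  finally show ?thesis by simp
qed

text \<open>In the norm \<open>sup exp (- p t) |u t|\<close> an integral of order
  \<open>\<kappa>\<close> has norm at most \<open>p powr (- \<kappa>)\<close>. For large
  \<open>p\<close> both orders together cost less than a factor \<open>1/2\<close>, and the maximum
  \<open>M\<close> satisfies \<open>M \<le> M / 2\<close>. The same weight handles two different
  orders at once.\<close>

lemma fractional_gronwall_zero:
  assumes k: "\<kappa>\<^sub>1 > 0" "\<kappa>\<^sub>2 > 0" and L: "L \<ge> 0" and u: "continuous_on {0..b} u"
    and nn: "\<And>t. t \<in> {0..b} \<Longrightarrow> 0 \<le> u t"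
    and le: "\<And>t. t \<in> {0..b} \<Longrightarrow> u t \<le> L * (conv (rl_kernel \<kappa>\<^sub>1) u t + conv (rl_kernel \<kappa>\<^sub>2) u t)"
    and t: "t \<in> {0..b}"
  shows "u t = 0"
proof -
  have "((\<lambda>p. L * (p powr (- \<kappa>\<^sub>1) + p powr (- \<kappa>\<^sub>2))) \<longlongrightarrow> L * (0 + 0)) at_top"
    using k by (intro tendsto_intros tendsto_neg_powr filterlim_ident) auto
  then have "\<forall>\<^sub>F p in at_top. L * (p powr (- \<kappa>\<^sub>1) + p powr (- \<kappa>\<^sub>2)) < 1 / 2"
    by (intro order_tendstoD) auto
  then have "\<forall>\<^sub>F p in at_top. L * (p powr (- \<kappa>\<^sub>1) + p powr (- \<kappa>\<^sub>2)) < 1 / 2 \<and> 0 < p"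
    using eventually_gt_at_top[of 0] by eventually_elim auto
  then obtain p where l: "L * (p powr (- \<kappa>\<^sub>1) + p powr (- \<kappa>\<^sub>2)) < 1 / 2" "0 < p"
    using eventually_happens[of _ "at_top :: real filter"] by auto
  have c: "continuous_on {0..b} (\<lambda>t. exp (- p * t) * u t)" by (intro continuous_intros u)
  obtain m where m: "m \<in> {0..b}" "\<And>s. s \<in> {0..b} \<Longrightarrow> exp (- p * s) * u s \<le> exp (- p * m) * u m"
    using continuous_attains_sup[OF _ _ c] t by auto
  define M where "M = exp (- p * m) * u m"
  have M: "u s \<le> M * exp (p * s)" if "s \<in> {0..b}" for s
    using mult_right_mono[OF m(2)[OF that], of "exp (p * s)"] by (simp add: M_def exp_minus field_simps)
  have M0: "M \<ge> 0" using nn[OF m(1)] by (simp add: M_def)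
  have cvle: "conv (rl_kernel \<kappa>) u m \<le> M * (exp (p * m) * p powr (- \<kappa>))" if "\<kappa> > 0" for \<kappa>
  proof -
    have "\<bar>conv (rl_kernel \<kappa>) u m\<bar> \<le> conv (rl_kernel \<kappa>) (\<lambda>s. M * exp (p * s)) m"
      using m(1) that rl_kernel_nonneg[OF that] nn M
      by (intro conv_bound rl_kernel_integrable continuous_on_subset[OF u] continuous_intros) auto
    also have "\<dots> \<le> M * (exp (p * m) * p powr (- \<kappa>))"
      unfolding conv_cmult using M0 that l by (intro mult_left_mono conv_rl_kernel_exp_le) auto
    finally show ?thesis by simp
  qed
  have "M * exp (p * m) = u m" by (simp add: M_def exp_minus)
  also have "\<dots> \<le> L * (conv (rl_kernel \<kappa>\<^sub>1) u m + conv (rl_kernel \<kappa>\<^sub>2) u m)" by (rule le[OF m(1)])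
  also have "\<dots> \<le> L * (M * (exp (p * m) * p powr (- \<kappa>\<^sub>1)) + M * (exp (p * m) * p powr (- \<kappa>\<^sub>2)))"
    using L k by (intro mult_left_mono add_mono cvle) auto
  also have "\<dots> = (L * (p powr (- \<kappa>\<^sub>1) + p powr (- \<kappa>\<^sub>2))) * (M * exp (p * m))"
    by (simp add: algebra_simps)
  also have "\<dots> \<le> 1 / 2 * (M * exp (p * m))" using l M0 by (intro mult_right_mono) auto
  finally have "M * exp (p * m) \<le> 0" by simp
  then have "M \<le> 0" by (simp add: mult_le_0_iff) 
  with M0 have "M = 0" by simp
  with M[OF t] nn[OF t] show ?thesis by simp
qed

section \<open>Laplace transforms\<close>

lemma laplace_conv:
  fixes k g :: "real \<Rightarrow> real"
  assumes k: "set_integrable lborel {0..} (\<lambda>s. exp (- p * s) * k s)"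
    and g: "set_integrable lborel {0..} (\<lambda>s. exp (- p * s) * g s)"
  shows "set_integrable lborel {0..} (\<lambda>s. exp (- p * s) * conv k g s)"
    and "(LBINT s:{0..}. exp (- p * s) * conv k g s) =
      (LBINT s:{0..}. exp (- p * s) * k s) * (LBINT s:{0..}. exp (- p * s) * g s)"
proof -
  define K where "K = (\<lambda>s. indicator {0..} s * (exp (- p * s) * k s))"
  define G where "G = (\<lambda>s. indicator {0..} s * (exp (- p * s) * g s))"
  have K: "integrable lborel K" and G: "integrable lborel G"
    using k g by (simp_all add: set_integrable_def K_def G_def)
  have int: "integrable (lborel \<Otimes>\<^sub>M lborel) (case_prod (\<lambda>u t. G u * K (t - u)))"
    using integrable_shear[OF K G] by simp
  have eq: "indicator {0..} t * (exp (- p * t) * conv k g t) = (\<integral>u. G u * K (t - u) \<partial>lborel)" for t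
  proof -
    have "indicator {0..} t * (exp (- p * t) * conv k g t)
        = indicator {0..} t * (\<integral>u. exp (- p * t) * (indicator {0..t} u * (k (t - u) * g u)) \<partial>lborel)"
      by (simp add: conv_def set_lebesgue_integral_def)
    also have "\<dots> = (\<integral>u. indicator {0..} t * (exp (- p * t) * (indicator {0..t} u * (k (t - u) * g u))) \<partial>lborel)"
      by (rule integral_mult_right_zero[symmetric])
    also have "\<dots> = (\<integral>u. G u * K (t - u) \<partial>lborel)"
    proof (intro Bochner_Integration.integral_cong refl)
      fix u
      have "exp (- p * t) = exp (- p * u) * exp (- p * (t - u))"
        by (simp flip: exp_add add: algebra_simps)
      then show "indicator {0..} t * (exp (- p * t) * (indicator {0..t} u * (k (t - u) * g u))) = G u * K (t - u)"
        by (auto simp: G_def K_def indicator_def)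
    qed
    finally show ?thesis .
  qed
  show "set_integrable lborel {0..} (\<lambda>s. exp (- p * s) * conv k g s)"
    using lborel_pair.integrable_snd[OF int] unfolding set_integrable_def real_scaleR_def eq .
  have "(\<integral>t. \<integral>u. G u * K (t - u) \<partial>lborel \<partial>lborel) = (\<integral>u. \<integral>t. G u * K (t - u) \<partial>lborel \<partial>lborel)"
    by (rule lborel_pair.Fubini_integral[OF int])
  also have "\<dots> = (\<integral>u. G u * (\<integral>t. K t \<partial>lborel) \<partial>lborel)"
  proof (intro Bochner_Integration.integral_cong refl)
    fix u
    have "(\<integral>t. K (t - u) \<partial>lborel) = (\<integral>t. K t \<partial>lborel)"
      using lborel_integral_real_affine[of 1 K "-u"] by simp
    then show "(\<integral>t. G u * K (t - u) \<partial>lborel) = G u * (\<integral>t. K t \<partial>lborel)" by simp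
  qed
  also have "\<dots> = (\<integral>t. K t \<partial>lborel) * (\<integral>u. G u \<partial>lborel)" by simp
  finally show "(LBINT s:{0..}. exp (- p * s) * conv k g s) =
      (LBINT s:{0..}. exp (- p * s) * k s) * (LBINT s:{0..}. exp (- p * s) * g s)"
    unfolding set_lebesgue_integral_def real_scaleR_def eq K_def G_def .
qed

lemma set_integrable_exp:
  assumes "p > 0"
  shows "set_integrable lborel {0..} (\<lambda>s::real. exp (- p * s))"
  unfolding set_integrable_def
proof (rule Bochner_Integration.integrable_cong_AE_imp)
  show "integrable lborel (\<lambda>s. indicator {0..} s *\<^sub>R (exp (- p * s) * rl_kernel 1 s) :: real)"
    using laplace_rl_kernel(1)[of 1 p] assms by (simp add: set_integrable_def)
  have "AE s::real in lborel. s \<noteq> 0" by (rule AE_lborel_singleton)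
  then show "AE s in lborel. indicator {0..} s *\<^sub>R (exp (- p * s) * rl_kernel 1 s) = indicator {0..} s *\<^sub>R exp (- p * s)"
    by eventually_elim (simp add: rl_kernel_def)
qed measurable

lemma set_integrable_exp_mult:
  fixes g :: "real \<Rightarrow> real"
  assumes q: "q < p" and g: "continuous_on {0..} g" and B: "\<And>t. 0 \<le> t \<Longrightarrow> \<bar>g t\<bar> \<le> B * exp (q * t)"
  shows "set_integrable lborel {0..} (\<lambda>s. exp (- p * s) * g s)"
  unfolding set_integrable_def
proof (rule Bochner_Integration.integrable_bound)
  show "integrable lborel (\<lambda>s. B * (indicator {0..} s *\<^sub>R exp (- (p - q) * s)))"
    using set_integrable_exp[of "p - q"] q by (simp add: set_integrable_def)
  have "continuous_on {0..} (\<lambda>s. exp (- p * s) * g s)" by (intro continuous_intros g)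
  then show "(\<lambda>x. indicator {0..} x *\<^sub>R (exp (- p * x) * g x)) \<in> borel_measurable lborel"
    using borel_measurable_continuous_on_indicator[of "{0..}" "\<lambda>s. exp (- p * s) * g s"] by simp
  show "AE s in lborel. norm (indicator {0..} s *\<^sub>R (exp (- p * s) * g s))
      \<le> norm (B * (indicator {0..} s *\<^sub>R exp (- (p - q) * s)))"
  proof (rule AE_I2)
    fix s
    show "norm (indicator {0..} s *\<^sub>R (exp (- p * s) * g s)) \<le> norm (B * (indicator {0..} s *\<^sub>R exp (- (p - q) * s)))"
    proof (cases "s \<ge> 0")
      case True
      have "exp (- p * s) * \<bar>g s\<bar> \<le> exp (- p * s) * (B * exp (q * s))"
        using B[OF True] by (intro mult_left_mono) auto
      also have "\<dots> = B * exp (- (p - q) * s)" by (simp add: algebra_simps flip: exp_add)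
      also have "\<dots> \<le> \<bar>B\<bar> * exp (- (p - q) * s)" by (intro mult_right_mono) auto
      finally show ?thesis using True by (simp add: abs_mult)
    qed simp
  qed
qed

text \<open>With \<open>g t = exp (- 2 t) u t\<close>, which vanishes at infinity, \<open>v \<mapsto> g (- ln v)\<close> is a continuous function on
  \<open>[0, 1]\<close> all of whose moments vanish, so Weierstrass approximation applies.\<close>

lemma laplace_zero_imp_zero:
  fixes u :: "real \<Rightarrow> real"
  assumes u: "continuous_on {0..} u" and B: "\<And>t. 0 \<le> t \<Longrightarrow> \<bar>u t\<bar> \<le> B * exp t"
    and zero: "\<And>p. p > 1 \<Longrightarrow> (LBINT s:{0..}. exp (- p * s) * u s) = 0"
    and t: "0 \<le> t"
  shows "u t = 0"
proof -
  define g where "g = (\<lambda>t. exp (- 2 * t) * u t)"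
  define h where "h = (\<lambda>v. if v = 0 then 0 else g (- ln v))"
  have g: "continuous_on {0..} g" unfolding g_def by (intro continuous_intros u)
  have gB: "\<bar>g s\<bar> \<le> B * exp (- 1 * s)" if "0 \<le> s" for s
  proof -
    have "\<bar>g s\<bar> \<le> exp (- 2 * s) * (B * exp s)"
      unfolding g_def abs_mult using B[OF that] by (auto intro!: mult_left_mono)
    also have "\<dots> = B * exp (- 1 * s)" by (simp flip: exp_add)
    finally show ?thesis .
  qed
  have hB: "\<bar>h v\<bar> \<le> B * v" if "v \<in> {0..1}" for v
  proof (cases "v = 0")
    case False
    then have "0 < v" "v \<le> 1" using that by auto
    then show ?thesis using gB[of "- ln v"] by (simp add: h_def)
  qed (simp add: h_def)
  have hc: "continuous_on {0..1} h"
    unfolding continuous_on_eq_continuous_within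
  proof
    fix v :: real assume v: "v \<in> {0..1}"
    show "continuous (at v within {0..1}) h"
    proof (cases "v = 0")
      case True
      have "((\<lambda>x. B * x) \<longlongrightarrow> B * 0) (at 0 within {0..1})" by (intro tendsto_intros)
      moreover have "\<forall>\<^sub>F x in at 0 within {0..1}. norm (h x) \<le> B * x"
        using hB by (simp add: eventually_at_filter)
      ultimately have "(h \<longlongrightarrow> 0) (at 0 within {0..1})"
        using Lim_null_comparison[of h "\<lambda>x. B * x"] by simp
      then show ?thesis unfolding True continuous_within by (simp add: h_def)
    next
      case False
      with v have v0: "0 < v" "v \<le> 1" by auto
      have "continuous_on {0<..1} (\<lambda>v. g (- ln v))"
        by (rule continuous_on_compose2[OF g]) (auto intro!: continuous_intros)
      then have "continuous_on {0<..1} h"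
        by (rule continuous_on_eq) (auto simp: h_def)
      then have "continuous (at v within {0<..1}) h"
        using v0 by (simp add: continuous_on_eq_continuous_within)
      moreover have "at v within {0..1} = at v within {0<..1}"
        using v0 by (intro at_within_nhd[of v "{0<..}"]) auto
      ultimately show ?thesis by simp
    qed
  qed
  \<comment> \<open>The factor \<open>exp (- s)\<close> is the Jacobian of
    \<open>v = exp (- s)\<close>: integrals of \<open>\<phi> (exp (- s)) * w s\<close> over the
    half-line are integrals of \<open>\<phi> v * h v\<close> over \<open>[0, 1]\<close>.\<close>
  define w where "w = (\<lambda>s. exp (- s) * g s)"
  have w_int: "set_integrable lborel {0..} (\<lambda>s. exp (- p * s) * g s)" if "p \<ge> 0" for p
    using that by (intro set_integrable_exp_mult[of "-1" p g B] g gB) auto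
  \<comment> \<open>Since \<open>w s = exp (- 3 s) u s\<close>, the moment of order \<open>i\<close>
    is the transform of \<open>u\<close> at \<open>i + 3\<close>, which lies in the range
    \<open>p > 1\<close> of the hypothesis.\<close>
  have e: "exp (- s) ^ i = exp (- (real i * s))" for s :: real and i
    using exp_of_nat_mult[of i "- s"] by simp
  have mom: "(LBINT s:{0..}. exp (- s) ^ i * w s) = 0" for i
  proof -
    have "(LBINT s:{0..}. exp (- s) ^ i * w s) = (LBINT s:{0..}. exp (- (real i + 3) * s) * u s)"
      unfolding w_def g_def e mult.assoc[symmetric] exp_add[symmetric] by (simp add: algebra_simps)
    also have "\<dots> = 0" by (rule zero) simp
    finally show ?thesis .
  qed
  have mom_int: "set_integrable lborel {0..} (\<lambda>s. exp (- s) ^ i * w s)" for i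
  proof -
    have "(\<lambda>s. exp (- s) ^ i * w s) = (\<lambda>s. exp (- (real i + 1) * s) * g s)"
      unfolding w_def e mult.assoc[symmetric] exp_add[symmetric] by (simp add: algebra_simps)
    then show ?thesis using w_int[of "real i + 1"] by simp
  qed
  have w2: "set_integrable lborel {0..} (\<lambda>s. \<bar>w s\<bar>)"
    using set_integrable_abs[OF mom_int[of 0]] by simp
  have sq_int: "set_integrable lborel {0..} (\<lambda>s. h (exp (- s)) * w s)"
  proof -
    have "set_integrable lborel {0..} (\<lambda>s. exp (- 1 * s) * (g s * g s))"
    proof (rule set_integrable_exp_mult[of "-2"])
      show "continuous_on {0..} (\<lambda>s. g s * g s)" by (intro continuous_intros g)
      show "\<bar>g s * g s\<bar> \<le> (B * B) * exp (- 2 * s)" if "0 \<le> s" for s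
      proof -
        have "\<bar>g s\<bar> * \<bar>g s\<bar> \<le> (B * exp (- 1 * s)) * (B * exp (- 1 * s))"
          using gB[OF that] by (intro mult_mono) (auto intro: order_trans[OF abs_ge_zero])
        also have "\<dots> = (B * B) * exp (- 2 * s)" by (simp flip: exp_add)
        finally show ?thesis by (simp add: abs_mult)
      qed
    qed simp
    also have "(\<lambda>s. exp (- 1 * s) * (g s * g s)) = (\<lambda>s. h (exp (- s)) * w s)"
      by (auto simp: h_def w_def)
    finally show ?thesis .
  qed
  \<comment> \<open>In the variable \<open>v\<close> this is the integral of
    \<open>h\<^sup>2\<close>. Replacing one factor \<open>h\<close> by a polynomial gives
    \<open>0\<close> by the moments, so \<open>I\<close> is at most the uniform approximation error
    times \<open>W\<close>.\<close>
  define I where "I = (LBINT s:{0..}. h (exp (- s)) * w s)"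
  define W where "W = (LBINT s:{0..}. \<bar>w s\<bar>)"
  have W0: "W \<ge> 0" unfolding W_def set_lebesgue_integral_def by (intro integral_nonneg_AE) auto
  have bound: "\<bar>I\<bar> \<le> e * W" if e: "e > 0" for e
  proof -
    obtain P where P: "real_polynomial_function P" "\<And>x. x \<in> {0..1} \<Longrightarrow> \<bar>h x - P x\<bar> < e"
      using Stone_Weierstrass_real_polynomial_function[OF _ hc e] by auto
    obtain a n where a: "P = (\<lambda>x. \<Sum>i\<le>n. a i * x ^ i)"
      using real_polynomial_function_imp_sum[OF P(1)] by auto
    have Peq: "P (exp (- s)) * w s = (\<Sum>i\<le>n. a i * (exp (- s) ^ i * w s))" for s
      by (simp add: a sum_distrib_right mult.assoc)
    define m where "m = (\<lambda>i s. indicator {0..} s *\<^sub>R (exp (- s) ^ i * w s))"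
    have m: "integrable lborel (m i)" "integral\<^sup>L lborel (m i) = 0" for i
      using mom[of i] mom_int[of i] by (simp_all add: m_def set_integrable_def set_lebesgue_integral_def)
    have Peq': "indicator {0..} s *\<^sub>R (P (exp (- s)) * w s) = (\<Sum>i\<le>n. a i * m i s)" for s
      unfolding Peq m_def by (simp add: sum_distrib_left mult.left_commute)
    have P_int: "set_integrable lborel {0..} (\<lambda>s. P (exp (- s)) * w s)"
      unfolding set_integrable_def Peq' using m by simp
    have P0: "(LBINT s:{0..}. P (exp (- s)) * w s) = 0"
      unfolding set_lebesgue_integral_def Peq' using m by simp
    have "I = (LBINT s:{0..}. h (exp (- s)) * w s - P (exp (- s)) * w s)"
      unfolding I_def using P0 set_integral_diff(2)[OF sq_int P_int] by simp
    also have "\<bar>\<dots>\<bar> \<le> (LBINT s:{0..}. \<bar>h (exp (- s)) * w s - P (exp (- s)) * w s\<bar>)"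
      using set_integral_norm_bound[OF set_integral_diff(1)[OF sq_int P_int]] by simp
    also have "\<dots> \<le> (LBINT s:{0..}. e * \<bar>w s\<bar>)"
    proof (rule set_integral_mono)
      show "set_integrable lborel {0..} (\<lambda>s. \<bar>h (exp (- s)) * w s - P (exp (- s)) * w s\<bar>)"
        by (rule set_integrable_abs[OF set_integral_diff(1)[OF sq_int P_int]])
      show "set_integrable lborel {0..} (\<lambda>s. e * \<bar>w s\<bar>)" using w2 by simp
      show "\<bar>h (exp (- s)) * w s - P (exp (- s)) * w s\<bar> \<le> e * \<bar>w s\<bar>" if "s \<in> {0..}" for s
        using P(2)[of "exp (- s)"] that
        by (auto simp flip: left_diff_distrib simp: abs_mult intro!: mult_right_mono)
    qed
    also have "\<dots> = e * W" by (simp add: W_def)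
    finally show ?thesis .
  qed
  have I0: "I = 0"
  proof (rule ccontr)
    assume "I \<noteq> 0"
    then have "\<bar>I\<bar> \<le> \<bar>I\<bar> / (2 * (W + 1)) * W" using W0 by (intro bound) auto
    also have "\<dots> < \<bar>I\<bar>" using W0 \<open>I \<noteq> 0\<close> by (simp add: field_simps add_nonneg_pos)
    finally show False by simp
  qed
  have hw: "h (exp (- s)) * w s = exp (- s) * (g s)\<^sup>2" for s
    by (simp add: h_def w_def power2_eq_square)
  have hwc: "continuous_on {0..b} (\<lambda>s. exp (- s) * (g s)\<^sup>2)" for b
    by (intro continuous_intros continuous_on_subset[OF g]) auto
  have "(LBINT s:{0..t + 1}. exp (- s) * (g s)\<^sup>2) \<le> (LBINT s:{0..}. exp (- s) * (g s)\<^sup>2)"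
    using sq_int set_integrable_subset[OF sq_int, of "{0..t + 1}"]
    unfolding hw set_lebesgue_integral_def set_integrable_def
    by (intro integral_mono) (auto simp: indicator_def)
  also have "\<dots> = 0" using I0 by (simp add: I_def hw)
  finally have "integral {0..t + 1} (\<lambda>s. exp (- s) * (g s)\<^sup>2) \<le> 0"
    using set_borel_integral_eq_integral(2)[OF borel_integrable_atLeastAtMost'[OF hwc]] by simp
  moreover have "integral {0..t + 1} (\<lambda>s. exp (- s) * (g s)\<^sup>2) \<ge> 0"
    by (intro integral_nonneg integrable_continuous_interval hwc) auto
  ultimately have "integral {0..t + 1} (\<lambda>s. exp (- s) * (g s)\<^sup>2) = 0" by simp
  then have "\<forall>s\<in>{0..t + 1}. exp (- s) * (g s)\<^sup>2 = 0"
    using t by (subst (asm) integral_eq_0_iff[OF hwc]) auto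
  then have "g t = 0" using t by auto
  then show ?thesis by (simp add: g_def)
qed

section \<open>Laplace inversion on a sector\<close>

text \<open>The substitution \<open>s = w\<^sup>2\<close> turns a sector around the right half plane, which is not convex, into one of
  half-angle below \<open>\<pi>/2\<close>. On convex sets Cauchy's formula is available for functions that, like
  \<open>w powr (2 * \<alpha>)\<close> at \<open>0\<close>, are merely continuous on the boundary.\<close>

definition sector :: "real \<Rightarrow> complex set" where
  "sector \<tau> = {w. \<bar>Im w\<bar> \<le> \<tau> * Re w}"

lemma convex_sector: "\<tau> \<ge> 0 \<Longrightarrow> convex (sector \<tau>)"
proof (rule convexI)
  fix x y :: complex and u v :: real
  assume a: "x \<in> sector \<tau>" "y \<in> sector \<tau>" "0 \<le> u" "0 \<le> v"
  have "\<bar>u * Im x + v * Im y\<bar> \<le> u * \<bar>Im x\<bar> + v * \<bar>Im y\<bar>"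
    using a abs_triangle_ineq[of "u * Im x" "v * Im y"] by (simp add: abs_mult)
  also have "\<dots> \<le> u * (\<tau> * Re x) + v * (\<tau> * Re y)"
    using a by (intro add_mono mult_left_mono) (auto simp: sector_def)
  finally show "u *\<^sub>R x + v *\<^sub>R y \<in> sector \<tau>" by (simp add: sector_def algebra_simps)
qed

lemma sector_Re_nonneg: "w \<in> sector \<tau> \<Longrightarrow> \<tau> > 0 \<Longrightarrow> Re w \<ge> 0"
  by (auto simp: sector_def intro: zero_le_mult_iff[THEN iffD1, THEN disjE, of \<tau> "Re w"] dest: order_trans[OF abs_ge_zero])

lemma sector_Re_pos: "w \<in> sector \<tau> \<Longrightarrow> \<tau> > 0 \<Longrightarrow> w \<noteq> 0 \<Longrightarrow> Re w > 0"
  using sector_Re_nonneg[of w \<tau>] by (auto simp: sector_def complex_eq_iff le_less)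

lemma interior_sector_open: "{w. \<bar>Im w\<bar> < \<tau> * Re w} \<subseteq> interior (sector \<tau>)"
proof (rule interior_maximal)
  have "open ({w. Im w < \<tau> * Re w} \<inter> {w. - Im w < \<tau> * Re w})"
    by (intro open_Int open_Collect_less continuous_intros)
  also have "({w. Im w < \<tau> * Re w} \<inter> {w. - Im w < \<tau> * Re w}) = {w. \<bar>Im w\<bar> < \<tau> * Re w}"
    by auto
  finally show "open {w. \<bar>Im w\<bar> < \<tau> * Re w}" .
qed (auto simp: sector_def)

text \<open>With \<open>s = w\<^sup>2\<close> and \<open>p = \<sigma>\<^sup>2\<close> the form
  \<open>2 w dw / (\<sigma>\<^sup>2 - w\<^sup>2)\<close> is \<open>ds / (p - s)\<close>, and
  \<open>1 / (p - s)\<close> is the Laplace transform of \<open>exp (s t)\<close> at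
  \<open>p\<close>. Of the two poles only \<open>\<sigma>\<close> lies in the sector; the factor
  \<open>w + \<sigma>\<close> is absorbed into \<open>g\<close>, and
  \<open>g \<sigma> = - r \<sigma>\<close>.\<close>

lemma sector_cauchy_triangle:
  fixes r :: "complex \<Rightarrow> complex"
  assumes \<tau>: "\<tau> > 0" and \<sigma>: "0 < \<sigma>" "\<sigma> < \<rho>"
    and cont: "continuous_on (sector \<tau>) r"
    and hol: "\<And>w. w \<in> interior (sector \<tau>) \<Longrightarrow> r field_differentiable at w"
  defines "h \<equiv> \<lambda>w. 2 * w * r w / (of_real (\<sigma>\<^sup>2) - w\<^sup>2)"
  defines "b \<equiv> Complex \<rho> (- \<rho> * \<tau>)" and "c \<equiv> Complex \<rho> (\<rho> * \<tau>)"
  shows "contour_integral (linepath 0 b) h + contour_integral (linepath b c) h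
       - contour_integral (linepath 0 c) h = - (2 * pi * \<i> * r (of_real \<sigma>))"
    and "h contour_integrable_on linepath 0 c" "h contour_integrable_on linepath b c"
proof -
  define S where "S = sector \<tau>"
  define g where "g = (\<lambda>w. - 2 * w * r w / (w + of_real \<sigma>))"
  have S: "convex S" using convex_sector[of \<tau>] \<tau> by (simp add: S_def)
  have nz: "w + of_real \<sigma> \<noteq> 0" if "w \<in> S" for w
    using sector_Re_nonneg[of w \<tau>] that \<tau> \<sigma> by (auto simp: S_def complex_eq_iff)
  have gc: "continuous_on S g"
    unfolding g_def using nz cont by (intro continuous_intros) (auto simp: S_def)
  have gd: "g field_differentiable at w" if "w \<in> interior S - {}" for w
    unfolding g_def using nz that interior_subset hol by (intro derivative_intros) (auto simp: S_def)
  have hg: "h w = g w / (w - of_real \<sigma>)" if "w \<in> S" for w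
  proof (cases "w = of_real \<sigma>")
    case False
    have "of_real (\<sigma>\<^sup>2) - w\<^sup>2 = - ((w + of_real \<sigma>) * (w - of_real \<sigma>))"
      by (simp add: power2_eq_square algebra_simps)
    then show ?thesis by (simp add: h_def g_def)
  qed (simp add: h_def)
  have in_S: "0 \<in> S" "b \<in> S" "c \<in> S"
    using \<tau> \<sigma> by (auto simp: S_def sector_def b_def c_def abs_mult)
  have seg: "closed_segment x y \<subseteq> S" if "x \<in> S" "y \<in> S" for x y
    using that S by (simp add: closed_segment_subset)
  have ns: "of_real \<sigma> \<notin> closed_segment 0 b" "of_real \<sigma> \<notin> closed_segment 0 c" "of_real \<sigma> \<notin> closed_segment b c"
    using \<tau> \<sigma> by (auto simp: in_segment b_def c_def complex_eq_iff algebra_simps)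
  have h_int: "h contour_integrable_on linepath x y"
    if "x \<in> S" "y \<in> S" "of_real \<sigma> \<notin> closed_segment x y" for x y
  proof (rule contour_integrable_continuous_linepath)
    have "continuous_on (closed_segment x y) (\<lambda>w. g w / (w - of_real \<sigma>))"
      using that seg[OF that(1,2)] by (intro continuous_intros continuous_on_subset[OF gc]) auto
    then show "continuous_on (closed_segment x y) h"
      by (rule continuous_on_eq) (use hg seg[OF that(1,2)] in auto)
  qed
  note hi = h_int[OF in_S(1,2) ns(1)] h_int[OF in_S(1,3) ns(2)] h_int[OF in_S(2,3) ns(3)]
  show "h contour_integrable_on linepath 0 c" "h contour_integrable_on linepath b c" by fact+
  have hi': "h contour_integrable_on linepath c 0"
    using h_int[OF in_S(3,1)] ns(2) by (simp add: closed_segment_commute)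
  let ?\<gamma> = "linepath 0 b +++ linepath b c +++ linepath c 0"
  have inner: "{w. \<bar>Im w\<bar> < \<tau> * Re w} \<inter> {w. Re w < \<rho>} \<subseteq> interior (convex hull {0, b, c})"
  proof (rule interior_maximal)
    have "open ({w. Im w < \<tau> * Re w} \<inter> {w. - Im w < \<tau> * Re w} \<inter> {w. Re w < \<rho>})"
      by (intro open_Int open_Collect_less continuous_intros)
    also have "({w. Im w < \<tau> * Re w} \<inter> {w. - Im w < \<tau> * Re w} \<inter> {w. Re w < \<rho>}) = {w. \<bar>Im w\<bar> < \<tau> * Re w} \<inter> {w. Re w < \<rho>}"
      by auto
    finally show "open ({w. \<bar>Im w\<bar> < \<tau> * Re w} \<inter> {w. Re w < \<rho>})" .
    show "{w. \<bar>Im w\<bar> < \<tau> * Re w} \<inter> {w. Re w < \<rho>} \<subseteq> convex hull {0, b, c}"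
    proof
      fix w assume "w \<in> {w. \<bar>Im w\<bar> < \<tau> * Re w} \<inter> {w. Re w < \<rho>}"
      then have w: "\<bar>Im w\<bar> < \<tau> * Re w" "Re w < \<rho>" by auto
      define v where "v = (Re w / \<rho> - Im w / (\<rho> * \<tau>)) / 2"
      define u where "u = (Re w / \<rho> + Im w / (\<rho> * \<tau>)) / 2"
      have \<rho>: "\<rho> > 0" using \<sigma> by simp
      have "v \<ge> 0" "u \<ge> 0"
        using w \<rho> \<tau> by (auto simp: u_def v_def field_simps abs_less_iff)
      moreover have "u + v = Re w / \<rho>" by (simp add: u_def v_def field_simps)
      moreover have "Re w / \<rho> \<le> 1" using w \<rho> by simp
      moreover have "w = v *\<^sub>R b + u *\<^sub>R c"
        using \<rho> \<tau> by (simp add: complex_eq_iff b_def c_def u_def v_def field_simps)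
      ultimately show "w \<in> convex hull {0, b, c}"
        unfolding convex_hull_3
        by (intro CollectI exI[of _ "1 - (u + v)"] exI[of _ v] exI[of _ u]) auto
    qed
  qed
  have "of_real \<sigma> \<in> interior (convex hull {0, b, c})"
    using inner \<tau> \<sigma> by auto
  from winding_number_triangle[OF this]
  have wn: "winding_number ?\<gamma> (of_real \<sigma>) = 1"
    using \<tau> \<sigma> by (simp add: b_def algebra_simps)
  have "((\<lambda>w. g w / (w - of_real \<sigma>)) has_contour_integral (2*pi * \<i> * winding_number ?\<gamma> (of_real \<sigma>) * g (of_real \<sigma>))) ?\<gamma>"
  proof (rule Cauchy_integral_formula_weak[OF S _ gc gd])
    show "complex_of_real \<sigma> \<in> interior S - {}"
      using interior_sector_open[of \<tau>] \<tau> \<sigma> by (auto simp: S_def)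
    show "path_image ?\<gamma> \<subseteq> S - {of_real \<sigma>}"
      using seg in_S ns by (auto simp: path_image_join closed_segment_commute[of c 0])
  qed (auto intro!: valid_path_join)
  also have "g (of_real \<sigma>) = - r (of_real \<sigma>)" using \<sigma> by (simp add: g_def)
  finally have "((\<lambda>w. g w / (w - of_real \<sigma>)) has_contour_integral - (2 * pi * \<i> * r (of_real \<sigma>))) ?\<gamma>"
    by (simp only: wn mult_1_right mult_minus_right of_real_mult of_real_numeral of_real_1)
  then have "(h has_contour_integral - (2 * pi * \<i> * r (of_real \<sigma>))) ?\<gamma>"
  proof (rule has_contour_integral_eq)
    fix w assume "w \<in> path_image ?\<gamma>"
    then have "w \<in> S"
      using seg[OF in_S(1,2)] seg[OF in_S(2,3)] seg[OF in_S(3,1)] by (auto simp: path_image_join)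
    then show "g w / (w - of_real \<sigma>) = h w" using hg by simp
  qed
  then have "contour_integral ?\<gamma> h = - (2 * pi * \<i> * r (of_real \<sigma>))"
    by (rule contour_integral_unique)
  also have "contour_integral ?\<gamma> h = contour_integral (linepath 0 b) h + (contour_integral (linepath b c) h + contour_integral (linepath c 0) h)"
    using hi hi' by (simp add: valid_path_join contour_integrable_joinI)
  also have "contour_integral (linepath c 0) h = - contour_integral (linepath 0 c) h"
    using contour_integral_reversepath[of "linepath 0 c" h] by simp
  finally show "contour_integral (linepath 0 b) h + contour_integral (linepath b c) h
       - contour_integral (linepath 0 c) h = - (2 * pi * \<i> * r (of_real \<sigma>))"
    by (simp only: add_uminus_conv_diff add.assoc add_diff_eq)
qed

text \<open>As the triangle grows, its chord has length of order \<open>\<rho>\<close> while the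
  integrand on it is of order \<open>\<rho> powr (- 1 - \<nu>)\<close>, so the chord disappears for
  any positive rate \<open>\<nu>\<close>. By the symmetry of \<open>r\<close> the lower ray
  contributes the conjugate of the upper one, and the difference of the two is \<open>2 \<i>\<close>
  times an imaginary part.\<close>

lemma sector_ray_integral:
  fixes r :: "complex \<Rightarrow> complex"
  assumes \<tau>: "\<tau> > 0" and \<sigma>: "0 < \<sigma>" and \<nu>: "\<nu> > 0"
    and cont: "continuous_on (sector \<tau>) r"
    and hol: "\<And>w. w \<in> interior (sector \<tau>) \<Longrightarrow> r field_differentiable at w"
    and cnj_r: "\<And>w. w \<in> sector \<tau> \<Longrightarrow> r (cnj w) = cnj (r w)"
    and decay: "\<And>w. w \<in> sector \<tau> \<Longrightarrow> w \<noteq> 0 \<Longrightarrow> norm (r w) \<le> C * norm w powr (- \<nu>)"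
  defines "d \<equiv> Complex 1 \<tau>"
  defines "\<phi> \<equiv> \<lambda>q::real. 2 * of_real q * d\<^sup>2 * r (of_real q * d) / (of_real (\<sigma>\<^sup>2) - of_real (q\<^sup>2) * d\<^sup>2)"
  assumes int: "set_integrable lborel {0..} \<phi>"
  shows "Im (LBINT q:{0..}. \<phi> q) = pi * Re (r (of_real \<sigma>))"
proof -
  define h where "h = (\<lambda>w. 2 * w * r w / (of_real (\<sigma>\<^sup>2) - w\<^sup>2))"
  define I where "I = (\<lambda>\<rho>. LBINT q:{0..\<rho>}. \<phi> q)"
  have lim: "(I \<longlongrightarrow> (LBINT q:{0..}. \<phi> q)) at_top"
    unfolding I_def using int by (intro tendsto_set_lebesgue_integral_at_top) auto
  have C: "C \<ge> 0" using decay[of 1] \<tau> by (auto simp: sector_def intro: order_trans[OF norm_ge_zero])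
  have bound: "\<bar>Im (I \<rho>) - pi * Re (r (of_real \<sigma>))\<bar> \<le> 4 * C * \<tau> * \<rho> powr (- \<nu>)"
    if \<rho>: "\<rho> > 2 * \<sigma>" for \<rho>
  proof -
    define b where "b = Complex \<rho> (- \<rho> * \<tau>)"
    define c where "c = Complex \<rho> (\<rho> * \<tau>)"
    have \<rho>0: "\<rho> > 0" "\<sigma> < \<rho>" using \<rho> \<sigma> by auto
    note tri = sector_cauchy_triangle[OF \<tau> \<sigma> \<rho>0(2) cont hol, folded h_def b_def c_def]
    have cb: "cnj c = b" by (simp add: b_def c_def complex_eq_iff)
    have I_eq: "contour_integral (linepath 0 c) h = I \<rho>"
    proof -
      have "set_integrable lborel {0..\<rho>} \<phi>" using int by (rule set_integrable_subset) auto
      from set_borel_integral_eq_integral[OF this] have "(\<phi> has_integral I \<rho>) {0..\<rho>}"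
        by (simp add: I_def has_integral_integral)
      from has_integral_stretch_real[OF this, of \<rho>]
      have "((\<lambda>x. \<phi> (\<rho> * x)) has_integral (1 / \<rho>) *\<^sub>R I \<rho>) {0..1}"
        using \<rho>0 by (simp add: image_divide_atLeastAtMost)
      from has_integral_mult_right[OF this, of "of_real \<rho>"]
      have "((\<lambda>x. of_real \<rho> * \<phi> (\<rho> * x)) has_integral I \<rho>) {0..1}"
        using \<rho>0 by (simp add: scaleR_conv_of_real)
      moreover have "of_real \<rho> * \<phi> (\<rho> * x) = h (linepath 0 c x) * (c - 0)" for x
      proof -
        have c: "c = of_real \<rho> * d" by (simp add: c_def d_def complex_eq_iff)
        show ?thesis
          by (simp add: h_def \<phi>_def c linepath_def scaleR_conv_of_real power2_eq_square mult_ac)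
      qed
      ultimately have "(h has_contour_integral I \<rho>) (linepath 0 c)"
        by (simp add: has_contour_integral_linepath)
      then show ?thesis by (rule contour_integral_unique)
    qed
    have "contour_integral (linepath 0 b) h = integral {0..1} (\<lambda>x. h (linepath 0 b x) * b)"
      by (simp add: contour_integral_integral)
    also have "\<dots> = integral {0..1} (\<lambda>x. cnj (h (linepath 0 c x) * c))"
    proof (rule integral_cong)
      fix x :: real assume x: "x \<in> {0..1}"
      have "linepath 0 c x \<in> sector \<tau>"
        using x \<rho>0 \<tau> by (simp add: linepath_def sector_def c_def abs_mult)
      moreover have "linepath 0 b x = cnj (linepath 0 c x)" by (simp add: linepath_def cb)
      ultimately show "h (linepath 0 b x) * b = cnj (h (linepath 0 c x) * c)"
        using cnj_r[of "linepath 0 c x"] by (simp add: h_def cb)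
    qed
    also have "\<dots> = cnj (integral {0..1} (\<lambda>x. h (linepath 0 c x) * c))"
      by (rule integral_cnj[symmetric])
    also have "integral {0..1} (\<lambda>x. h (linepath 0 c x) * c) = contour_integral (linepath 0 c) h"
      by (simp add: contour_integral_integral)
    finally have low: "contour_integral (linepath 0 b) h = cnj (I \<rho>)" unfolding I_eq .
    have chord: "norm (contour_integral (linepath b c) h) \<le> 4 * C * \<rho> powr (- 1 - \<nu>) * norm (c - b)"
    proof (rule contour_integral_bound_linepath)
      show "h contour_integrable_on linepath b c" by (rule tri)
      show "0 \<le> 4 * C * \<rho> powr (- 1 - \<nu>)" using C by simp
      fix w assume "w \<in> closed_segment b c"
      then obtain u where u: "0 \<le> u" "u \<le> 1" "w = (1 - u) *\<^sub>R b + u *\<^sub>R c" by (auto simp: in_segment)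
      have wS: "w \<in> sector \<tau>"
      proof -
        have "b \<in> sector \<tau>" "c \<in> sector \<tau>" using \<rho>0 \<tau> by (auto simp: b_def c_def sector_def abs_mult)
        then show ?thesis using convex_sector[of \<tau>] \<tau> u unfolding convex_alt by auto
      qed
      have Rw: "Re w = \<rho>" by (simp add: u b_def c_def algebra_simps)
      then have nw: "norm w \<ge> \<rho>" using complex_Re_le_cmod[of w] by simp
      have w0: "w \<noteq> 0" using Rw \<rho>0 by auto
      \<comment> \<open>Here \<open>\<rho> > 2 * \<sigma>\<close> enters: the pole is far enough
        from the chord for the denominator to stay above half of the square of
        \<open>norm w\<close>.\<close>
      have "(2 * \<sigma>)\<^sup>2 \<le> (norm w)\<^sup>2" using \<rho> \<sigma> nw by (intro power_mono) auto
      then have "4 * \<sigma>\<^sup>2 \<le> (norm w)\<^sup>2" by (simp add: power_mult_distrib)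
      then have sw: "\<sigma>\<^sup>2 \<le> (norm w)\<^sup>2 / 2"
        using zero_le_power2[of \<sigma>] by linarith
      have "norm (w\<^sup>2) - norm (of_real (\<sigma>\<^sup>2) :: complex) \<le> norm (w\<^sup>2 - of_real (\<sigma>\<^sup>2))"
        by (rule norm_triangle_ineq2)
      then have den: "norm (of_real (\<sigma>\<^sup>2) - w\<^sup>2) \<ge> (norm w)\<^sup>2 / 2"
        using sw by (simp add: norm_power norm_minus_commute)
      have "norm (h w) = 2 * norm w * norm (r w) / norm (of_real (\<sigma>\<^sup>2) - w\<^sup>2)"
        by (simp add: h_def norm_mult norm_divide)
      also have "\<dots> \<le> 2 * norm w * (C * norm w powr (- \<nu>)) / ((norm w)\<^sup>2 / 2)"
        using den w0 decay[OF wS w0] C by (intro frac_le mult_left_mono) auto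
      also have "\<dots> = 4 * C * (norm w powr (- \<nu>) / norm w)" using w0 by (simp add: power2_eq_square)
      also have "norm w powr (- \<nu>) / norm w = norm w powr (- 1 - \<nu>)"
        using w0 powr_add[of "norm w" "- 1" "- \<nu>"] by (simp add: powr_minus_divide)
      also have "\<dots> \<le> \<rho> powr (- 1 - \<nu>)" using nw \<rho>0 \<nu> by (intro powr_mono2') auto
      finally show "norm (h w) \<le> 4 * C * \<rho> powr (- 1 - \<nu>)" using C by (simp add: mult_left_mono)
    qed
    have nb: "norm (c - b) = 2 * \<rho> * \<tau>"
    proof -
      have "c - b = of_real (2 * \<rho> * \<tau>) * \<i>" by (simp add: c_def b_def complex_eq_iff)
      then have "norm (c - b) = \<bar>2 * \<rho> * \<tau>\<bar>" by (simp add: norm_mult abs_mult)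
      then show ?thesis using \<rho>0 \<tau> by simp
    qed
    have "\<rho> powr (- 1 - \<nu>) * \<rho> = \<rho> powr (- \<nu>)"
      using \<rho>0 powr_add[of \<rho> "- 1 - \<nu>" 1] by simp
    moreover have "norm (contour_integral (linepath b c) h) \<le> 8 * C * \<tau> * (\<rho> powr (- 1 - \<nu>) * \<rho>)"
      using chord unfolding nb by (simp add: mult_ac)
    ultimately have chord': "norm (contour_integral (linepath b c) h) \<le> 8 * C * \<tau> * \<rho> powr (- \<nu>)"
      by simp
    have "contour_integral (linepath b c) h = (I \<rho> - cnj (I \<rho>)) - 2 * pi * \<i> * r (of_real \<sigma>)"
      using tri(1) I_eq low by (simp add: algebra_simps)
    also have "\<dots> = 2 * \<i> * (of_real (Im (I \<rho>)) - pi * r (of_real \<sigma>))"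
      unfolding complex_diff_cnj by (simp add: algebra_simps)
    finally have "2 * norm (of_real (Im (I \<rho>)) - pi * r (of_real \<sigma>)) \<le> 8 * C * \<tau> * \<rho> powr (- \<nu>)"
      using chord' by (simp add: norm_mult)
    moreover have "\<bar>Re (of_real (Im (I \<rho>)) - pi * r (of_real \<sigma>))\<bar> \<le> norm (of_real (Im (I \<rho>)) - pi * r (of_real \<sigma>))"
      by (rule abs_Re_le_cmod)
    moreover have "Re (of_real (Im (I \<rho>)) - pi * r (of_real \<sigma>)) = Im (I \<rho>) - pi * Re (r (of_real \<sigma>))"
      by simp
    ultimately show ?thesis by linarith
  qed
  define e where "e = (\<lambda>\<rho>. Im (I \<rho>) - pi * Re (r (of_real \<sigma>)))"
  have "((\<lambda>\<rho>. 4 * C * \<tau> * \<rho> powr (- \<nu>)) \<longlongrightarrow> 4 * C * \<tau> * 0) at_top"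
    using \<nu> by (intro tendsto_intros tendsto_neg_powr filterlim_ident) auto
  then have z: "((\<lambda>\<rho>. 4 * C * \<tau> * \<rho> powr (- \<nu>)) \<longlongrightarrow> 0) at_top" by simp
  have ev: "\<forall>\<^sub>F \<rho> in at_top. norm (e \<rho>) \<le> 4 * C * \<tau> * \<rho> powr (- \<nu>)"
    unfolding e_def real_norm_def
    by (rule eventually_mono[OF eventually_gt_at_top[of "2 * \<sigma>"]]) (rule bound)
  have e0: "(e \<longlongrightarrow> 0) at_top" by (rule Lim_null_comparison[OF ev z])
  have "(e \<longlongrightarrow> Im (LBINT q:{0..}. \<phi> q) - pi * Re (r (of_real \<sigma>))) at_top"
    unfolding e_def by (intro tendsto_intros lim)
  from tendsto_unique[OF trivial_limit_at_top_linorder this e0]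
  show ?thesis by simp
qed

section \<open>Exponential and Gaussian integrals along the boundary ray\<close>

lemma LBINT_atLeast_FTC:
  fixes F f :: "real \<Rightarrow> 'a::euclidean_space"
  assumes F: "\<And>x. (F has_vector_derivative f x) (at x)"
    and f: "continuous_on {0..} f" and int: "set_integrable lborel {0..} f"
    and lim: "(F \<longlongrightarrow> L) at_top"
  shows "(LBINT x:{0..}. f x) = L - F 0"
proof -
  have "((\<lambda>b. LBINT x:{0..b}. f x) \<longlongrightarrow> (LBINT x:{0..}. f x)) at_top"
    using int by (intro tendsto_set_lebesgue_integral_at_top) auto
  moreover have "\<forall>\<^sub>F b in at_top. (LBINT x:{0..b}. f x) = F b - F 0"
    using eventually_ge_at_top[of 0]
  proof eventually_elim
    case (elim b)
    then show ?case unfolding set_lebesgue_integral_def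
      by (intro integral_FTC_atLeastAtMost continuous_on_subset[OF f]
          has_vector_derivative_at_within[OF F]) auto
  qed
  ultimately have "((\<lambda>b. F b - F 0) \<longlongrightarrow> (LBINT x:{0..}. f x)) at_top"
    by (rule Lim_transform_eventually)
  moreover have "((\<lambda>b. F b - F 0) \<longlongrightarrow> L - F 0) at_top" by (intro tendsto_intros lim)
  ultimately show ?thesis by (rule tendsto_unique[OF trivial_limit_at_top_linorder])
qed

lemma gauss_moment_integrable:
  assumes a: "a > -1" and k: "k > 0"
  shows "integrable lborel (\<lambda>q::real. indicator {0..} q * (q powr a * exp (- k * q\<^sup>2)))"
proof (rule Bochner_Integration.integrable_bound[OF _ _ AE_I2])
  show "integrable lborel (\<lambda>q. exp (1 / (4 * k)) * Gamma (a + 1) * (indicator {0..} q *\<^sub>R (exp (- 1 * q) * rl_kernel (a + 1) q)))"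
    using laplace_rl_kernel(1)[of "a + 1" 1] a unfolding set_integrable_def by (intro integrable_mult_right) auto
  fix q :: real
  have G: "Gamma (a + 1) > 0" using a by (intro Gamma_real_pos) auto
  \<comment> \<open>Completing the square gives \<open>q \<le> k q\<^sup>2 + 1 / (4 k)\<close>. This
    trades the Gaussian for \<open>exp (- q)\<close> and leaves a Gamma integral as
    majorant.\<close>
  have "0 \<le> k * (q - 1 / (2 * k))\<^sup>2" using k by simp
  also have "\<dots> = k * q\<^sup>2 - q + 1 / (4 * k)" using k by (simp add: power2_eq_square field_simps)
  finally have "exp (- k * q\<^sup>2) \<le> exp (1 / (4 * k) + - 1 * q)" by simp
  then have "exp (- k * q\<^sup>2) \<le> exp (1 / (4 * k)) * exp (- 1 * q)" unfolding exp_add .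
  then have "q powr a * exp (- k * q\<^sup>2) \<le> q powr a * (exp (1 / (4 * k)) * exp (- 1 * q))"
    by (intro mult_left_mono) auto
  then show "norm (indicator {0..} q * (q powr a * exp (- k * q\<^sup>2)))
     \<le> norm (exp (1 / (4 * k)) * Gamma (a + 1) * (indicator {0..} q *\<^sub>R (exp (- 1 * q) * rl_kernel (a + 1) q)))"
    using G by (auto simp: indicator_def rl_kernel_def abs_mult mult_ac)
qed measurable

text \<open>Scaling by \<open>sqrt t\<close>. The case \<open>a = 1 - \<nu>\<close> will give the
  power \<open>t powr (\<nu> / 2 - 1)\<close> near zero, and \<open>a = 1 + 2 * \<nu>\<close> the
  power \<open>t powr (- 1 - \<nu>)\<close> at infinity.\<close>

lemma gauss_moment:
  assumes a: "a > -1" and k: "k > 0" and t: "t > 0"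
  shows "integrable lborel (\<lambda>q::real. indicator {0..} q * (q powr a * exp (- k * (q\<^sup>2 * t))))"
    and "(\<integral>q. indicator {0..} q * (q powr a * exp (- k * (q\<^sup>2 * t))) \<partial>lborel)
       = t powr (- (a + 1) / 2) * (\<integral>q. indicator {0..} q * (q powr a * exp (- k * q\<^sup>2)) \<partial>lborel)"
proof -
  define f where "f = (\<lambda>q::real. indicator {0..} q * (q powr a * exp (- k * q\<^sup>2)))"
  have eq: "indicator {0..} q * (q powr a * exp (- k * (q\<^sup>2 * t))) = t powr (- a / 2) * f (sqrt t * q)" for q
  proof (cases "q \<ge> 0")
    case True
    have "sqrt t powr a = t powr (a / 2)" using t by (simp add: powr_half_sqrt[symmetric] powr_powr)
    moreover have "t powr (- a / 2) * t powr (a / 2) = 1" using t by (simp flip: powr_add)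
    ultimately show ?thesis using True t
      by (simp add: f_def powr_mult power_mult_distrib mult_ac flip: mult.assoc)
  next
    case False
    then show ?thesis using t by (simp add: f_def zero_le_mult_iff not_le)
  qed
  have f: "integrable lborel f" unfolding f_def by (rule gauss_moment_integrable[OF a k])
  have "integrable lborel (\<lambda>q. f (sqrt t * q))"
    using lborel_integrable_real_affine[OF f, of "sqrt t" 0] t by simp
  then show "integrable lborel (\<lambda>q::real. indicator {0..} q * (q powr a * exp (- k * (q\<^sup>2 * t))))"
    unfolding eq by simp
  have "(\<integral>q. f q \<partial>lborel) = sqrt t * (\<integral>q. f (sqrt t * q) \<partial>lborel)"
    using lborel_integral_real_affine[of "sqrt t" f 0] t by simp
  then have "(\<integral>q. f (sqrt t * q) \<partial>lborel) = t powr (- 1 / 2) * (\<integral>q. f q \<partial>lborel)"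
    using t by (simp add: powr_minus_divide powr_half_sqrt)
  then have "(\<integral>q. indicator {0..} q * (q powr a * exp (- k * (q\<^sup>2 * t))) \<partial>lborel)
     = (t powr (- a / 2) * t powr (- 1 / 2)) * (\<integral>q. f q \<partial>lborel)"
    unfolding eq by simp
  also have "t powr (- a / 2) * t powr (- 1 / 2) = t powr (- (a + 1) / 2)"
    by (simp add: diff_divide_distrib flip: powr_add)
  finally show "(\<integral>q. indicator {0..} q * (q powr a * exp (- k * (q\<^sup>2 * t))) \<partial>lborel)
       = t powr (- (a + 1) / 2) * (\<integral>q. indicator {0..} q * (q powr a * exp (- k * q\<^sup>2)) \<partial>lborel)"
    by (simp add: f_def)
qed

lemma norm_exp_of_real_mult: "norm (exp (of_real x * z)) = exp (x * Re z)"
  by (simp add: norm_exp_eq_Re)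

lemma LBINT_exp_complex:
  assumes z: "Re z < 0"
  shows "set_integrable lborel {0..} (\<lambda>t. exp (of_real t * z))" (is ?I)
    and "(LBINT t:{0..}. exp (of_real t * z)) = - (1 / z)"
proof -
  have c: "continuous_on A (\<lambda>t. exp (of_real t * z))" for A :: "real set"
    by (intro continuous_intros)
  show I: ?I unfolding set_integrable_def
  proof (rule Bochner_Integration.integrable_bound)
    show "integrable lborel (\<lambda>t. indicator {0..} t *\<^sub>R exp (- (- Re z) * t))"
      using set_integrable_exp[of "- Re z"] z by (simp add: set_integrable_def)
    show "(\<lambda>t. indicator {0..} t *\<^sub>R exp (of_real t * z)) \<in> borel_measurable lborel"
      using borel_measurable_continuous_on_indicator[OF _ c, of "{0..}"] by simp
  qed (auto simp: norm_exp_eq_Re mult.commute)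
  have z0: "z \<noteq> 0" using z by auto
  have "filterlim (\<lambda>t. Re z * t) at_bot at_top"
    by (rule filterlim_tendsto_neg_mult_at_bot[OF tendsto_const z filterlim_ident])
  from filterlim_compose[OF exp_at_bot this]
  have "((\<lambda>t. norm (exp (of_real t * z))) \<longlongrightarrow> 0) at_top"
    by (simp add: norm_exp_eq_Re mult.commute)
  then have "((\<lambda>t. exp (of_real t * z)) \<longlongrightarrow> 0) at_top" by (rule tendsto_norm_zero_cancel)
  then have lim: "((\<lambda>t. exp (of_real t * z) / z) \<longlongrightarrow> 0 / z) at_top" using z0 by (intro tendsto_intros)
  have "((\<lambda>t. exp (of_real t * z) / z) has_vector_derivative exp (of_real t * z)) (at t)" for t
    by (rule has_vector_derivative_real_field) (use z0 in \<open>auto intro!: derivative_eq_intros\<close>)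
  from LBINT_atLeast_FTC[OF this c I lim]
  show "(LBINT t:{0..}. exp (of_real t * z)) = - (1 / z)" by simp
qed

text \<open>The integrand is the derivative of \<open>exp (q\<^sup>2 z)\<close>, which runs from
  \<open>1\<close> to \<open>0\<close>. The value is therefore independent of \<open>z\<close> and,
  in particular, real.\<close>

lemma LBINT_exp_square_complex:
  assumes z: "Re z < 0"
  shows "integrable lborel (\<lambda>q::real. indicator {0..} q *\<^sub>R (2 * of_real q * z * exp (of_real (q\<^sup>2) * z)))" (is ?I)
    and "(\<integral>q. indicator {0..} q *\<^sub>R (2 * of_real q * z * exp (of_real (q\<^sup>2) * z)) \<partial>lborel) = - 1"
proof -
  have c: "continuous_on A (\<lambda>q. 2 * of_real q * z * exp (of_real (q\<^sup>2) * z))" for A :: "real set"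
    by (intro continuous_intros)
  show I: ?I
  proof (rule Bochner_Integration.integrable_bound)
    show "integrable lborel (\<lambda>q. 2 * norm z * (indicator {0..} q * (q powr 1 * exp (- (- Re z) * q\<^sup>2))))"
      using gauss_moment_integrable[of 1 "- Re z"] z by (intro integrable_mult_right) auto
    show "(\<lambda>q. indicator {0..} q *\<^sub>R (2 * of_real q * z * exp (of_real (q\<^sup>2) * z))) \<in> borel_measurable lborel"
      using borel_measurable_continuous_on_indicator[OF _ c, of "{0..}"] by simp
  qed (auto simp: norm_exp_of_real_mult norm_mult indicator_def mult_ac)
  have "filterlim (\<lambda>q. Re z * q\<^sup>2) at_bot at_top"
    by (intro filterlim_tendsto_neg_mult_at_bot[OF tendsto_const z] filterlim_pow_at_top filterlim_ident) simp
  from filterlim_compose[OF exp_at_bot this]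
  have "((\<lambda>q. norm (exp ((of_real q)\<^sup>2 * z))) \<longlongrightarrow> 0) at_top"
    by (simp add: norm_exp_eq_Re mult.commute flip: of_real_power)
  then have lim: "((\<lambda>q. exp ((of_real q)\<^sup>2 * z)) \<longlongrightarrow> 0) at_top" by (rule tendsto_norm_zero_cancel)
  have "((\<lambda>q. exp ((of_real q)\<^sup>2 * z)) has_vector_derivative 2 * of_real q * z * exp (of_real (q\<^sup>2) * z)) (at q)" for q
    by (rule has_vector_derivative_real_field) (auto intro!: derivative_eq_intros)
  from LBINT_atLeast_FTC[OF this c _ lim] I
  show "(\<integral>q. indicator {0..} q *\<^sub>R (2 * of_real q * z * exp (of_real (q\<^sup>2) * z)) \<partial>lborel) = - 1"
    unfolding set_lebesgue_integral_def set_integrable_def by simp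
qed

text \<open>The two bounds estimate one ray integral through different properties of
  \<open>r\<close>: decay at infinity governs small \<open>t\<close>, Hoelder regularity at
  \<open>0\<close> governs large \<open>t\<close>. Exponents halve under
  \<open>s = w\<^sup>2\<close>, so the decay hypothesis is of order \<open>- \<nu> / 2\<close> in
  \<open>s\<close> and costs \<open>t powr (\<nu> / 2 - 1)\<close>, while the Hoelder condition is
  of order \<open>\<nu>\<close> in \<open>s\<close> and yields
  \<open>t powr (- 1 - \<nu>)\<close>.\<close>

theorem sector_inverse_laplace:
  fixes r :: "complex \<Rightarrow> complex"
  assumes \<tau>: "\<tau> > 1" and \<nu>: "0 < \<nu>" "\<nu> \<le> 1"
    and cont: "continuous_on (sector \<tau>) r"
    and hol: "\<And>w. w \<in> interior (sector \<tau>) \<Longrightarrow> r field_differentiable at w"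
    and cnj_r: "\<And>w. w \<in> sector \<tau> \<Longrightarrow> r (cnj w) = cnj (r w)"
    and decay: "\<And>w. w \<in> sector \<tau> \<Longrightarrow> w \<noteq> 0 \<Longrightarrow> norm (r w) \<le> C * norm w powr (- \<nu>)"
    and hoelder: "\<And>w. w \<in> sector \<tau> \<Longrightarrow> norm (r w - r 0) \<le> C * norm w powr (2 * \<nu>)"
  obtains K :: "real \<Rightarrow> real" and B where
    "K \<in> borel_measurable borel"
    "\<And>t. t > 0 \<Longrightarrow> \<bar>K t\<bar> \<le> B * t powr (\<nu> / 2 - 1)"
    "\<And>t. t > 0 \<Longrightarrow> \<bar>K t\<bar> \<le> B * t powr (- 1 - \<nu>)"
    "\<And>s. s > 0 \<Longrightarrow> (LBINT t:{0..}. exp (- s * t) * K t) = Re (r (of_real (sqrt s)))"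
proof -
  \<comment> \<open>\<open>K t\<close> is \<open>1/(2 \<pi> i)\<close> times the integral of \<open>exp (w\<^sup>2 t) r(w) 2 w dw\<close> along both boundary rays. They are
    conjugate, so only the imaginary part over the ray \<open>w = q d\<close>, \<open>q \<ge> 0\<close>, remains.\<close>
  define d where "d = Complex 1 \<tau>"
  define D where "D = d\<^sup>2"
  \<comment> \<open>As \<open>Re (d\<^sup>2) = 1 - \<tau>\<^sup>2 = - k\<close>, the condition
    \<open>\<tau> > 1\<close> is exactly what makes \<open>exp (q\<^sup>2 t d\<^sup>2)\<close> decay
    along the ray.\<close>
  define k where "k = \<tau>\<^sup>2 - 1"
  have k: "k > 0" using \<tau> by (simp add: k_def)
  have ReD: "Re D = - k" by (simp add: D_def d_def k_def power2_eq_square)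
  have d1: "norm d \<ge> 1" using complex_Re_le_cmod[of d] by (simp add: d_def)
  have C: "C \<ge> 0" using decay[of 1] \<tau> by (auto simp: sector_def intro: order_trans[OF norm_ge_zero])
  have qd: "of_real q * d \<in> sector \<tau>" if "q \<ge> 0" for q
    using that \<tau> by (simp add: sector_def d_def abs_mult)
  define R where "R = (\<lambda>q::real. indicator {0..} q *\<^sub>R r (of_real q * d))"
  have [measurable]: "R \<in> borel_measurable borel"
    unfolding R_def using qd
    by (intro borel_measurable_continuous_on_indicator continuous_on_compose2[OF cont] continuous_intros) auto
  define F where "F = (\<lambda>t q::real. R q * (2 * of_real q * D * exp (of_real (q\<^sup>2 * t) * D)))"
  have Fm: "(\<lambda>(t, q). F t q) \<in> borel_measurable (lborel \<Otimes>\<^sub>M lborel)"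
    unfolding F_def by measurable
  have [measurable]: "F t \<in> borel_measurable borel" for t
    unfolding F_def by measurable
  define J where "J = (\<lambda>a. \<integral>q. indicator {0..} q * (q powr a * exp (- k * q\<^sup>2)) \<partial>lborel)"
  have J: "J a \<ge> 0" for a unfolding J_def by (intro integral_nonneg_AE AE_I2) (auto simp: indicator_def)
  note gm = gauss_moment[OF _ k]
  define C1 where "C1 = 2 * C * norm D"
  have normF: "norm (F t q) \<le> C1 * (indicator {0..} q * (q powr (1 - \<nu>) * exp (- k * (q\<^sup>2 * t))))" for t q
  proof (cases "q > 0")
    case True
    have nz: "of_real q * d \<noteq> 0" using True d1 by auto
    have "norm (R q) \<le> C * norm (of_real q * d) powr (- \<nu>)"
      using decay[OF qd nz] True by (simp add: R_def)
    also have "norm (of_real q * d) powr (- \<nu>) \<le> q powr (- \<nu>)"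
      using True d1 \<nu> by (intro powr_mono2') (auto simp: norm_mult)
    finally have "norm (R q) \<le> C * q powr (- \<nu>)" using C by (simp add: mult_left_mono)
    moreover have "norm (F t q) = norm (R q) * (2 * q * norm D * exp (- k * (q\<^sup>2 * t)))"
      using True by (simp add: F_def norm_mult norm_exp_of_real_mult ReD mult_ac del: of_real_mult of_real_power)
    ultimately have "norm (F t q) \<le> C * q powr (- \<nu>) * (2 * q * norm D * exp (- k * (q\<^sup>2 * t)))"
      using True by (metis mult_right_mono mult_nonneg_nonneg norm_ge_zero exp_ge_zero less_imp_le zero_le_numeral)
    also have "\<dots> = C1 * ((q powr (- \<nu>) * q) * exp (- k * (q\<^sup>2 * t)))" by (simp add: C1_def mult_ac)
    also have "q powr (- \<nu>) * q = q powr (1 - \<nu>)" using True powr_add[of q "- \<nu>" 1] by simp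
    finally show ?thesis using True by simp
  next
    case False
    then have "q < 0 \<or> q = 0" by auto
    then show ?thesis by (auto simp: F_def R_def)
  qed
  have Fint: "integrable lborel (F t)" and Fbound: "(\<integral>q. norm (F t q) \<partial>lborel) \<le> C1 * J (1 - \<nu>) * t powr (\<nu> / 2 - 1)"
    if t: "t > 0" for t
  proof -
    have a: "- 1 < 1 - \<nu>" using \<nu> by simp
    have i: "integrable lborel (\<lambda>q. C1 * (indicator {0..} q * (q powr (1 - \<nu>) * exp (- k * (q\<^sup>2 * t)))))"
      using gm(1)[OF a t] by (rule integrable_mult_right)
    show int: "integrable lborel (F t)"
      by (rule Bochner_Integration.integrable_bound[OF i]) (auto intro!: AE_I2 order_trans[OF normF])
    have "(\<integral>q. norm (F t q) \<partial>lborel) \<le> (\<integral>q. C1 * (indicator {0..} q * (q powr (1 - \<nu>) * exp (- k * (q\<^sup>2 * t)))) \<partial>lborel)"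
      using int by (intro integral_mono i normF integrable_norm)
    also have "\<dots> = C1 * (t powr (- ((1 - \<nu>) + 1) / 2) * J (1 - \<nu>))"
      unfolding integral_mult_right_zero gm(2)[OF a t] J_def ..
    also have "- ((1 - \<nu>) + 1) / 2 = \<nu> / 2 - 1" by (simp add: field_simps)
    finally show "(\<integral>q. norm (F t q) \<partial>lborel) \<le> C1 * J (1 - \<nu>) * t powr (\<nu> / 2 - 1)" by (simp add: mult_ac)
  qed
  define K where "K = (\<lambda>t. if t > 0 then Im (\<integral>q. F t q \<partial>lborel) / pi else 0)"
  have Im_meas [measurable]: "(\<lambda>t. \<integral>q. F t q \<partial>lborel) \<in> borel_measurable borel"
    using sigma_finite_measure.borel_measurable_lebesgue_integral[OF _ Fm] by (simp add: lborel.sigma_finite_measure_axioms)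
  have Km: "K \<in> borel_measurable borel" unfolding K_def by measurable
  define B1 where "B1 = C1 * J (1 - \<nu>) / pi"
  have K1: "\<bar>K t\<bar> \<le> B1 * t powr (\<nu> / 2 - 1)" if t: "t > 0" for t
  proof -
    have "\<bar>Im (\<integral>q. F t q \<partial>lborel)\<bar> \<le> norm (\<integral>q. F t q \<partial>lborel)" by (rule abs_Im_le_cmod)
    also have "\<dots> \<le> (\<integral>q. norm (F t q) \<partial>lborel)" by (rule integral_norm_bound)
    also note Fbound[OF t]
    finally show ?thesis using t by (simp add: K_def B1_def field_simps)
  qed
  define C2 where "C2 = 2 * C * norm D * norm d powr (2 * \<nu>)"
  define B2 where "B2 = C2 * J (1 + 2 * \<nu>) / pi"
  have r0: "Im (r 0) = 0"
    using cnj_r[of 0] \<tau> by (simp add: sector_def complex_eq_iff)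
  have K2: "\<bar>K t\<bar> \<le> B2 * t powr (- 1 - \<nu>)" if t: "t > 0" for t
  proof -
    define E where "E = (\<lambda>q::real. indicator {0..} q *\<^sub>R (2 * of_real q * (of_real t * D) * exp (of_real (q\<^sup>2) * (of_real t * D))))"
    have Rt: "Re (of_real t * D) < 0" using t k ReD by simp
    note E = LBINT_exp_square_complex[OF Rt, folded E_def]
    \<comment> \<open>Subtracting \<open>r 0\<close> changes the integral by a real number only, as \<open>\<integral> 2 q D exp (q\<^sup>2 t D) dq = - 1/t\<close>.\<close>
    define G where "G = (\<lambda>q. F t q - r 0 / of_real t * E q)"
    have Gint: "integrable lborel G"
      unfolding G_def using Fint[OF t] E(1) by (intro Bochner_Integration.integrable_diff integrable_mult_right)
    have "(\<integral>q. G q \<partial>lborel) = (\<integral>q. F t q \<partial>lborel) - r 0 / of_real t * (\<integral>q. E q \<partial>lborel)"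
      unfolding G_def using Fint[OF t] E(1) by simp
    then have "Im (\<integral>q. F t q \<partial>lborel) = Im (\<integral>q. G q \<partial>lborel)"
      using r0 by (simp add: E(2))
    also have "\<bar>\<dots>\<bar> \<le> norm (\<integral>q. G q \<partial>lborel)" by (rule abs_Im_le_cmod)
    also have "\<dots> \<le> (\<integral>q. norm (G q) \<partial>lborel)" by (rule integral_norm_bound)
    also have "\<dots> \<le> (\<integral>q. C2 * (indicator {0..} q * (q powr (1 + 2 * \<nu>) * exp (- k * (q\<^sup>2 * t)))) \<partial>lborel)"
    proof (rule integral_mono)
      show "integrable lborel (\<lambda>q. norm (G q))" using Gint by (rule integrable_norm)
      show "integrable lborel (\<lambda>q. C2 * (indicator {0..} q * (q powr (1 + 2 * \<nu>) * exp (- k * (q\<^sup>2 * t)))))"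
        using gm(1)[of "1 + 2 * \<nu>", OF _ t] \<nu> by (intro integrable_mult_right) auto
      fix q :: real
      show "norm (G q) \<le> C2 * (indicator {0..} q * (q powr (1 + 2 * \<nu>) * exp (- k * (q\<^sup>2 * t))))"
      proof (cases "q > 0")
        case True
        have "G q = (r (of_real q * d) - r 0) * (2 * of_real q * D * exp (of_real (q\<^sup>2 * t) * D))"
          using True t by (simp add: G_def F_def E_def R_def field_simps)
        then have "norm (G q) = norm (r (of_real q * d) - r 0) * (2 * q * norm D * exp (- k * (q\<^sup>2 * t)))"
          using True by (simp add: norm_mult norm_exp_of_real_mult ReD mult_ac del: of_real_mult of_real_power)
        also have "norm (r (of_real q * d) - r 0) \<le> C * norm (of_real q * d) powr (2 * \<nu>)"
          using True by (intro hoelder qd) auto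
        also have "norm (of_real q * d) powr (2 * \<nu>) = q powr (2 * \<nu>) * norm d powr (2 * \<nu>)"
          using True by (simp add: norm_mult powr_mult)
        finally have "norm (G q) \<le> C * (q powr (2 * \<nu>) * norm d powr (2 * \<nu>)) * (2 * q * norm D * exp (- k * (q\<^sup>2 * t)))"
          using True by (simp add: mult_right_mono)
        also have "\<dots> = C2 * ((q * q powr (2 * \<nu>)) * exp (- k * (q\<^sup>2 * t)))" by (simp add: C2_def mult_ac)
        also have "q * q powr (2 * \<nu>) = q powr (1 + 2 * \<nu>)" using True by (simp add: powr_add)
        finally show ?thesis using True by simp
      next
        case False
        then have "q < 0 \<or> q = 0" by auto
        then show ?thesis by (auto simp: G_def F_def E_def R_def)
      qed
    qed
    also have "\<dots> = C2 * (t powr (- ((1 + 2 * \<nu>) + 1) / 2) * J (1 + 2 * \<nu>))"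
      unfolding integral_mult_right_zero using gm(2)[of "1 + 2 * \<nu>", OF _ t] \<nu> by (simp add: J_def)
    also have "- ((1 + 2 * \<nu>) + 1) / 2 = - 1 - \<nu>" by (simp add: field_simps)
    finally show ?thesis using t by (simp add: K_def B2_def field_simps)
  qed
  have L: "(LBINT t:{0..}. exp (- s * t) * K t) = Re (r (of_real (sqrt s)))" if s: "s > 0" for s
  proof -
    \<comment> \<open>Integrability of \<open>F t\<close> is known for positive \<open>t\<close>,
      whence the open half-line. The bound \<open>t powr (\<nu> / 2 - 1)\<close> is integrable at
      \<open>0\<close> and supplies the majorant for Fubini.\<close>
    define H where "H = (\<lambda>t q::real. (indicator {0<..} t * exp (- s * t)) *\<^sub>R F t q)"
    have Hint: "integrable (lborel \<Otimes>\<^sub>M lborel) (\<lambda>(t, q). H t q)"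
    proof (rule lborel_pair.Fubini_integrable)
      show Hm: "(\<lambda>(t, q). H t q) \<in> borel_measurable (lborel \<Otimes>\<^sub>M lborel)"
        unfolding H_def F_def by measurable
      define M where "M = (\<lambda>t. C1 * J (1 - \<nu>) * Gamma (\<nu> / 2) * (indicator {0..} t *\<^sub>R (exp (- s * t) * rl_kernel (\<nu> / 2) t)))"
      have m1: "(\<lambda>t. \<integral>q. norm (H t q) \<partial>lborel) \<in> borel_measurable lborel"
        using lborel.borel_measurable_lebesgue_integral[of "\<lambda>t q. norm (H t q)" lborel] Hm by simp
      have m2: "integrable lborel M"
        using laplace_rl_kernel(1)[of "\<nu> / 2" s] \<nu> s unfolding M_def set_integrable_def by (intro integrable_mult_right) auto
      have m3: "(\<integral>q. norm (H t q) \<partial>lborel) \<le> M t" for t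
      proof (cases "t > 0")
        case True
        have G: "Gamma (\<nu> / 2) > 0" using \<nu> by (intro Gamma_real_pos) auto
        have "(\<integral>q. norm (H t q) \<partial>lborel) = exp (- s * t) * (\<integral>q. norm (F t q) \<partial>lborel)"
          using True by (simp add: H_def)
        also have "\<dots> \<le> exp (- s * t) * (C1 * J (1 - \<nu>) * t powr (\<nu> / 2 - 1))"
          using Fbound[OF True] by (intro mult_left_mono) auto
        finally show ?thesis using True G by (simp add: M_def rl_kernel_def mult_ac)
      next
        case False
        then show ?thesis by (simp add: M_def H_def rl_kernel_def indicator_def)
      qed
      have "integrable lborel (\<lambda>t. \<integral>q. norm (H t q) \<partial>lborel)"
      proof (rule Bochner_Integration.integrable_bound[OF m2 m1 AE_I2])
        fix t
        have "norm (\<integral>q. norm (H t q) \<partial>lborel) = (\<integral>q. norm (H t q) \<partial>lborel)" by simp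
        also note m3
        also have "M t \<le> norm (M t)" by simp
        finally show "norm (\<integral>q. norm (H t q) \<partial>lborel) \<le> norm (M t)" .
      qed
      then show "integrable lborel (\<lambda>t. \<integral>q. norm (case (t, q) of (t, q) \<Rightarrow> H t q) \<partial>lborel)"
        unfolding prod.case .
      have "integrable lborel (H t)" for t
        using Fint[of t] by (cases "t > 0") (auto simp: H_def intro: integrable_scaleR_right)
      then show "AE t in lborel. integrable lborel (\<lambda>q. case (t, q) of (t, q) \<Rightarrow> H t q)" by simp
    qed
    define \<phi> where "\<phi> = (\<lambda>q::real. 2 * of_real q * d\<^sup>2 * r (of_real q * d) / (of_real ((sqrt s)\<^sup>2) - of_real (q\<^sup>2) * d\<^sup>2))"
    \<comment> \<open>Integrating over \<open>t\<close> first turns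
      \<open>exp (t * (q\<^sup>2 D - s))\<close> into \<open>1 / (s - q\<^sup>2 d\<^sup>2)\<close>,
      the Cauchy kernel of \<open>sector_ray_integral\<close> for
      \<open>\<sigma> = sqrt s\<close>.\<close>
    have inner: "(\<integral>t. H t q \<partial>lborel) = indicator {0..} q *\<^sub>R \<phi> q" for q
    proof (cases "q \<ge> 0")
      case True
      define z where "z = of_real (q\<^sup>2) * D - of_real s"
      have z: "Re z < 0"
      proof -
        have "Re z = - k * q\<^sup>2 - s" by (simp add: z_def ReD)
        moreover have "k * q\<^sup>2 \<ge> 0" using k by simp
        ultimately show ?thesis using s by simp
      qed
      have "AE t::real in lborel. t \<noteq> 0" by (rule AE_lborel_singleton)
      then have "(\<integral>t. H t q \<partial>lborel) = (\<integral>t. R q * (2 * of_real q * D) * (indicator {0..} t *\<^sub>R exp (of_real t * z)) \<partial>lborel)"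
      proof (intro integral_cong_AE, goal_cases)
        case 3
        then show ?case
        proof eventually_elim
          case (elim t)
          have "of_real t * z = of_real (- s * t) + of_real (q\<^sup>2 * t) * D"
            by (simp add: z_def algebra_simps)
          then have "exp (of_real t * z) = of_real (exp (- s * t)) * exp (of_real (q\<^sup>2 * t) * D)"
            by (simp only: exp_add exp_of_real)
          then show ?case using elim
            by (simp add: H_def F_def indicator_def scaleR_conv_of_real mult_ac del: exp_of_real)
        qed
      qed (auto simp: H_def F_def)
      also have "\<dots> = R q * (2 * of_real q * D) * (- (1 / z))"
        unfolding integral_mult_right_zero using LBINT_exp_complex(2)[OF z] by (simp add: set_lebesgue_integral_def)
      also have "\<dots> = \<phi> q"
      proof -
        have "of_real ((sqrt s)\<^sup>2) - of_real (q\<^sup>2) * d\<^sup>2 = - z" using s by (simp add: z_def D_def)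
        then show ?thesis unfolding \<phi>_def using True by (simp add: R_def D_def)
      qed
      finally show ?thesis using True by simp
    qed (simp add: H_def F_def R_def)
    have int\<phi>: "set_integrable lborel {0..} \<phi>"
      using lborel_pair.integrable_snd[OF Hint] by (simp add: inner set_integrable_def)
    have "(\<integral>t. \<integral>q. H t q \<partial>lborel \<partial>lborel) = (LBINT q:{0..}. \<phi> q)"
      using lborel_pair.Fubini_integral[OF Hint] by (simp add: inner set_lebesgue_integral_def)
    moreover have "(LBINT t:{0..}. exp (- s * t) * K t) = (\<integral>t. Im (\<integral>q. H t q \<partial>lborel) / pi \<partial>lborel)"
      unfolding set_lebesgue_integral_def
      by (intro Bochner_Integration.integral_cong) (auto simp: H_def K_def indicator_def)
    moreover have "integrable lborel (\<lambda>t. \<integral>q. H t q \<partial>lborel)"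
      by (rule lborel_pair.integrable_fst[OF Hint])
    ultimately have "(LBINT t:{0..}. exp (- s * t) * K t) = Im (LBINT q:{0..}. \<phi> q) / pi"
      by simp
    also have "Im (LBINT q:{0..}. \<phi> q) = pi * Re (r (of_real (sqrt s)))"
      using sector_ray_integral[of \<tau> "sqrt s" \<nu> r C] \<tau> s \<nu> cont hol cnj_r decay int\<phi>
      unfolding \<phi>_def d_def by simp
    finally show ?thesis by simp
  qed
  have B: "B1 * x \<le> max B1 B2 * x" "B2 * x \<le> max B1 B2 * x" if "x \<ge> 0" for x
    using that by (auto intro: mult_right_mono)
  show ?thesis
    by (rule that[of K "max B1 B2"]) (use Km K1 K2 L in \<open>auto intro: order_trans[OF _ B(1)] order_trans[OF _ B(2)]\<close>)
qed

section \<open>The characteristic function and the resolvent kernels\<close>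

text \<open>On the right half plane and at \<open>0\<close> this is \<open>Q\<close> at
  \<open>w\<^sup>2\<close>, written as the determinant of \<open>diag (w^(2a), w^(2b)) - A\<close>.
  The factored form keeps the two powers apart in the estimates.\<close>

definition char_sq :: "real \<Rightarrow> real \<Rightarrow> real^2^2 \<Rightarrow> complex \<Rightarrow> complex" where
  "char_sq a b A w = (w powr of_real (2 * a) - of_real (A$1$1)) * (w powr of_real (2 * b) - of_real (A$2$2))
     - of_real (A$1$2) * of_real (A$2$1)"

text \<open>An argument in \<open>(-\<pi>/2, \<pi>/2)\<close> stays in the principal range when it
  is doubled, so no branch is crossed.\<close>

lemma power2_powr_complex:
  fixes w z :: complex
  assumes "Re w > 0"
  shows "(w\<^sup>2) powr z = w powr (2 * z)"
proof -
  have w: "w \<noteq> 0" using assms by auto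
  have "\<bar>Im (Ln w)\<bar> < pi / 2" using Re_Ln_pos_lt[OF w] assms by simp
  then have "Ln (exp (2 * Ln w)) = 2 * Ln w" by (intro Ln_exp) auto
  moreover have "exp (2 * Ln w) = w\<^sup>2" using w by (simp add: exp_double)
  ultimately show ?thesis using w by (simp add: powr_def mult_ac)
qed

lemma char_fun_power2:
  assumes "Re w > 0 \<or> w = 0" and \<alpha>: "\<alpha>$1 > 0" "\<alpha>$2 > 0"
  shows "char_fun \<alpha> A (w\<^sup>2) = char_sq (\<alpha>$1) (\<alpha>$2) A w"
proof (cases "w = 0")
  case True
  then show ?thesis using \<alpha> by (simp add: char_fun_def char_sq_def det_2)
next
  case False
  with assms have w: "Re w > 0" by simp
  have "w powr of_real (2 * (\<alpha>$1 + \<alpha>$2)) = w powr of_real (2 * \<alpha>$1) * w powr of_real (2 * \<alpha>$2)"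
    by (simp add: distrib_left powr_add)
  then show ?thesis using power2_powr_complex[OF w]
    by (simp add: char_fun_def char_sq_def det_2 algebra_simps)
qed

lemma norm_powr_of_real: "norm ((w :: complex) powr of_real x) = norm w powr x"
  by (simp add: norm_powr_real_powr')

section \<open>Lower bounds for the characteristic function on a sector\<close>

lemma closed_sector: "closed (sector \<tau>)"
proof -
  have "sector \<tau> = {w. Im w \<le> \<tau> * Re w} \<inter> {w. - Im w \<le> \<tau> * Re w}" by (auto simp: sector_def)
  then show ?thesis by (auto intro!: closed_Int closed_Collect_le continuous_intros)
qed

lemma sector_compact: "compact {w \<in> sector \<tau>. norm w \<le> M}"
proof -
  have "{w \<in> sector \<tau>. norm w \<le> M} = cball 0 M \<inter> sector \<tau>" by auto
  then show ?thesis using closed_sector by (auto intro: compact_Int_closed)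
qed

lemma continuous_on_powr_sector:
  "x > 0 \<Longrightarrow> \<tau> > 0 \<Longrightarrow> continuous_on (sector \<tau>) (\<lambda>w. w powr of_real x)"
  by (intro continuous_intros) (auto dest: sector_Re_nonneg)

lemma continuous_on_char_sq:
  "a > 0 \<Longrightarrow> b > 0 \<Longrightarrow> \<tau> > 0 \<Longrightarrow> continuous_on (sector \<tau>) (char_sq a b A)"
  unfolding char_sq_def by (intro continuous_intros continuous_on_powr_sector) auto

lemma char_sq_large:
  assumes a: "0 < \<nu>" "\<nu> \<le> a" "\<nu> \<le> b"
  obtains M where "\<And>w. norm w \<ge> M \<Longrightarrow> (1 + norm w powr (2 * a)) * (1 + norm w powr (2 * b)) / 8 \<le> norm (char_sq a b A w)"
proof -
  \<comment> \<open>Each entry of \<open>A\<close> is at most \<open>N / 4\<close> in modulus, and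
    \<open>M\<close> is chosen so that both powers are at least \<open>N\<close>, their orders being
    at least \<open>\<nu>\<close>. The diagonal factors then keep \<open>3/4\<close> of their powers
    and the off-diagonal product costs \<open>1/16\<close>. This leaves
    \<open>9/16 - 1/16 = 1/2\<close> of \<open>p q\<close>, and \<open>1 + p \<le> 2 p\<close>,
    \<open>1 + q \<le> 2 q\<close> turn it into \<open>1/8\<close>.\<close>
  define N where "N = 4 + 4 * (\<bar>A$1$1\<bar> + \<bar>A$1$2\<bar> + \<bar>A$2$1\<bar> + \<bar>A$2$2\<bar>)"
  define M where "M = N powr (1 / (2 * \<nu>))"
  have N: "N \<ge> 4" by (simp add: N_def)
  show ?thesis
  proof (rule that[of M])
    fix w :: complex assume w: "norm w \<ge> M"
    define p where "p = norm w powr (2 * a)"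
    define q where "q = norm w powr (2 * b)"
    have large: "N \<le> norm w powr (2 * x)" if "\<nu> \<le> x" for x
    proof -
      have "N = N powr 1" using N by simp
      also have "\<dots> \<le> N powr (x / \<nu>)" using that a N by (intro powr_mono) auto
      also have "\<dots> = M powr (2 * x)" using a N by (simp add: M_def powr_powr)
      also have "\<dots> \<le> norm w powr (2 * x)" using w that a by (intro powr_mono2) (auto simp: M_def)
      finally show ?thesis .
    qed
    have p: "N \<le> p" and q: "N \<le> q" using large a by (auto simp: p_def q_def)
    have f: "3 / 4 * p \<le> norm (w powr of_real (2 * a) - of_real (A$1$1))"
    proof -
      have "norm (w powr of_real (2 * a)) - norm (of_real (A$1$1) :: complex) \<le> norm (w powr of_real (2 * a) - of_real (A$1$1))"
        by (rule norm_triangle_ineq2)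
      then show ?thesis using p unfolding norm_powr_of_real p_def[symmetric] by (simp add: N_def)
    qed
    have g: "3 / 4 * q \<le> norm (w powr of_real (2 * b) - of_real (A$2$2))"
    proof -
      have "norm (w powr of_real (2 * b)) - norm (of_real (A$2$2) :: complex) \<le> norm (w powr of_real (2 * b) - of_real (A$2$2))"
        by (rule norm_triangle_ineq2)
      then show ?thesis using q unfolding norm_powr_of_real q_def[symmetric] by (simp add: N_def)
    qed
    have "(3 / 4 * p) * (3 / 4 * q) \<le> norm (w powr of_real (2 * a) - of_real (A$1$1)) * norm (w powr of_real (2 * b) - of_real (A$2$2))"
      using f g p q N by (intro mult_mono) auto
    moreover have "\<bar>A$1$2\<bar> * \<bar>A$2$1\<bar> \<le> (p / 4) * (q / 4)"
      using p q by (intro mult_mono) (auto simp: N_def)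
    moreover have "norm ((w powr of_real (2 * a) - of_real (A$1$1)) * (w powr of_real (2 * b) - of_real (A$2$2)))
         - norm (of_real (A$1$2) * of_real (A$2$1) :: complex) \<le> norm (char_sq a b A w)"
      unfolding char_sq_def by (rule norm_triangle_ineq2)
    ultimately have "(3 / 4 * p) * (3 / 4 * q) - (p / 4) * (q / 4) \<le> norm (char_sq a b A w)"
      by (simp add: norm_mult)
    moreover have "(1 + p) * (1 + q) \<le> (2 * p) * (2 * q)" using p q N by (intro mult_mono) auto
    ultimately have "(1 + p) * (1 + q) / 8 \<le> norm (char_sq a b A w)" by simp
    then show "(1 + norm w powr (2 * a)) * (1 + norm w powr (2 * b)) / 8 \<le> norm (char_sq a b A w)"
      by (simp add: p_def q_def)
  qed
qed

text \<open>The square maps \<open>sector 1\<close> onto the closed right half plane. The growth at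
  infinity confines the zeros in \<open>sector 2\<close> to a compact set, on which the slope
  \<open>|Im w| / Re w\<close> exceeds \<open>1\<close>; its minimum \<open>m\<close> leaves room
  for the aperture \<open>(1 + m) / 2\<close>. In the resulting sector the quotient by the model
  growth has a positive minimum on the bounded part, and is at least \<open>1/8\<close> beyond
  it.\<close>

lemma char_sq_sector_bound:
  assumes a: "0 < a" "0 < b"
    and nz: "\<And>w. w \<in> sector 1 \<Longrightarrow> char_sq a b A w \<noteq> 0"
  obtains \<tau> c where "\<tau> > 1" "c > 0"
    "\<And>w. w \<in> sector \<tau> \<Longrightarrow> c * ((1 + norm w powr (2 * a)) * (1 + norm w powr (2 * b))) \<le> norm (char_sq a b A w)"
proof -
  have mono: "sector x \<subseteq> sector y" if "x \<le> y" "x > 0" for x y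
  proof
    fix w assume w: "w \<in> sector x"
    then have "x * Re w \<le> y * Re w" using that sector_Re_nonneg by (intro mult_right_mono) auto
    then show "w \<in> sector y" using w by (simp add: sector_def)
  qed
  obtain M where M: "\<And>w. norm w \<ge> M \<Longrightarrow> (1 + norm w powr (2 * a)) * (1 + norm w powr (2 * b)) / 8 \<le> norm (char_sq a b A w)"
    using char_sq_large[of "min a b" a b A] a by auto
  define T where "T = (\<lambda>\<tau>. {w \<in> sector \<tau>. norm w \<le> max M 0})"
  have T: "compact (T \<tau>)" for \<tau> unfolding T_def by (rule sector_compact)
  define Z where "Z = {w \<in> T 2. char_sq a b A w = 0}"
  have cT: "continuous_on (T \<tau>) (char_sq a b A)" if "\<tau> > 0" for \<tau>
    using continuous_on_char_sq[OF a that] by (rule continuous_on_subset) (auto simp: T_def)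
  have "closed Z" unfolding Z_def using cT T by (intro continuous_closed_preimage_constant compact_imp_closed) auto
  then have Z: "compact Z" using T compact_Int_closed[of "T 2" Z] by (simp add: Z_def Int_def conj_commute cong: conj_cong) 
  have Zs: "w \<in> sector 2" "w \<notin> sector 1" "Re w > 0" "Re w < \<bar>Im w\<bar>" if "w \<in> Z" for w
  proof -
    show s: "w \<in> sector 2" "w \<notin> sector 1" using that nz by (auto simp: Z_def T_def)
    then have "w \<noteq> 0" by (auto simp: sector_def)
    with s show "Re w > 0" by (intro sector_Re_pos[of w 2]) auto
    show "Re w < \<bar>Im w\<bar>" using s by (simp add: sector_def)
  qed
  obtain \<tau> where \<tau>: "1 < \<tau>" "\<tau> \<le> 2" "Z \<inter> sector \<tau> = {}"
  proof (cases "Z = {}")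
    case True then show ?thesis using that[of 2] by simp
  next
    case False
    have "continuous_on Z (\<lambda>w. \<bar>Im w\<bar> / Re w)"
      using Zs(3) by (intro continuous_intros) force
    then obtain z where z: "z \<in> Z" "\<And>w. w \<in> Z \<Longrightarrow> \<bar>Im z\<bar> / Re z \<le> \<bar>Im w\<bar> / Re w"
      using continuous_attains_inf[OF Z False] by blast
    define m where "m = \<bar>Im z\<bar> / Re z"
    have m: "1 < m" "m \<le> 2" using Zs[OF z(1)] by (auto simp: m_def sector_def field_simps)
    have "w \<notin> sector ((1 + m) / 2)" if w: "w \<in> Z" for w
    proof
      assume "w \<in> sector ((1 + m) / 2)"
      then have "\<bar>Im w\<bar> / Re w \<le> (1 + m) / 2" using Zs[OF w] by (simp add: sector_def field_simps)
      moreover have "m \<le> \<bar>Im w\<bar> / Re w" using z(2)[OF w] by (simp add: m_def)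
      ultimately have "m \<le> (1 + m) / 2" by (rule order_trans[rotated])
      then show False using m by simp
    qed
    then show ?thesis using m by (intro that[of "(1 + m) / 2"]) auto
  qed
  have nz': "char_sq a b A w \<noteq> 0" if "w \<in> T \<tau>" for w
    using that \<tau> mono[of \<tau> 2] by (auto simp: Z_def T_def)
  define g where "g = (\<lambda>w. norm (char_sq a b A w) / ((1 + norm w powr (2 * a)) * (1 + norm w powr (2 * b))))"
  have den: "(1 + norm w powr (2 * a)) * (1 + norm w powr (2 * b)) > 0" for w :: complex
    by (intro mult_pos_pos add_pos_nonneg) auto
  have cn: "continuous_on (T \<tau>) (\<lambda>w. norm w powr (2 * x))" if "x > 0" for x
    using that by (intro continuous_on_powr' continuous_intros) auto
  have "continuous_on (T \<tau>) g"
    unfolding g_def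
  proof (intro continuous_on_divide continuous_on_norm continuous_on_mult continuous_on_add continuous_on_const cn cT)
    show "\<forall>w\<in>T \<tau>. (1 + norm w powr (2 * a)) * (1 + norm w powr (2 * b)) \<noteq> 0"
      using den by (metis less_irrefl)
  qed (use a \<tau> in auto)
  moreover have "0 \<in> T \<tau>" by (simp add: T_def sector_def)
  ultimately obtain z where z: "z \<in> T \<tau>" "\<And>w. w \<in> T \<tau> \<Longrightarrow> g z \<le> g w"
    using continuous_attains_inf[OF T] by blast
  have gz: "g z > 0" using nz'[OF z(1)] den by (simp add: g_def)
  show ?thesis
  proof (rule that[of \<tau> "min (g z) (1 / 8)"])
    fix w assume w: "w \<in> sector \<tau>"
    let ?d = "(1 + norm w powr (2 * a)) * (1 + norm w powr (2 * b))"
    show "min (g z) (1 / 8) * ?d \<le> norm (char_sq a b A w)"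
    proof (cases "norm w \<ge> M")
      case True
      have "min (g z) (1 / 8) * ?d \<le> 1 / 8 * ?d" using den[of w] by (intro mult_right_mono) auto
      then show ?thesis using M[OF True] by simp
    next
      case False
      then have "w \<in> T \<tau>" using w by (simp add: T_def)
      then have "min (g z) (1 / 8) * ?d \<le> g w * ?d"
        using den[of w] z(2)[of w] by (intro mult_right_mono) auto
      also have "\<dots> = norm (char_sq a b A w)"
        unfolding g_def by (rule nonzero_eq_divide_eq[THEN iffD1, OF less_imp_neq[OF den, symmetric] refl])
      finally show ?thesis .
    qed
  qed (use \<tau> gz in auto)
qed

text \<open>The numerators \<open>x + y s^b'\<close> cover every entry of the adjugate of
  \<open>diag (s^\<alpha>) - A\<close>. The factor \<open>1 + |w|^(2 b')\<close> of the denominator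
  absorbs the numerator, and the factor belonging to the other order \<open>a'\<close> remains and
  provides the decay. At the origin the constant terms of \<open>r w - r 0\<close> cancel, so what
  is left carries powers of \<open>w\<close> of degree at least \<open>2 \<nu>\<close>.\<close>

lemma resolvent_kernel:
  assumes \<nu>: "0 < \<nu>" "\<nu> \<le> a" "\<nu> \<le> b" "\<nu> \<le> 1"
    and nz: "\<And>w. w \<in> sector 1 \<Longrightarrow> char_sq a b A w \<noteq> 0"
    and b': "b' = a \<or> b' = b"
  obtains K :: "real \<Rightarrow> real" and B where
    "K \<in> borel_measurable borel"
    "\<And>t. t > 0 \<Longrightarrow> \<bar>K t\<bar> \<le> B * t powr (\<nu> / 2 - 1)"
    "\<And>t. t > 0 \<Longrightarrow> \<bar>K t\<bar> \<le> B * t powr (- 1 - \<nu>)"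
    "\<And>s. s > 0 \<Longrightarrow> (LBINT t:{0..}. exp (- s * t) * K t) =
       (x + y * s powr b') / ((s powr a - A$1$1) * (s powr b - A$2$2) - A$1$2 * A$2$1)"
proof -
  have ab: "0 < a" "0 < b" using \<nu> by auto
  obtain \<tau> c where \<tau>: "\<tau> > 1" "c > 0" and
    bd: "\<And>w. w \<in> sector \<tau> \<Longrightarrow> c * ((1 + norm w powr (2 * a)) * (1 + norm w powr (2 * b))) \<le> norm (char_sq a b A w)"
    using char_sq_sector_bound[OF ab nz] by blast
  have den: "(1 + norm w powr (2 * a)) * (1 + norm w powr (2 * b)) > 0" for w :: complex
    by (intro mult_pos_pos add_pos_nonneg) auto
  have nz': "char_sq a b A w \<noteq> 0" if "w \<in> sector \<tau>" for w
    using bd[OF that] den[of w] \<tau> mult_pos_pos[of c] by fastforce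
  define P where "P = (\<lambda>w::complex. w powr of_real (2 * b'))"
  define r where "r = (\<lambda>w. (of_real x + of_real y * P w) / char_sq a b A w)"
  have b'0: "b' > 0" "\<nu> \<le> b'" using b' \<nu> by auto
  obtain a' where a': "a' > 0" "\<nu> \<le> a'" and ab': "\<And>w. (1 + norm w powr (2 * a)) * (1 + norm w powr (2 * b)) = (1 + norm w powr (2 * a')) * (1 + norm (w::complex) powr (2 * b'))"
    using b' ab \<nu> by (metis mult.commute)
  have cont: "continuous_on (sector \<tau>) r"
    unfolding r_def P_def using nz' \<tau> ab b'0
    by (intro continuous_intros continuous_on_char_sq continuous_on_powr_sector) auto
  have hol: "r field_differentiable at w" if "w \<in> interior (sector \<tau>)" for w
  proof -
    have ws: "w \<in> sector \<tau>" using that interior_subset by blast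
    have "w \<noteq> 0"
    proof
      assume "w = 0"
      with that obtain e where e: "e > 0" "ball 0 e \<subseteq> sector \<tau>" by (auto simp: mem_interior)
      then have "- of_real (e / 2) \<in> sector \<tau>" by (intro subsetD[OF e(2)]) (simp add: dist_norm)
      then show False using sector_Re_nonneg[of "- of_real (e / 2)" \<tau>] \<tau> e by simp
    qed
    then have "Re w > 0" using sector_Re_pos[OF ws] \<tau> by simp
    then have "w \<notin> \<real>\<^sub>\<le>\<^sub>0" by (auto simp: complex_nonpos_Reals_iff)
    then have d: "(\<lambda>w. w powr z) field_differentiable at w" for z
      using has_field_derivative_powr[of w z] unfolding field_differentiable_def by blast
    show ?thesis unfolding r_def P_def char_sq_def
      by (intro derivative_intros d) (use nz'[OF ws] in \<open>simp add: char_sq_def\<close>)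
  qed
  have cnjP: "cnj (w powr of_real z) = cnj w powr of_real z" if "w \<in> sector \<tau>" for w and z :: real
    using cnj_powr[of w "of_real z"] sector_Re_nonneg[OF that] \<tau> by simp
  have cnj_r: "r (cnj w) = cnj (r w)" if "w \<in> sector \<tau>" for w
    unfolding r_def P_def char_sq_def by (simp add: cnjP[OF that] del: of_real_mult)
  have small: "norm w powr p \<le> norm w powr q" if "norm w \<le> 1" "0 < q" "q \<le> p" for w :: complex and p q
    using that powr_mono'[of q p "norm w"] by (cases "w = 0") auto
  define C1 where "C1 = (\<bar>x\<bar> + \<bar>y\<bar>) / c"
  have decay: "norm (r w) \<le> C1 * norm w powr (- \<nu>)" if w: "w \<in> sector \<tau>" and w0: "w \<noteq> 0" for w
  proof -
    let ?n = "norm w"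
    have "norm (of_real x + of_real y * P w) \<le> \<bar>x\<bar> + \<bar>y\<bar> * ?n powr (2 * b')"
      using norm_triangle_ineq[of "of_real x" "of_real y * P w"] by (simp add: norm_mult P_def norm_powr_of_real del: of_real_mult)
    also have "\<dots> \<le> (\<bar>x\<bar> + \<bar>y\<bar>) * (1 + ?n powr (2 * b'))" by (simp add: algebra_simps)
    finally have num: "norm (of_real x + of_real y * P w) \<le> (\<bar>x\<bar> + \<bar>y\<bar>) * (1 + ?n powr (2 * b'))" .
    have "norm (r w) \<le> ((\<bar>x\<bar> + \<bar>y\<bar>) * (1 + ?n powr (2 * b'))) / (c * ((1 + ?n powr (2 * a')) * (1 + ?n powr (2 * b'))))"
      unfolding r_def norm_divide using num bd[OF w] den[of w] \<tau> unfolding ab' by (intro frac_le) auto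
    also have "\<dots> = C1 / (1 + ?n powr (2 * a'))"
    proof -
      have "1 + ?n powr (2 * b') \<noteq> 0" by (metis add_nonneg_eq_0_iff powr_ge_zero zero_le_one zero_neq_one)
      then show ?thesis by (simp add: C1_def)
    qed
    also have "\<dots> \<le> C1 / ?n powr \<nu>"
    proof -
      have "?n powr \<nu> \<le> 1 + ?n powr (2 * a')"
      proof (cases "?n \<le> 1")
        case True
        then have "?n powr \<nu> \<le> 1" using w0 \<nu> by (simp add: powr_le1)
        then show ?thesis by (simp add: add_increasing2)
      next
        case False
        then have "?n powr \<nu> \<le> ?n powr (2 * a')" using a' \<nu> by (intro powr_mono) auto
        then show ?thesis by simp
      qed
      then show ?thesis using \<tau> w0 by (intro divide_left_mono) (auto simp: C1_def add_pos_nonneg)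
    qed
    also have "\<dots> = C1 * ?n powr (- \<nu>)" by (simp add: powr_minus_divide)
    finally show ?thesis .
  qed
  define Q0 where "Q0 = A$1$1 * A$2$2 - A$1$2 * A$2$1"
  have Q0: "char_sq a b A 0 = of_real Q0" by (simp add: char_sq_def Q0_def)
  have Q0nz: "Q0 \<noteq> 0" using nz'[of 0] Q0 by (auto simp: sector_def)
  define L where "L = \<bar>y\<bar> * \<bar>Q0\<bar> + \<bar>x\<bar> * (1 + \<bar>A$1$1\<bar> + \<bar>A$2$2\<bar>)"
  define C2 where "C2 = 3 * L / (c * \<bar>Q0\<bar>)"
  have L0: "L \<ge> 0" by (simp add: L_def)
  have hoelder: "norm (r w - r 0) \<le> C2 * norm w powr (2 * \<nu>)" if w: "w \<in> sector \<tau>" for w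
  proof -
    define X where "X = w powr of_real (2 * a)"
    define Y where "Y = w powr of_real (2 * b)"
    define p where "p = norm w powr (2 * a)"
    define q where "q = norm w powr (2 * b)"
    have pq: "norm X = p" "norm Y = q" "0 \<le> p" "0 \<le> q" by (simp_all add: X_def Y_def p_def q_def norm_powr_of_real del: of_real_mult)
    have Qw: "char_sq a b A w = of_real Q0 + (X * Y - of_real (A$1$1) * Y - of_real (A$2$2) * X)"
      by (simp add: char_sq_def X_def Y_def Q0_def algebra_simps)
    \<comment> \<open>The numerator of \<open>r w - r 0\<close> over the denominator
      \<open>Q(w) Q(0)\<close>, from which the constant \<open>x Q(0)\<close> has dropped out: each
      remaining term contains \<open>X\<close>, \<open>Y\<close> or \<open>P w\<close>.\<close>
    define n where "n = of_real y * P w * of_real Q0 - of_real x * (X * Y - of_real (A$1$1) * Y - of_real (A$2$2) * X)"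
    have r0: "r 0 = of_real x / of_real Q0" using b'0 by (simp add: r_def P_def Q0)
    have "r w - r 0 = ((of_real x + of_real y * P w) * of_real Q0 - of_real x * char_sq a b A w) / (char_sq a b A w * of_real Q0)"
      unfolding r0 unfolding r_def using nz'[OF w] Q0nz by (intro diff_frac_eq) auto
    also have "(of_real x + of_real y * P w) * of_real Q0 - of_real x * char_sq a b A w = n"
      unfolding Qw n_def by (simp add: algebra_simps)
    finally have rr: "r w - r 0 = n / (char_sq a b A w * of_real Q0)" .
    have Pw: "norm (P w) \<le> p + q" using b' pq by (auto simp: P_def norm_powr_of_real p_def q_def simp del: of_real_mult)
    have "norm n \<le> norm (of_real y * P w * of_real Q0) + norm (of_real x * (X * Y - of_real (A$1$1) * Y - of_real (A$2$2) * X))"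
      unfolding n_def by (rule norm_triangle_ineq4)
    also have "norm (of_real y * P w * of_real Q0) \<le> \<bar>y\<bar> * \<bar>Q0\<bar> * (p + q)"
      using mult_left_mono[OF Pw, of "\<bar>y\<bar> * \<bar>Q0\<bar>"] by (simp add: norm_mult mult_ac)
    also have "norm (of_real x * (X * Y - of_real (A$1$1) * Y - of_real (A$2$2) * X)) \<le> \<bar>x\<bar> * (p * q + \<bar>A$1$1\<bar> * q + \<bar>A$2$2\<bar> * p)"
    proof -
      have "norm (X * Y - of_real (A$1$1) * Y - of_real (A$2$2) * X) \<le> norm (X * Y) + norm (of_real (A$1$1) * Y) + norm (of_real (A$2$2) * X)"
        by (rule order_trans[OF norm_triangle_ineq4]) (intro add_right_mono norm_triangle_ineq4)
      then have "norm (X * Y - of_real (A$1$1) * Y - of_real (A$2$2) * X) \<le> p * q + \<bar>A$1$1\<bar> * q + \<bar>A$2$2\<bar> * p"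
        by (simp add: norm_mult pq)
      then show ?thesis by (simp add: norm_mult mult_left_mono)
    qed
    also have "\<bar>y\<bar> * \<bar>Q0\<bar> * (p + q) + \<bar>x\<bar> * (p * q + \<bar>A$1$1\<bar> * q + \<bar>A$2$2\<bar> * p) \<le> L * (p + q + p * q)"
    proof -
      have "\<bar>y\<bar> * \<bar>Q0\<bar> * (p + q) \<le> \<bar>y\<bar> * \<bar>Q0\<bar> * (p + q + p * q)" using pq by (intro mult_left_mono) auto
      moreover have "p * q + \<bar>A$1$1\<bar> * q + \<bar>A$2$2\<bar> * p \<le> (1 + \<bar>A$1$1\<bar> + \<bar>A$2$2\<bar>) * (p + q + p * q)"
      proof -
        have "1 * (p * q) \<le> 1 * (p + q + p * q)" "\<bar>A$1$1\<bar> * q \<le> \<bar>A$1$1\<bar> * (p + q + p * q)" "\<bar>A$2$2\<bar> * p \<le> \<bar>A$2$2\<bar> * (p + q + p * q)"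
          using pq by (intro mult_left_mono; simp)+
        then show ?thesis unfolding distrib_right by linarith
      qed
      then have "\<bar>x\<bar> * (p * q + \<bar>A$1$1\<bar> * q + \<bar>A$2$2\<bar> * p) \<le> \<bar>x\<bar> * ((1 + \<bar>A$1$1\<bar> + \<bar>A$2$2\<bar>) * (p + q + p * q))"
        by (intro mult_left_mono) auto
      ultimately show ?thesis by (simp add: L_def distrib_right mult.assoc)
    qed
    finally have nn: "norm n \<le> L * (p + q + p * q)" by simp
    have dpos: "(1 + p) * (1 + q) > 0" using pq by (intro mult_pos_pos) auto
    \<comment> \<open>In the unit disc each of \<open>p\<close>, \<open>q\<close> and
      \<open>p q\<close> is at most \<open>norm w powr (2 * \<nu>)\<close>, which explains the
      \<open>3\<close>; outside it the quotient is at most \<open>1\<close> and the right hand side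
      is larger than that.\<close>
    have frac: "(p + q + p * q) / ((1 + p) * (1 + q)) \<le> 3 * norm w powr (2 * \<nu>)"
    proof (cases "norm w \<le> 1")
      case True
      have pl: "p \<le> norm w powr (2 * \<nu>)" "q \<le> norm w powr (2 * \<nu>)"
        using small[OF True, of "2 * \<nu>"] \<nu> by (auto simp: p_def q_def)
      have "q \<le> 1" unfolding q_def using True \<nu> by (simp add: powr_le1)
      then have "p * q \<le> p * 1" using pq by (intro mult_left_mono) auto
      then have "p + q + p * q \<le> 3 * norm w powr (2 * \<nu>)" using pl by simp
      moreover have "(p + q + p * q) / ((1 + p) * (1 + q)) \<le> (p + q + p * q) / 1"
        using pq by (intro divide_left_mono) (auto simp: algebra_simps intro!: add_pos_nonneg)
      ultimately show ?thesis by simp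
    next
      case False
      have "(p + q + p * q) / ((1 + p) * (1 + q)) \<le> 1" using dpos by (simp add: algebra_simps)
      also have "1 \<le> norm w powr (2 * \<nu>)" using False \<nu> by (simp add: ge_one_powr_ge_zero)
      also have "norm w powr (2 * \<nu>) \<le> 3 * norm w powr (2 * \<nu>)" by simp
      finally show ?thesis .
    qed
    have "norm (r w - r 0) \<le> L * (p + q + p * q) / (c * ((1 + p) * (1 + q)) * \<bar>Q0\<bar>)"
      unfolding rr norm_divide norm_mult using nn bd[OF w] dpos \<tau> Q0nz L0 pq(3,4)
      by (intro frac_le mult_right_mono) (auto simp: p_def q_def)
    also have "\<dots> = L / (c * \<bar>Q0\<bar>) * ((p + q + p * q) / ((1 + p) * (1 + q)))" by (simp add: field_simps)
    also have "\<dots> \<le> L / (c * \<bar>Q0\<bar>) * (3 * norm w powr (2 * \<nu>))"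
      using L0 \<tau> by (intro mult_left_mono frac) auto
    also have "\<dots> = C2 * norm w powr (2 * \<nu>)" by (simp add: C2_def)
    finally show ?thesis .
  qed
  have C: "C1 * z \<le> max C1 C2 * z" "C2 * z \<le> max C1 C2 * z" if "z \<ge> 0" for z
    using that by (auto intro: mult_right_mono)
  have real: "of_real (sqrt s) powr of_real (2 * z) = (of_real (s powr z) :: complex)" if "s > 0" for s z
  proof -
    have "of_real (sqrt s) powr of_real (2 * z) = (of_real (sqrt s powr (2 * z)) :: complex)"
      using that by (intro powr_of_real) auto
    also have "sqrt s powr (2 * z) = s powr z"
      using that by (simp add: powr_powr flip: powr_half_sqrt)
    finally show ?thesis .
  qed
  have rs: "r (of_real (sqrt s)) = of_real ((x + y * s powr b') / ((s powr a - A$1$1) * (s powr b - A$2$2) - A$1$2 * A$2$1))"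
    if "s > 0" for s
    unfolding r_def P_def char_sq_def real[OF that] by simp
  show ?thesis
  proof (rule sector_inverse_laplace[OF \<tau>(1) \<nu>(1,4) cont hol cnj_r])
    show "norm (r w) \<le> max C1 C2 * norm w powr (- \<nu>)" if "w \<in> sector \<tau>" "w \<noteq> 0" for w
      using decay[OF that] C(1) by (rule order_trans) simp
    show "norm (r w - r 0) \<le> max C1 C2 * norm w powr (2 * \<nu>)" if "w \<in> sector \<tau>" for w
      using hoelder[OF that] C(2) by (rule order_trans) simp
  next
    fix K B
    assume K: "K \<in> borel_measurable borel" "\<And>t. t > 0 \<Longrightarrow> \<bar>K t\<bar> \<le> B * t powr (\<nu> / 2 - 1)"
      "\<And>t. t > 0 \<Longrightarrow> \<bar>K t\<bar> \<le> B * t powr (- 1 - \<nu>)"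
      "\<And>s. s > 0 \<Longrightarrow> (LBINT t:{0..}. exp (- s * t) * K t) = Re (r (of_real (sqrt s)))"
    show ?thesis
    proof (rule that[OF K(1-3)])
      fix s :: real assume s: "s > 0"
      show "(LBINT t:{0..}. exp (- s * t) * K t) = (x + y * s powr b') / ((s powr a - A$1$1) * (s powr b - A$2$2) - A$1$2 * A$2$1)"
        unfolding K(4)[OF s] rs[OF s] by (rule Re_complex_of_real)
    qed
  qed
qed

text \<open>With the absolute value the weight is positive and continuous on the whole line, the domain of the
  bounded continuous functions in the fixed point argument.\<close>

definition weight :: "real \<Rightarrow> real \<Rightarrow> real" where
  "weight \<nu> t = (1 + \<bar>t\<bar>) powr (- \<nu>)"

section \<open>Power-law kernels against the polynomial weight\<close>

lemma weight_pos: "weight \<nu> t > 0" by (simp add: weight_def)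

lemma weight_le_1: "\<nu> \<ge> 0 \<Longrightarrow> weight \<nu> t \<le> 1"
  using powr_mono2'[of "- \<nu>" 1 "1 + \<bar>t\<bar>"] by (simp add: weight_def)

lemma continuous_on_weight: "continuous_on S (weight \<nu>)"
  unfolding weight_def by (intro continuous_intros) (auto simp: add_nonneg_eq_0_iff)

text \<open>Serves to replace a power of \<open>s\<close> by the weight at \<open>t\<close> once
  \<open>s\<close> is at least a fixed fraction of \<open>1 + t\<close>. The loss is
  \<open>c powr (- \<nu>)\<close>, which is at most \<open>1 / c\<close> because
  \<open>\<nu> \<le> 1\<close>.\<close>

lemma powr_le_weight: "0 \<le> \<nu> \<Longrightarrow> \<nu> \<le> 1 \<Longrightarrow> 0 \<le> t \<Longrightarrow> c > 0 \<Longrightarrow> c \<le> 1 \<Longrightarrow> c * (1 + t) \<le> s \<Longrightarrow> s powr (- \<nu>) \<le> (1 / c) * weight \<nu> t"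
proof -
  assume a: "0 \<le> \<nu>" "\<nu> \<le> 1" "0 \<le> t" "c > 0" "c \<le> 1" "c * (1 + t) \<le> s"
  have "s powr (- \<nu>) \<le> (c * (1 + t)) powr (- \<nu>)" using a by (intro powr_mono2') auto
  also have "\<dots> = c powr (- \<nu>) * weight \<nu> t" using a by (simp add: powr_mult weight_def)
  also have "c powr (- \<nu>) \<le> c powr (- 1)" using a by (intro powr_mono') auto
  also have "c powr (- 1) = 1 / c" using a by (simp add: powr_minus_divide)
  finally show ?thesis using weight_pos[of \<nu> t] by (simp add: mult_right_mono)
qed

lemma LBINT_powr_tail:
  fixes T \<nu> :: real
  assumes "T > 0" "\<nu> > 0"
  shows "set_integrable lborel {T..} (\<lambda>s. s powr (- 1 - \<nu>))"
    and "(LBINT s:{T..}. s powr (- 1 - \<nu>)) = T powr (- \<nu>) / \<nu>"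
proof -
  have h: "((\<lambda>s. s powr (- 1 - \<nu>)) has_integral T powr (- \<nu>) / \<nu>) {T..}"
  proof -
    have "- (T powr (- 1 - \<nu> + 1)) / (- 1 - \<nu> + 1) = T powr (- \<nu>) / \<nu>" by simp
    then show ?thesis using has_integral_powr_to_inf[of "- 1 - \<nu>" T] assms by simp
  qed
  have "integral\<^sup>N lborel (\<lambda>x. indicator {T..} x * x powr (- 1 - \<nu>)) = ennreal (T powr (- \<nu>) / \<nu>)"
    using nn_integral_has_integral_lebesgue[OF _ h] by simp
  then have "has_bochner_integral lborel (\<lambda>x. indicator {T..} x * x powr (- 1 - \<nu>)) (T powr (- \<nu>) / \<nu>)"
    using assms by (intro has_bochner_integral_nn_integral) auto
  then show "set_integrable lborel {T..} (\<lambda>s. s powr (- 1 - \<nu>))"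
    "(LBINT s:{T..}. s powr (- 1 - \<nu>)) = T powr (- \<nu>) / \<nu>"
    by (simp_all add: has_bochner_integral_iff set_integrable_def set_lebesgue_integral_def)
qed

lemma set_integrable_bound_except_0:
  fixes K g :: "real \<Rightarrow> real"
  assumes "set_integrable lborel S g" "K \<in> borel_measurable borel" "S \<in> sets borel"
    and "\<And>t. t \<in> S \<Longrightarrow> t \<noteq> 0 \<Longrightarrow> \<bar>K t\<bar> \<le> g t"
  shows "set_integrable lborel S K"
  unfolding set_integrable_def
proof (rule Bochner_Integration.integrable_bound)
  show "integrable lborel (\<lambda>x. indicator S x *\<^sub>R g x)" using assms(1) by (simp add: set_integrable_def)
  show "(\<lambda>x. indicator S x *\<^sub>R K x) \<in> borel_measurable lborel" using assms(2,3) by simp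
  have "AE t::real in lborel. t \<noteq> 0" by (rule AE_lborel_singleton)
  then show "AE x in lborel. norm (indicator S x *\<^sub>R K x) \<le> norm (indicator S x *\<^sub>R g x)"
    by eventually_elim (use assms(4) in \<open>auto simp: indicator_def intro: order_trans[OF _ abs_ge_self]\<close>)
qed

text \<open>For \<open>t > 1\<close> the convolution is split at \<open>s = t / 2\<close>. Below,
  the weight at \<open>t - s\<close> is comparable to the weight at \<open>t\<close> and the kernel
  has finite mass. Above, the kernel is at most \<open>B (t/2)^(-1-\<nu>)\<close>, the weight at
  most \<open>1\<close> and the interval no longer than \<open>t\<close>, which again gives the
  order \<open>t^(-\<nu>)\<close>; the integral of \<open>s^(-1-\<nu>)\<close> beyond
  \<open>t\<close> has the same order. For \<open>t \<le> 1\<close> the weight is at least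
  \<open>1/2\<close>, so the total mass suffices.\<close>

lemma kernel_bounds:
  fixes K :: "real \<Rightarrow> real"
  assumes \<nu>: "0 < \<nu>" "\<nu> \<le> 1" and Km: "K \<in> borel_measurable borel"
    and K1: "\<And>t. t > 0 \<Longrightarrow> \<bar>K t\<bar> \<le> B * t powr (\<nu> / 2 - 1)"
    and K2: "\<And>t. t > 0 \<Longrightarrow> \<bar>K t\<bar> \<le> B * t powr (- 1 - \<nu>)"
  obtains M where "M \<ge> 0" "set_integrable lborel {0..} K"
    "\<And>t. t \<ge> 0 \<Longrightarrow> conv (\<lambda>s. \<bar>K s\<bar>) (weight \<nu>) t \<le> M * weight \<nu> t"
    "\<And>t. t \<ge> 0 \<Longrightarrow> \<bar>(LBINT s:{0..t}. K s) - (LBINT s:{0..}. K s)\<bar> \<le> M * weight \<nu> t"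
proof -
  have B: "B \<ge> 0" using K1[of 1] by simp
  have G: "Gamma (\<nu> / 2) > 0" using \<nu> by (intro Gamma_real_pos) auto
  have "set_integrable lborel {0..1} K"
  proof (rule set_integrable_bound_except_0[OF _ Km])
    show "set_integrable lborel {0..1} (\<lambda>t. B * Gamma (\<nu> / 2) * rl_kernel (\<nu> / 2) t)"
      using rl_kernel_integrable[of "\<nu> / 2" 1] \<nu> by simp
    show "\<bar>K t\<bar> \<le> B * Gamma (\<nu> / 2) * rl_kernel (\<nu> / 2) t" if "t \<in> {0..1}" "t \<noteq> 0" for t
      using K1[of t] that G by (simp add: rl_kernel_def)
  qed auto
  moreover have "set_integrable lborel {1..} K"
  proof (rule set_integrable_bound_except_0[OF _ Km])
    show "set_integrable lborel {1..} (\<lambda>t. B * t powr (- 1 - \<nu>))"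
      using LBINT_powr_tail(1)[of 1 \<nu>] \<nu> by simp
  qed (use K2 in auto)
  ultimately have "set_integrable lborel ({0..1} \<union> {1..}) K" by (intro set_integrable_Un) auto
  also have "{0..1} \<union> {1..} = {0::real..}" by auto
  finally have Ki: "set_integrable lborel {0..} K" .
  then have Ka: "set_integrable lborel {0..} (\<lambda>s. \<bar>K s\<bar>)" by (rule set_integrable_abs)
  define N where "N = (LBINT s:{0..}. \<bar>K s\<bar>)"
  have N: "N \<ge> 0" unfolding N_def set_lebesgue_integral_def by (intro integral_nonneg_AE) auto
  have sub: "(LBINT s:S. \<bar>K s\<bar>) \<le> N" if "S \<subseteq> {0..}" "S \<in> sets borel" for S
    unfolding N_def set_lebesgue_integral_def
    using that Ka set_integrable_subset[OF Ka, of S] unfolding set_integrable_def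
    by (intro integral_mono) (auto simp: indicator_def)
  \<comment> \<open>Large enough for all cases: \<open>2 N\<close> when \<open>t \<le> 1\<close>,
    \<open>2 N + 8 B\<close> for the convolution and \<open>2 B / \<nu>\<close> for the tail when
    \<open>t > 1\<close>.\<close>
  define M where "M = 4 * N + 8 * B + 2 * B / \<nu>"
  have small: "1 \<le> 2 * weight \<nu> t" if "0 \<le> t" "t \<le> 1" for t
    using powr_le_weight[of \<nu> t "1/2" 1] that \<nu> by simp
  have wpos: "0 < weight \<nu> t" for t by (rule weight_pos)
  have wm: "weight \<nu> a * \<bar>b\<bar> \<le> \<bar>b\<bar>" for a b
    using mult_right_mono[OF weight_le_1, of \<nu> "\<bar>b\<bar>" a] \<nu> by simp
  show ?thesis
  proof (rule that[of M])
    show "M \<ge> 0" using N B \<nu> by (simp add: M_def)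
    show "set_integrable lborel {0..} K" by fact
  next
    fix t :: real assume t: "t \<ge> 0"
    have Kt: "set_integrable lborel {0..t} (\<lambda>s. \<bar>K s\<bar>)" using Ka by (rule set_integrable_subset) auto
    have "set_integrable lborel {0..t} (\<lambda>s. \<bar>K (t - s)\<bar> * weight \<nu> s)"
      by (rule conv_integrable[OF Kt continuous_on_weight])
    have i: "set_integrable lborel {0..t} (\<lambda>s. weight \<nu> (t - s) * \<bar>K s\<bar>)"
    proof (rule set_integrable_bound[OF Kt])
      show "set_borel_measurable lborel {0..t} (\<lambda>s. weight \<nu> (t - s) * \<bar>K s\<bar>)"
        unfolding set_borel_measurable_def weight_def using Km by measurable
      show "AE s in lborel. s \<in> {0..t} \<longrightarrow> norm (weight \<nu> (t - s) * \<bar>K s\<bar>) \<le> norm \<bar>K s\<bar>"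
        using wm wpos by (simp add: abs_mult abs_of_pos)
    qed
    have eq: "conv (\<lambda>s. \<bar>K s\<bar>) (weight \<nu>) t = (LBINT s:{0..t}. weight \<nu> (t - s) * \<bar>K s\<bar>)"
      by (subst conv_commute) (simp add: conv_def)
    show "conv (\<lambda>s. \<bar>K s\<bar>) (weight \<nu>) t \<le> M * weight \<nu> t"
    proof (cases "t \<le> 1")
      case True
      have "conv (\<lambda>s. \<bar>K s\<bar>) (weight \<nu>) t \<le> (LBINT s:{0..t}. \<bar>K s\<bar>)"
        unfolding eq by (intro set_integral_mono i Kt wm)
      also have "\<dots> \<le> N" by (rule sub) auto
      also have "N \<le> N * (2 * weight \<nu> t)" using mult_left_mono[OF small[OF t True] N] by simp
      also have "\<dots> = (2 * N) * weight \<nu> t" by simp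
      also have "\<dots> \<le> M * weight \<nu> t" using N B \<nu> wpos less_imp_le by (intro mult_right_mono) (auto simp: M_def)
      finally show ?thesis .
    next
      case False
      define c where "c = B * (t / 2) powr (- 1 - \<nu>)"
      have c0: "c \<ge> 0" using B by (simp add: c_def)
      have pw: "weight \<nu> (t - s) * \<bar>K s\<bar> \<le> 2 * weight \<nu> t * \<bar>K s\<bar> + c" if s: "s \<in> {0..t}" for s
      proof (cases "s \<le> t / 2")
        case True
        have "weight \<nu> (t - s) \<le> 2 * weight \<nu> t"
          using powr_le_weight[of \<nu> t "1/2" "1 + (t - s)"] \<nu> s True by (simp add: weight_def)
        then have "weight \<nu> (t - s) * \<bar>K s\<bar> \<le> 2 * weight \<nu> t * \<bar>K s\<bar>" by (intro mult_right_mono) auto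
        then show ?thesis using c0 by simp
      next
        case False
        have "\<bar>K s\<bar> \<le> B * s powr (- 1 - \<nu>)" using False t by (intro K2) auto
        also have "\<dots> \<le> c" unfolding c_def using False t B \<open>\<not> t \<le> 1\<close> \<nu> by (intro mult_left_mono powr_mono2') auto
        finally have "weight \<nu> (t - s) * \<bar>K s\<bar> \<le> 1 * c"
          using weight_le_1[of \<nu>] wpos \<nu> less_imp_le by (intro mult_mono) auto
        moreover have "0 \<le> 2 * weight \<nu> t * \<bar>K s\<bar>" using wpos[of t] by simp
        ultimately show ?thesis by linarith
      qed
      have ci: "set_integrable lborel {0..t} (\<lambda>s. c)" by (rule borel_integrable_atLeastAtMost') simp
      have "conv (\<lambda>s. \<bar>K s\<bar>) (weight \<nu>) t \<le> (LBINT s:{0..t}. 2 * weight \<nu> t * \<bar>K s\<bar> + c)"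
        unfolding eq by (intro set_integral_mono i pw set_integral_add(1) ci set_integrable_mult_right Kt)
      also have "\<dots> = 2 * weight \<nu> t * (LBINT s:{0..t}. \<bar>K s\<bar>) + t * c"
        using Kt ci t set_borel_integral_eq_integral(2)[OF ci] by (subst set_integral_add(2)) auto
      also have "\<dots> \<le> 2 * weight \<nu> t * N + 8 * B * weight \<nu> t"
      proof (intro add_mono mult_left_mono sub)
        have "(t / 2) powr (- 1 - \<nu>) * (t / 2) = (t / 2) powr (- \<nu>)"
          using False powr_add[of "t / 2" "- 1 - \<nu>" 1] by simp
        then have "t * c = 2 * B * (t / 2) powr (- \<nu>)" by (simp add: c_def mult_ac)
        also have "(t / 2) powr (- \<nu>) \<le> (1 / (1 / 4)) * weight \<nu> t"
          using False \<nu> by (intro powr_le_weight) auto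
        finally show "t * c \<le> 8 * B * weight \<nu> t" using B by (simp add: mult_left_mono)
      qed (use wpos[of t] in auto)
      also have "\<dots> = (2 * N + 8 * B) * weight \<nu> t" by (simp add: algebra_simps)
      also have "\<dots> \<le> M * weight \<nu> t" using N B \<nu> wpos less_imp_le by (intro mult_right_mono) (auto simp: M_def)
      finally show ?thesis .
    qed
    have Kti: "set_integrable lborel {0..t} K" "set_integrable lborel {t<..} K"
      using t by (auto intro: set_integrable_subset[OF Ki])
    have "(LBINT s:{0..t} \<union> {t<..}. K s) = (LBINT s:{0..t}. K s) + (LBINT s:{t<..}. K s)"
      by (rule set_integral_Un) (use Kti in auto)
    moreover have "{0..t} \<union> {t<..} = {0..}" using t by auto
    ultimately have "\<bar>(LBINT s:{0..t}. K s) - (LBINT s:{0..}. K s)\<bar> = \<bar>LBINT s:{t<..}. K s\<bar>" by simp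
    also have "\<dots> \<le> (LBINT s:{t<..}. \<bar>K s\<bar>)"
      using set_integral_norm_bound[OF Kti(2)] by simp
    also have "\<dots> \<le> M * weight \<nu> t"
    proof (cases "t \<le> 1")
      case True
      have "(LBINT s:{t<..}. \<bar>K s\<bar>) \<le> N" using t by (intro sub) auto
      also have "N \<le> N * (2 * weight \<nu> t)" using mult_left_mono[OF small[OF t True] N] by simp
      also have "\<dots> = (2 * N) * weight \<nu> t" by simp
      also have "\<dots> \<le> M * weight \<nu> t" using N B \<nu> wpos less_imp_le by (intro mult_right_mono) (auto simp: M_def)
      finally show ?thesis .
    next
      case False
      have tl: "set_integrable lborel {t..} (\<lambda>s. s powr (- 1 - \<nu>))"
        using False \<nu> by (intro LBINT_powr_tail) auto
      have "(LBINT s:{t<..}. \<bar>K s\<bar>) \<le> (LBINT s:{t..}. B * s powr (- 1 - \<nu>))"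
        unfolding set_lebesgue_integral_def
      proof (rule integral_mono)
        show "integrable lborel (\<lambda>x. indicator {t<..} x *\<^sub>R \<bar>K x\<bar>)"
          using set_integrable_abs[OF Kti(2)] by (simp add: set_integrable_def)
        show "integrable lborel (\<lambda>x. indicator {t..} x *\<^sub>R (B * x powr (- 1 - \<nu>)))"
          using tl set_integrable_mult_right[of B lborel "{t..}"] by (simp add: set_integrable_def)
        show "indicator {t<..} x *\<^sub>R \<bar>K x\<bar> \<le> indicator {t..} x *\<^sub>R (B * x powr (- 1 - \<nu>))" for x
          using K2[of x] False B by (auto simp: indicator_def)
      qed
      also have "\<dots> = B * (t powr (- \<nu>) / \<nu>)"
        using False \<nu> LBINT_powr_tail(2)[of t \<nu>] by simp
      also have "\<dots> \<le> B * ((1 / (1 / 2)) * weight \<nu> t / \<nu>)"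
        using False \<nu> B by (intro mult_left_mono divide_right_mono powr_le_weight) auto
      also have "\<dots> = (2 * B / \<nu>) * weight \<nu> t" by simp
      also have "\<dots> \<le> M * weight \<nu> t" using N B \<nu> wpos less_imp_le by (intro mult_right_mono) (auto simp: M_def)
      finally show ?thesis .
    qed
    finally show "\<bar>(LBINT s:{0..t}. K s) - (LBINT s:{0..}. K s)\<bar> \<le> M * weight \<nu> t" .
  qed
qed

section \<open>Resolvent kernels on the Laplace side\<close>

lemma laplace_integrable_of_integrable:
  fixes K :: "real \<Rightarrow> real"
  assumes "set_integrable lborel {0..} K" "p \<ge> 0"
  shows "set_integrable lborel {0..} (\<lambda>s. exp (- p * s) * K s)"
  unfolding set_integrable_def
proof (rule Bochner_Integration.integrable_bound)
  show "integrable lborel (\<lambda>s. indicator {0..} s *\<^sub>R K s)" using assms by (simp add: set_integrable_def)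
  then have "(\<lambda>s. indicator {0..} s *\<^sub>R K s) \<in> borel_measurable borel"
    by (auto dest: borel_measurable_integrable)
  then have "(\<lambda>s. exp (- p * s) *\<^sub>R (indicator {0..} s *\<^sub>R K s)) \<in> borel_measurable borel" by measurable
  then show "(\<lambda>s. indicator {0..} s *\<^sub>R (exp (- p * s) * K s)) \<in> borel_measurable lborel" by (simp add: mult_ac)
  show "AE s in lborel. norm (indicator {0..} s *\<^sub>R (exp (- p * s) * K s)) \<le> norm (indicator {0..} s *\<^sub>R K s)"
    using assms(2) by (intro AE_I2) (auto simp: indicator_def abs_mult intro!: mult_left_le_one_le)
qed

text \<open>The transforms of the kernels are known for positive arguments; this passage to the
  limit along \<open>1 / (n + 1)\<close> reaches the argument \<open>0\<close>, that is, the total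
  integral.\<close>

lemma laplace_tendsto_integral:
  fixes K :: "real \<Rightarrow> real"
  assumes K: "set_integrable lborel {0..} K"
  shows "((\<lambda>n. LBINT s:{0..}. exp (- (1 / real (Suc n)) * s) * K s) \<longlonglongrightarrow> (LBINT s:{0..}. K s))"
  unfolding set_lebesgue_integral_def
proof (rule integral_dominated_convergence[where w="\<lambda>s. norm (indicator {0..} s *\<^sub>R K s)"])
  show "integrable lborel (\<lambda>s. norm (indicator {0..} s *\<^sub>R K s))"
    using K by (simp add: set_integrable_def)
  show "(\<lambda>s. indicator {0..} s *\<^sub>R K s) \<in> borel_measurable lborel"
    using K by (auto simp: set_integrable_def dest: borel_measurable_integrable)
  show "(\<lambda>s. indicator {0..} s *\<^sub>R (exp (- (1 / real (Suc n)) * s) * K s)) \<in> borel_measurable lborel" for n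
    using laplace_integrable_of_integrable[OF K, of "1 / real (Suc n)"]
    unfolding set_integrable_def by (rule_tac borel_measurable_integrable) auto
  show "AE s in lborel. norm (indicator {0..} s *\<^sub>R (exp (- (1 / real (Suc n)) * s) * K s)) \<le> norm (indicator {0..} s *\<^sub>R K s)" for n
    by (intro AE_I2) (auto simp: indicator_def abs_mult intro!: mult_left_le_one_le)
  show "AE s in lborel. (\<lambda>n. indicator {0..} s *\<^sub>R (exp (- (1 / real (Suc n)) * s) * K s)) \<longlonglongrightarrow> indicator {0..} s *\<^sub>R K s"
  proof (rule AE_I2)
    fix s
    have "(\<lambda>n. 1 / real (Suc n)) \<longlonglongrightarrow> 0" using LIMSEQ_inverse_real_of_nat by (simp add: inverse_eq_divide)
    then have "(\<lambda>n. indicator {0..} s *\<^sub>R (exp (- (1 / real (Suc n)) * s) * K s)) \<longlonglongrightarrow> indicator {0..} s *\<^sub>R (exp (- 0 * s) * K s)"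
      by (intro tendsto_intros)
    then show "(\<lambda>n. indicator {0..} s *\<^sub>R (exp (- (1 / real (Suc n)) * s) * K s)) \<longlonglongrightarrow> indicator {0..} s *\<^sub>R K s" by simp
  qed
qed

text \<open>\<open>K_laplace\<close> is the identity
  \<open>(diag (s^\<alpha>) - A) L(s) = I\<close>, entry by entry, where \<open>L(s)\<close> is the
  transform of the kernel matrix. In this form no inverse and no characteristic function occur in
  the later arguments.\<close>

locale resolvent =
  fixes \<alpha> :: "real^2" and A :: "real^2^2" and K :: "2 \<Rightarrow> 2 \<Rightarrow> real \<Rightarrow> real" and M \<nu> :: real
  assumes \<alpha>_pos: "\<alpha> $ i > 0"
    and \<nu>_pos: "\<nu> > 0"
    and M_nonneg: "M \<ge> 0"
    and K_int: "set_integrable lborel {0..} (K i j)"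
    and K_weight: "t \<ge> 0 \<Longrightarrow> conv (\<lambda>s. \<bar>K i j s\<bar>) (weight \<nu>) t \<le> M * weight \<nu> t"
    and K_tail: "t \<ge> 0 \<Longrightarrow> \<bar>(LBINT s:{0..t}. K i j s) - (LBINT s:{0..}. K i j s)\<bar> \<le> M * weight \<nu> t"
    and K_laplace: "s > 0 \<Longrightarrow> s powr (\<alpha> $ i) * (LBINT t:{0..}. exp (- s * t) * K i j t)
       - (\<Sum>l\<in>UNIV. A $ i $ l * (LBINT t:{0..}. exp (- s * t) * K l j t)) = (if i = j then 1 else 0)"

lemma resolvent_kernels:
  fixes \<alpha> :: "real^2" and A :: "real^2^2"
  assumes \<alpha>: "\<alpha> $ 1 \<in> {0<..1}" "\<alpha> $ 2 \<in> {0<..1}"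
    and zeros: "\<forall>s. char_fun \<alpha> A s = 0 \<longrightarrow> Re s < 0"
  obtains K M where "resolvent \<alpha> A K M (min (\<alpha> $ 1) (\<alpha> $ 2))"
proof -
  define \<nu> where "\<nu> = min (\<alpha> $ 1) (\<alpha> $ 2)"
  have \<nu>: "0 < \<nu>" "\<nu> \<le> 1" "\<nu> \<le> \<alpha> $ 1" "\<nu> \<le> \<alpha> $ 2" using \<alpha> by (auto simp: \<nu>_def)
  have nz: "char_sq (\<alpha> $ 1) (\<alpha> $ 2) A w \<noteq> 0" if w: "w \<in> sector 1" for w
  proof
    assume "char_sq (\<alpha> $ 1) (\<alpha> $ 2) A w = 0"
    moreover have "Re w > 0 \<or> w = 0" using sector_Re_pos[OF w] by auto
    ultimately have "char_fun \<alpha> A (w\<^sup>2) = 0" using char_fun_power2[of w \<alpha> A] \<alpha> by simp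
    then have "Re (w\<^sup>2) < 0" using zeros by blast
    moreover have "(Im w)\<^sup>2 \<le> (Re w)\<^sup>2"
      using w by (intro power2_le_iff_abs_le[THEN iffD2]) (auto simp: sector_def)
    ultimately show False by (simp add: power2_eq_square)
  qed
  define q where "q = (\<lambda>s. (s powr (\<alpha> $ 1) - A$1$1) * (s powr (\<alpha> $ 2) - A$2$2) - A$1$2 * A$2$1)"
  have qnz: "q s \<noteq> 0" if "s > 0" for s
  proof
    assume "q s = 0"
    have "char_fun \<alpha> A (of_real s) = of_real (q s)"
    proof -
      have "(of_real s :: complex) powr of_real z = of_real (s powr z)" for z
        using that by (intro powr_of_real) auto
      then show ?thesis
        unfolding char_fun_def by (simp only:) (simp add: q_def det_2 powr_add algebra_simps)
    qed
    then have "Re (of_real s) < 0" using zeros \<open>q s = 0\<close> by (metis of_real_0)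
    then show False using that by simp
  qed
  define P where "P = (\<lambda>x y b' K. \<exists>M. M \<ge> 0 \<and> set_integrable lborel {0..} K \<and>
     (\<forall>t\<ge>0. conv (\<lambda>s. \<bar>K s\<bar>) (weight \<nu>) t \<le> M * weight \<nu> t) \<and>
     (\<forall>t\<ge>0. \<bar>(LBINT s:{0..t}. K s) - (LBINT s:{0..}. K s)\<bar> \<le> M * weight \<nu> t) \<and>
     (\<forall>s>0. (LBINT t:{0..}. exp (- s * t) * K t) = (x + y * s powr b') / q s))"
  have ex: "\<exists>K. P x y b' K" if b': "b' = \<alpha> $ 1 \<or> b' = \<alpha> $ 2" for x y b'
  proof (rule resolvent_kernel[OF \<nu>(1,3,4,2) nz b', of x y])
    fix K B
    assume K: "K \<in> borel_measurable borel"
      "\<And>t. t > 0 \<Longrightarrow> \<bar>K t\<bar> \<le> B * t powr (\<nu> / 2 - 1)"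
      "\<And>t. t > 0 \<Longrightarrow> \<bar>K t\<bar> \<le> B * t powr (- 1 - \<nu>)"
      "\<And>s. s > 0 \<Longrightarrow> (LBINT t:{0..}. exp (- s * t) * K t) =
        (x + y * s powr b') / ((s powr (\<alpha> $ 1) - A$1$1) * (s powr (\<alpha> $ 2) - A$2$2) - A$1$2 * A$2$1)"
    show ?thesis
    proof (rule kernel_bounds[OF \<nu>(1,2) K(1-3)])
      fix M assume M: "M \<ge> 0" "set_integrable lborel {0..} K"
        "\<And>t. t \<ge> 0 \<Longrightarrow> conv (\<lambda>s. \<bar>K s\<bar>) (weight \<nu>) t \<le> M * weight \<nu> t"
        "\<And>t. t \<ge> 0 \<Longrightarrow> \<bar>(LBINT s:{0..t}. K s) - (LBINT s:{0..}. K s)\<bar> \<le> M * weight \<nu> t"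
      have "(LBINT t:{0..}. exp (- s * t) * K t) = (x + y * s powr b') / q s" if "s > 0" for s
        unfolding q_def by (rule K(4)[OF that])
      then show ?thesis unfolding P_def using M by (intro exI[of _ K] exI[of _ M]) simp
    qed
  qed
  \<comment> \<open>These numerators are the entries of the adjugate of
    \<open>diag (s^\<alpha>) - A\<close>; the off-diagonal ones are constant, hence
    \<open>y = 0\<close>.\<close>
  obtain K11 K12 K21 K22 where P: "P (- A$2$2) 1 (\<alpha> $ 2) K11" "P (A$1$2) 0 (\<alpha> $ 2) K12"
      "P (A$2$1) 0 (\<alpha> $ 2) K21" "P (- A$1$1) 1 (\<alpha> $ 1) K22"
    using ex by metis
  define K where "K = (\<lambda>(i :: 2) (j :: 2). if i = 1 then (if j = 1 then K11 else K12) else (if j = 1 then K21 else K22))"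
  have Keq: "K 1 1 = K11" "K 1 2 = K12" "K 2 1 = K21" "K 2 2 = K22" by (simp_all add: K_def)
  have "\<exists>x y b'. P x y b' (K i j)" for i j
    using P exhaust_2[of i] exhaust_2[of j] Keq by metis
  then have "\<exists>M. M \<ge> 0 \<and> set_integrable lborel {0..} (K i j) \<and>
     (\<forall>t\<ge>0. conv (\<lambda>s. \<bar>K i j s\<bar>) (weight \<nu>) t \<le> M * weight \<nu> t) \<and>
     (\<forall>t\<ge>0. \<bar>(LBINT s:{0..t}. K i j s) - (LBINT s:{0..}. K i j s)\<bar> \<le> M * weight \<nu> t)" for i j
    unfolding P_def by metis
  then obtain m where m: "\<And>i j. m i j \<ge> 0" "\<And>i j. set_integrable lborel {0..} (K i j)"
     "\<And>i j t. t\<ge>0 \<Longrightarrow> conv (\<lambda>s. \<bar>K i j s\<bar>) (weight \<nu>) t \<le> m i j * weight \<nu> t"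
     "\<And>i j t. t\<ge>0 \<Longrightarrow> \<bar>(LBINT s:{0..t}. K i j s) - (LBINT s:{0..}. K i j s)\<bar> \<le> m i j * weight \<nu> t"
    by metis
  define M where "M = (\<Sum>i\<in>UNIV. \<Sum>j\<in>UNIV. m i j)"
  have M: "m i j \<le> M" for i j
  proof -
    have "m i j \<le> (\<Sum>j\<in>UNIV. m i j)" using m(1) by (intro member_le_sum) auto
    also have "\<dots> \<le> M" unfolding M_def using m(1) by (intro member_le_sum[of i UNIV "\<lambda>i. \<Sum>j\<in>UNIV. m i j"] sum_nonneg) auto
    finally show ?thesis .
  qed
  have M': "m i j * weight \<nu> t \<le> M * weight \<nu> t" for i j t
    using M weight_pos[of \<nu> t] by (intro mult_right_mono) auto
  have "resolvent \<alpha> A K M \<nu>"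
  proof
    show "\<alpha> $ i > 0" for i using \<alpha> exhaust_2[of i] by auto
    show "\<nu> > 0" by (rule \<nu>)
    show "M \<ge> 0" using order_trans[OF m(1) M] .
    show "set_integrable lborel {0..} (K i j)" for i j by (rule m(2))
    show "conv (\<lambda>s. \<bar>K i j s\<bar>) (weight \<nu>) t \<le> M * weight \<nu> t" if "t \<ge> 0" for i j t
      using m(3)[OF that] M' by (rule order_trans)
    show "\<bar>(LBINT s:{0..t}. K i j s) - (LBINT s:{0..}. K i j s)\<bar> \<le> M * weight \<nu> t" if "t \<ge> 0" for i j t
      using m(4)[OF that] M' by (rule order_trans)
    fix i j :: 2 and s :: real assume s: "s > 0"
    define l where "l = (\<lambda>i j. LBINT t:{0..}. exp (- s * t) * K i j t)"
    have L: "l 1 1 = (s powr (\<alpha> $ 2) - A$2$2) / q s" "l 1 2 = A$1$2 / q s"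
      "l 2 1 = A$2$1 / q s" "l 2 2 = (s powr (\<alpha> $ 1) - A$1$1) / q s"
      using P s unfolding P_def Keq l_def by auto
    have "i = 1 \<or> i = 2" "j = 1 \<or> j = 2" using exhaust_2 by auto
    moreover have "s powr (\<alpha> $ 1) * l 1 1 - (A$1$1 * l 1 1 + A$1$2 * l 2 1) = q s / q s"
      "s powr (\<alpha> $ 2) * l 2 2 - (A$2$1 * l 1 2 + A$2$2 * l 2 2) = q s / q s"
      unfolding L times_divide_eq_right add_divide_distrib[symmetric] diff_divide_distrib[symmetric]
      by (rule arg_cong[of _ _ "\<lambda>x. x / q s"], simp add: q_def algebra_simps)+
    moreover have "s powr (\<alpha> $ 1) * l 1 2 - (A$1$1 * l 1 2 + A$1$2 * l 2 2) = 0 / q s"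
      "s powr (\<alpha> $ 2) * l 2 1 - (A$2$1 * l 1 1 + A$2$2 * l 2 1) = 0 / q s"
      unfolding L times_divide_eq_right add_divide_distrib[symmetric] diff_divide_distrib[symmetric]
      by (rule arg_cong[of _ _ "\<lambda>x. x / q s"], simp add: algebra_simps)+
    ultimately have "s powr (\<alpha> $ i) * l i j - (\<Sum>k\<in>UNIV. A $ i $ k * l k j) = (if i = j then 1 else 0)"
      using qnz[OF s] by (auto simp: sum_2)
    then show "s powr (\<alpha> $ i) * (LBINT t:{0..}. exp (- s * t) * K i j t)
       - (\<Sum>l\<in>UNIV. A $ i $ l * (LBINT t:{0..}. exp (- s * t) * K l j t)) = (if i = j then 1 else 0)"
      unfolding l_def .
  qed
  then show ?thesis using that unfolding \<nu>_def by blast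
qed

section \<open>The mild equation\<close>

lemma continuous_on_atLeast_of_Icc:
  fixes g :: "real \<Rightarrow> 'a::topological_space"
  assumes "\<And>b. continuous_on {0..b} g"
  shows "continuous_on {0..} g"
  unfolding continuous_on_eq_continuous_within
proof
  fix t :: real assume t: "t \<in> {0..}"
  have "continuous (at t within {0..t + 1}) g"
    using assms[of "t + 1"] t by (simp add: continuous_on_eq_continuous_within)
  moreover have "at t within {0..t + 1} = at t within {0..}"
    using t by (intro at_within_nhd[of t "{..<t + 1}"]) auto
  ultimately show "continuous (at t within {0..}) g" by simp
qed

context resolvent
begin

definition kconv :: "(real \<Rightarrow> real^2) \<Rightarrow> real \<Rightarrow> real^2" where
  "kconv u t = (\<chi> i. \<Sum>j\<in>UNIV. conv (K i j) (\<lambda>s. u s $ j) t)"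

lemma K_int_Icc: "set_integrable lborel {0..t} (K i j)"
  by (rule set_integrable_subset[OF K_int]) auto

lemma continuous_on_kconv:
  assumes "continuous_on {0..} u" shows "continuous_on {0..} (kconv u)"
proof (rule continuous_on_atLeast_of_Icc)
  fix b
  have "continuous_on {0..b} u" using assms by (rule continuous_on_subset) auto
  then show "continuous_on {0..b} (kconv u)"
    unfolding kconv_def
    by (intro continuous_on_vec_lambda continuous_on_sum continuous_on_conv K_int_Icc continuous_on_component)
qed

lemma norm_vec2_le: "norm (x :: real^2) \<le> \<bar>x $ 1\<bar> + \<bar>x $ 2\<bar>"
  using norm_le_l1_cart[of x] by (simp add: sum_2)

text \<open>The factor \<open>4\<close> arises from two columns in each component and two components
  in the bound of the Euclidean norm by the sum of moduli.\<close>

lemma kconv_norm_le: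
  assumes u: "continuous_on {0..} u" and le: "\<And>s. 0 \<le> s \<Longrightarrow> norm (u s) \<le> c * weight \<nu> s" and t: "0 \<le> t"
  shows "norm (kconv u t) \<le> 4 * M * c * weight \<nu> t"
proof -
  have c: "c \<ge> 0"
    using le[of 0] weight_pos[of \<nu> 0] by (auto dest: order_trans[OF norm_ge_zero] simp: zero_le_mult_iff)
  have b: "\<bar>conv (K i j) (\<lambda>s. u s $ j) t\<bar> \<le> M * c * weight \<nu> t" for i j
  proof -
    have "\<bar>conv (K i j) (\<lambda>s. u s $ j) t\<bar> \<le> conv (\<lambda>s. \<bar>K i j s\<bar>) (\<lambda>s. c * weight \<nu> s) t"
    proof (rule conv_bound)
      show "continuous_on {0..t} (\<lambda>s. u s $ j)"
        by (intro continuous_on_component continuous_on_subset[OF u]) auto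
      show "\<bar>u s $ j\<bar> \<le> c * weight \<nu> s" if "0 \<le> s" for s
        using le[OF that] component_le_norm_cart[of "u s" j] by simp
    qed (auto intro!: K_int_Icc set_integrable_abs continuous_intros continuous_on_weight)
    also have "\<dots> \<le> c * (M * weight \<nu> t)"
      unfolding conv_cmult by (intro mult_left_mono K_weight t c)
    finally show ?thesis by (simp add: mult_ac)
  qed
  have "\<bar>kconv u t $ i\<bar> \<le> 2 * (M * c * weight \<nu> t)" for i
    using b[of i 1] b[of i 2] by (simp add: kconv_def sum_2)
  from this[of 1] this[of 2] norm_vec2_le[of "kconv u t"] show ?thesis by simp
qed

lemma kconv_add:
  assumes "continuous_on {0..} u" "continuous_on {0..} v"
  shows "kconv (\<lambda>s. u s + v s) t = kconv u t + kconv v t"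
proof -
  have "continuous_on {0..t} u" "continuous_on {0..t} v"
    using assms by (auto intro: continuous_on_subset)
  then show ?thesis
    by (simp add: kconv_def vec_eq_iff conv_add K_int_Icc continuous_on_component sum.distrib)
qed

lemma kconv_diff:
  assumes "continuous_on {0..} u" "continuous_on {0..} v"
  shows "kconv (\<lambda>s. u s - v s) t = kconv u t - kconv v t"
proof -
  have "continuous_on {0..t} u" "continuous_on {0..t} v"
    using assms by (auto intro: continuous_on_subset)
  then show ?thesis
    by (simp add: kconv_def vec_eq_iff conv_diff K_int_Icc continuous_on_component sum_subtractf)
qed

text \<open>As \<open>s\<close> tends to \<open>0\<close> in \<open>K_laplace\<close>, the term with
  \<open>s powr (\<alpha> $ i)\<close> vanishes, so \<open>A\<close> times the integral of
  \<open>K\<close> is \<open>- I\<close>. The opposite order of the factors is the one that meets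
  \<open>A *v x\<^sub>0\<close>, and for square matrices a right inverse is also a left
  inverse.\<close>

lemma K_total: "(\<chi> i j. LBINT s:{0..}. K i j s) ** A = - mat 1"
proof -
  define k where "k = (\<chi> i j. LBINT s:{0..}. K i j s)"
  have "- (\<Sum>l\<in>UNIV. A $ i $ l * k $ l $ j) = (if i = j then 1 else 0)" for i j
  proof -
    define s where "s = (\<lambda>n. 1 / real (Suc n))"
    have s: "s \<longlonglongrightarrow> 0" unfolding s_def using LIMSEQ_inverse_real_of_nat by (simp add: inverse_eq_divide)
    have L: "(\<lambda>n. LBINT t:{0..}. exp (- s n * t) * K i j t) \<longlonglongrightarrow> k $ i $ j" for i j
      using laplace_tendsto_integral[OF K_int] by (simp add: s_def k_def)
    have sa: "(\<lambda>n. s n powr (\<alpha> $ i)) \<longlonglongrightarrow> 0 powr (\<alpha> $ i)"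
      by (rule tendsto_powr'[OF s tendsto_const]) (use \<alpha>_pos in \<open>auto simp: s_def intro!: always_eventually\<close>)
    have "(\<lambda>n. s n powr (\<alpha> $ i) * (LBINT t:{0..}. exp (- s n * t) * K i j t)
       - (\<Sum>l\<in>UNIV. A $ i $ l * (LBINT t:{0..}. exp (- s n * t) * K l j t)))
       \<longlonglongrightarrow> 0 powr (\<alpha> $ i) * k $ i $ j - (\<Sum>l\<in>UNIV. A $ i $ l * k $ l $ j)"
      by (intro tendsto_diff tendsto_mult tendsto_sum tendsto_const L sa)
    moreover have "s n powr (\<alpha> $ i) * (LBINT t:{0..}. exp (- s n * t) * K i j t)
       - (\<Sum>l\<in>UNIV. A $ i $ l * (LBINT t:{0..}. exp (- s n * t) * K l j t)) = (if i = j then 1 else 0)" for n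
      by (rule K_laplace) (simp add: s_def)
    ultimately have "(\<lambda>n::nat. if i = j then 1 else 0) \<longlonglongrightarrow> 0 powr (\<alpha> $ i) * k $ i $ j - (\<Sum>l\<in>UNIV. A $ i $ l * k $ l $ j)"
      by simp
    from LIMSEQ_unique[OF this tendsto_const] show ?thesis by simp
  qed
  then have "A ** (- k) = mat 1"
    by (simp add: vec_eq_iff matrix_matrix_mult_def mat_def sum_negf)
  then have "(- k) ** A = mat 1" by (simp add: matrix_left_right_inverse)
  then have "- (k ** A) = mat 1" by (simp add: vec_eq_iff matrix_matrix_mult_def sum_negf)
  then show ?thesis unfolding k_def by (metis add.inverse_inverse)
qed

text \<open>\<open>K_total\<close> expresses \<open>x\<^sub>0\<close> as minus the full integral of
  \<open>K\<close> applied to \<open>A *v x\<^sub>0\<close>. It cancels the part of the convolution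
  that does not decay and leaves a tail, to which \<open>K_tail\<close> applies.\<close>

lemma kconv_const_norm_le:
  assumes t: "0 \<le> t"
  shows "norm (x\<^sub>0 + kconv (\<lambda>_. A *v x\<^sub>0) t) \<le> 4 * M * norm (A *v x\<^sub>0) * weight \<nu> t"
proof -
  define y where "y = A *v x\<^sub>0"
  define D where "D = (\<lambda>i j. (LBINT s:{0..t}. K i j s) - (LBINT s:{0..}. K i j s))"
  have "conv (K i j) (\<lambda>_. c) t = c * (LBINT s:{0..t}. K i j s)" for i j c
    by (subst conv_commute) (simp add: conv_def)
  moreover have "x\<^sub>0 $ i = - (\<Sum>j\<in>UNIV. y $ j * (LBINT s:{0..}. K i j s))" for i
  proof -
    have "- x\<^sub>0 = ((\<chi> i j. LBINT s:{0..}. K i j s) ** A) *v x\<^sub>0"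
      unfolding K_total by (simp add: matrix_vector_mult_def vec_eq_iff mat_def if_distrib[of "\<lambda>x. - x"] if_distrib[of "\<lambda>x. x * _"] cong: if_cong)
    also have "\<dots> = (\<chi> i j. LBINT s:{0..}. K i j s) *v y"
      by (simp add: y_def matrix_vector_mul_assoc)
    finally have "(- x\<^sub>0) $ i = ((\<chi> i j. LBINT s:{0..}. K i j s) *v y) $ i" by simp
    then show ?thesis by (simp add: matrix_vector_mult_def mult.commute)
  qed
  ultimately have eq: "(x\<^sub>0 + kconv (\<lambda>_. y) t) $ i = (\<Sum>j\<in>UNIV. y $ j * D i j)" for i
    by (simp add: kconv_def D_def right_diff_distrib sum_subtractf)
  have b: "\<bar>y $ j * D i j\<bar> \<le> norm y * (M * weight \<nu> t)" for i j
    unfolding abs_mult D_def by (intro mult_mono K_tail t component_le_norm_cart) auto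
  have "\<bar>(x\<^sub>0 + kconv (\<lambda>_. y) t) $ i\<bar> \<le> 2 * (norm y * (M * weight \<nu> t))" for i
    unfolding eq using b[of 1 i] b[of 2 i] by (simp add: sum_2)
  from this[of 1] this[of 2] norm_vec2_le[of "x\<^sub>0 + kconv (\<lambda>_. y) t"]
  show ?thesis by (simp add: y_def mult_ac)
qed

text \<open>The unknown \<open>u\<close> is the solution divided by the weight, so the weighted norm
  is the sup norm and completeness comes with the space of bounded continuous functions. With the
  \<open>4 M\<close> of the kernel estimates, \<open>8 * M * \<eta> \<le> 1\<close> makes the
  nonlinear part a contraction with constant \<open>1/2\<close>. It thus uses half of the radius
  \<open>\<rho>\<close>, and the bound on \<open>A *v x\<^sub>0\<close> fits the linear part into
  the other half.\<close>

lemma mild_solution: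
  fixes f :: "real^2 \<Rightarrow> real^2"
  assumes f0: "f 0 = 0" and \<rho>: "\<rho> > 0" and \<eta>: "\<eta> \<ge> 0" "8 * M * \<eta> \<le> 1"
    and lip: "\<And>x y. norm x \<le> \<rho> \<Longrightarrow> norm y \<le> \<rho> \<Longrightarrow> norm (f x - f y) \<le> \<eta> * norm (x - y)"
    and x0: "8 * M * norm (A *v x\<^sub>0) \<le> \<rho>"
  obtains x where "continuous_on {0..} x" "\<And>t. 0 \<le> t \<Longrightarrow> norm (x t) \<le> \<rho> * weight \<nu> t"
    "\<And>t. 0 \<le> t \<Longrightarrow> x t = x\<^sub>0 + kconv (\<lambda>s. A *v x\<^sub>0 + f (x s)) t"
proof -
  define X where "X = (\<lambda>(u :: real \<Rightarrow>\<^sub>C (real^2)) s. weight \<nu> s *\<^sub>R u s)"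
  define \<Phi> where "\<Phi> = (\<lambda>u t. x\<^sub>0 + kconv (\<lambda>s. A *v x\<^sub>0 + f (X u s)) t)"
  define S where "S = (cball 0 \<rho> :: (real \<Rightarrow>\<^sub>C (real^2)) set)"
  \<comment> \<open>The function space lives on the whole line and the equation on the half-line, so
    \<open>\<Phi> u\<close> is extended evenly. The argument of \<open>Bcontfun\<close> is shown to
    be bounded and continuous for \<open>u\<close> in \<open>S\<close>.\<close>
  define T where "T = (\<lambda>u. Bcontfun (\<lambda>t. (1 / weight \<nu> t) *\<^sub>R \<Phi> u \<bar>t\<bar>))"
  have weight_nz: "weight \<nu> t \<noteq> 0" for t using weight_pos[of \<nu> t] by simp
  have weight_abs: "weight \<nu> \<bar>t\<bar> = weight \<nu> t" for t by (simp add: weight_def)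
  have uS: "norm (u s) \<le> \<rho>" if "u \<in> S" for u s
    using that norm_bounded[of u s] by (simp add: S_def)
  have XS: "norm (X u s) \<le> \<rho> * weight \<nu> s" if "u \<in> S" for u s
    using mult_right_mono[OF uS[OF that, of s], of "weight \<nu> s"] weight_pos[of \<nu> s] by (simp add: X_def mult.commute)
  have XS': "norm (X u s) \<le> \<rho>" if "u \<in> S" for u s
    using order_trans[OF XS[OF that] mult_left_le[OF weight_le_1]] \<rho> \<nu>_pos by simp
  have "\<eta>-lipschitz_on {x. norm x \<le> \<rho>} f"
    using \<eta> lip by (intro lipschitz_onI) (auto simp: dist_norm)
  then have fc: "continuous_on {x. norm x \<le> \<rho>} f" by (rule lipschitz_on_continuous_on)
  have fX: "continuous_on R (\<lambda>s. f (X u s))" if "u \<in> S" for u R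
    by (rule continuous_on_compose2[OF fc]) (use XS'[OF that] in \<open>auto simp: X_def intro!: continuous_intros continuous_on_weight\<close>)
  have fXb: "norm (f (X u s) - f (X v s)) \<le> \<eta> * dist u v * weight \<nu> s" if "u \<in> S" "v \<in> S" for u v s
  proof -
    have "norm (X u s - X v s) = weight \<nu> s * dist (u s) (v s)"
      using weight_pos[of \<nu> s] by (simp add: X_def dist_norm flip: scaleR_diff_right)
    also have "\<dots> \<le> weight \<nu> s * dist u v"
      using weight_pos[of \<nu> s] by (intro mult_left_mono dist_bounded) auto
    finally have "\<eta> * norm (X u s - X v s) \<le> \<eta> * (weight \<nu> s * dist u v)"
      using \<eta> by (intro mult_left_mono) auto
    moreover have "norm (f (X u s) - f (X v s)) \<le> \<eta> * norm (X u s - X v s)"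
      using that by (intro lip XS')
    ultimately show ?thesis by (simp add: mult_ac)
  qed
  have \<Phi>c: "continuous_on {0..} (\<Phi> u)" if "u \<in> S" for u
    unfolding \<Phi>_def by (intro continuous_intros continuous_on_kconv fX that)
  have \<Phi>eq: "\<Phi> u t = (x\<^sub>0 + kconv (\<lambda>_. A *v x\<^sub>0) t) + kconv (\<lambda>s. f (X u s)) t" if "u \<in> S" for u t
    unfolding \<Phi>_def by (subst kconv_add) (auto intro: fX that)
  have zS: "0 \<in> S" using \<rho> by (simp add: S_def)
  have X0: "X 0 s = 0" for s by (simp add: X_def)
  have \<Phi>b: "norm (\<Phi> u t) \<le> \<rho> * weight \<nu> t" if u: "u \<in> S" and t: "0 \<le> t" for u t
  proof -
    have "norm (f (X u s)) \<le> (\<eta> * \<rho>) * weight \<nu> s" for s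
    proof -
      have "norm (f (X u s)) \<le> \<eta> * dist u 0 * weight \<nu> s" using fXb[OF u zS, of s] by (simp add: X0 f0)
      also have "\<dots> \<le> (\<eta> * \<rho>) * weight \<nu> s"
        using u \<eta> weight_pos[of \<nu> s] by (intro mult_right_mono mult_left_mono) (auto simp: S_def dist_commute)
      finally show ?thesis .
    qed
    then have "norm (kconv (\<lambda>s. f (X u s)) t) \<le> 4 * M * (\<eta> * \<rho>) * weight \<nu> t"
      by (intro kconv_norm_le fX u t)
    also have "\<dots> = (4 * M * \<eta>) * (\<rho> * weight \<nu> t)" by simp
    also have "\<dots> \<le> (1 / 2) * (\<rho> * weight \<nu> t)"
      using \<eta> \<rho> weight_pos[of \<nu> t] by (intro mult_right_mono) auto
    finally have 1: "norm (kconv (\<lambda>s. f (X u s)) t) \<le> (1 / 2) * (\<rho> * weight \<nu> t)" .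
    have "4 * M * norm (A *v x\<^sub>0) * weight \<nu> t \<le> (\<rho> / 2) * weight \<nu> t"
      using x0 weight_pos[of \<nu> t] by (intro mult_right_mono) auto
    then have 2: "norm (x\<^sub>0 + kconv (\<lambda>_. A *v x\<^sub>0) t) \<le> (1 / 2) * (\<rho> * weight \<nu> t)"
      using kconv_const_norm_le[OF t, of x\<^sub>0] by simp
    show ?thesis unfolding \<Phi>eq[OF u] using norm_triangle_le[OF add_mono[OF 2 1]] by simp
  qed
  have TB: "(\<lambda>t. (1 / weight \<nu> t) *\<^sub>R \<Phi> u \<bar>t\<bar>) \<in> bcontfun" if u: "u \<in> S" for u
  proof (rule bcontfun_normI)
    have "continuous_on UNIV (\<lambda>t. \<Phi> u \<bar>t\<bar>)"
      by (rule continuous_on_compose2[OF \<Phi>c[OF u]]) (auto intro!: continuous_intros)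
    then show "continuous_on UNIV (\<lambda>t. (1 / weight \<nu> t) *\<^sub>R \<Phi> u \<bar>t\<bar>)"
      using weight_nz by (intro continuous_intros continuous_on_weight) auto
    show "norm ((1 / weight \<nu> t) *\<^sub>R \<Phi> u \<bar>t\<bar>) \<le> \<rho>" for t
      using \<Phi>b[OF u, of "\<bar>t\<bar>"] weight_pos[of \<nu> t] by (simp add: weight_abs field_simps)
  qed
  have Tapp: "T u t = (1 / weight \<nu> t) *\<^sub>R \<Phi> u \<bar>t\<bar>" if "u \<in> S" for u t
    unfolding T_def using Bcontfun_inverse[OF TB[OF that]] by simp
  have "\<exists>!u\<in>S. T u = u"
  proof (rule Banach_fix[where c="1/2"])
    show "complete S" unfolding S_def by (simp add: complete_eq_closed)
    show "S \<noteq> {}" using zS by auto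
    show "T ` S \<subseteq> S"
    proof
      fix v assume "v \<in> T ` S"
      then obtain u where u: "u \<in> S" "v = T u" by auto
      have "norm (v t) \<le> \<rho>" for t
        unfolding u(2) Tapp[OF u(1)]
        using \<Phi>b[OF u(1), of "\<bar>t\<bar>"] weight_pos[of \<nu> t] by (simp add: weight_abs field_simps)
      then show "v \<in> S" by (simp add: S_def norm_bound)
    qed
    show "dist (T u) (T v) \<le> 1 / 2 * dist u v" if u: "u \<in> S" and v: "v \<in> S" for u v
    proof (rule dist_bound)
      fix t
      have "\<Phi> u \<bar>t\<bar> - \<Phi> v \<bar>t\<bar> = kconv (\<lambda>s. f (X u s) - f (X v s)) \<bar>t\<bar>"
        unfolding \<Phi>eq[OF u] \<Phi>eq[OF v] by (subst kconv_diff) (auto intro: fX u v)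
      also have "norm \<dots> \<le> 4 * M * (\<eta> * dist u v) * weight \<nu> \<bar>t\<bar>"
        by (intro kconv_norm_le continuous_intros fX u v fXb) auto
      also have "\<dots> = (4 * M * \<eta>) * (dist u v * weight \<nu> t)" by (simp add: weight_abs)
      also have "\<dots> \<le> (1 / 2) * (dist u v * weight \<nu> t)"
        using \<eta> weight_pos[of \<nu> t] by (intro mult_right_mono) auto
      finally have le: "norm (\<Phi> u \<bar>t\<bar> - \<Phi> v \<bar>t\<bar>) \<le> (1 / 2) * (dist u v * weight \<nu> t)" .
      have "dist (T u t) (T v t) = norm (\<Phi> u \<bar>t\<bar> - \<Phi> v \<bar>t\<bar>) / weight \<nu> t"
        unfolding Tapp[OF u] Tapp[OF v] dist_norm scaleR_diff_right[symmetric] using weight_pos[of \<nu> t] by simp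
      also have "\<dots> \<le> ((1 / 2) * (dist u v * weight \<nu> t)) / weight \<nu> t"
        using weight_pos[of \<nu> t] by (intro divide_right_mono le) auto
      finally show "dist (T u t) (T v t) \<le> 1 / 2 * dist u v" using weight_nz by simp
    qed
  qed auto
  then obtain u where u: "u \<in> S" "T u = u" by auto
  have fixpt: "X u t = \<Phi> u t" if "0 \<le> t" for t
    using Tapp[OF u(1), of t] u(2) that weight_pos[of \<nu> t] by (simp add: X_def)
  show ?thesis
  proof (rule that[of "X u"])
    show "continuous_on {0..} (X u)"
      unfolding X_def by (intro continuous_intros continuous_on_weight) auto
    show "norm (X u t) \<le> \<rho> * weight \<nu> t" for t by (rule XS[OF u(1)])
    show "X u t = x\<^sub>0 + kconv (\<lambda>s. A *v x\<^sub>0 + f (X u s)) t" if "0 \<le> t" for t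
      using fixpt[OF that] by (simp add: \<Phi>_def)
  qed
qed

text \<open>For \<open>z = kconv h\<close> the transform of \<open>z\<close> is that of the kernel
  matrix times that of \<open>h\<close>, so \<open>K_laplace\<close> says that
  \<open>p^\<alpha>\<close> times the transform of \<open>z\<close> equals the transform of
  \<open>A z + h\<close>. Division by \<open>p^\<alpha>\<close> corresponds to convolution with the
  Riemann--Liouville kernel. Boundedness of \<open>h\<close> and \<open>z\<close> makes the
  transforms converge, and a fractional integral of a bounded function is at most a multiple of
  \<open>exp t\<close>, the growth that \<open>laplace_zero_imp_zero\<close> admits.\<close>

lemma volterra_of_mild:
  assumes h: "continuous_on {0..} h" and hb: "\<And>t. 0 \<le> t \<Longrightarrow> norm (h t) \<le> B"
    and kb: "\<And>t. 0 \<le> t \<Longrightarrow> norm (kconv h t) \<le> B" and t: "0 \<le> t"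
  shows "kconv h t $ i = conv (rl_kernel (\<alpha> $ i)) (\<lambda>s. (A *v kconv h s + h s) $ i) t"
proof -
  define z where "z = (\<lambda>i s. kconv h s $ i)"
  define H where "H = (\<lambda>i s. h s $ i)"
  define y where "y = (\<lambda>s. (\<Sum>l\<in>UNIV. A $ i $ l * z l s) + H i s)"
  define u where "u = (\<lambda>s. z i s - conv (rl_kernel (\<alpha> $ i)) y s)"
  have zc: "continuous_on {0..} (z j)" and Hc: "continuous_on {0..} (H j)" for j
    unfolding z_def H_def by (intro continuous_on_component continuous_on_kconv h)+
  have yc: "continuous_on {0..} y" unfolding y_def by (intro continuous_intros zc Hc)
  have zb: "\<bar>z j s\<bar> \<le> B" and Hb: "\<bar>H j s\<bar> \<le> B" if "0 \<le> s" for j s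
    using component_le_norm_cart[of "kconv h s" j] kb[OF that] component_le_norm_cart[of "h s" j] hb[OF that]
    by (auto simp: z_def H_def)
  define Y where "Y = (\<Sum>l\<in>UNIV. \<bar>A $ i $ l\<bar> * B) + B"
  have yb: "\<bar>y s\<bar> \<le> Y" if "0 \<le> s" for s
  proof -
    have "\<bar>y s\<bar> \<le> \<bar>\<Sum>l\<in>UNIV. A $ i $ l * z l s\<bar> + \<bar>H i s\<bar>" unfolding y_def by (rule abs_triangle_ineq)
    also have "\<bar>\<Sum>l\<in>UNIV. A $ i $ l * z l s\<bar> \<le> (\<Sum>l\<in>UNIV. \<bar>A $ i $ l * z l s\<bar>)" by (rule sum_abs)
    also have "\<dots> \<le> (\<Sum>l\<in>UNIV. \<bar>A $ i $ l\<bar> * B)"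
      using zb[OF that] by (intro sum_mono) (simp add: abs_mult mult_left_mono)
    finally show ?thesis using Hb[OF that, of i] by (simp add: Y_def)
  qed
  have B0: "B \<ge> 0" using zb[of 0] by (auto intro: order_trans[OF abs_ge_zero])
  have Y0: "Y \<ge> 0" using yb[of 0] by (auto intro: order_trans[OF abs_ge_zero])
  have cvb: "\<bar>conv (rl_kernel (\<alpha> $ i)) y s\<bar> \<le> Y * exp s" if s: "0 \<le> s" for s
  proof -
    have "\<bar>conv (rl_kernel (\<alpha> $ i)) y s\<bar> \<le> conv (rl_kernel (\<alpha> $ i)) (\<lambda>s. Y * exp (1 * s)) s"
    proof (rule conv_bound)
      show "\<bar>y r\<bar> \<le> Y * exp (1 * r)" if "0 \<le> r" for r
        using yb[OF that] mult_left_mono[of 1 "exp r" Y] Y0 that by simp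
    qed (use \<alpha>_pos rl_kernel_nonneg in \<open>auto intro!: rl_kernel_integrable continuous_intros continuous_on_subset[OF yc]\<close>)
    also have "\<dots> \<le> Y * (exp (1 * s) * 1 powr (- (\<alpha> $ i)))"
      unfolding conv_cmult using \<alpha>_pos Y0 by (intro mult_left_mono conv_rl_kernel_exp_le) auto
    finally show ?thesis by simp
  qed
  have cvc: "continuous_on {0..} (conv (rl_kernel (\<alpha> $ i)) y)"
    using \<alpha>_pos by (intro continuous_on_atLeast_of_Icc continuous_on_conv rl_kernel_integrable continuous_on_subset[OF yc]) auto
  have "u t = 0"
  proof (rule laplace_zero_imp_zero[OF _ _ _ t])
    show "continuous_on {0..} u" unfolding u_def by (intro continuous_intros zc cvc)
    show "\<bar>u s\<bar> \<le> (B + Y) * exp s" if "0 \<le> s" for s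
    proof -
      have "B \<le> B * exp s" using mult_left_mono[of 1 "exp s" B] B0 that by simp
      then show ?thesis using zb[OF that, of i] cvb[OF that] by (simp add: u_def algebra_simps)
    qed
    fix p :: real assume p: "p > 1"
    define L where "L = (\<lambda>g. LBINT s:{0..}. exp (- p * s) * g s)"
    define I where "I = (\<lambda>g. set_integrable lborel {0..} (\<lambda>s::real. exp (- p * s) * (g s :: real)))"
    have Iz: "I (z j)" and IH: "I (H j)" for j
      unfolding I_def using p zb Hb by (intro set_integrable_exp_mult[of 0 p _ B] zc Hc; simp)+
    have IK: "I (K j l)" for j l
      unfolding I_def using p by (intro laplace_integrable_of_integrable K_int) auto
    have LIadd: "L (\<lambda>s. f s + g s) = L f + L g" "I (\<lambda>s. f s + g s)" if "I f" "I g" for f g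
      using that unfolding L_def I_def distrib_left by (auto intro: set_integral_add)
    have LImult: "L (\<lambda>s. c * f s) = c * L f" "I (\<lambda>s. c * f s)" if "I f" for c f
      using that unfolding L_def I_def by (auto simp: mult.left_commute)
    have LIcv: "L (conv k g) = L k * L g" "I (conv k g)" if "I k" "I g" for k g
      using that laplace_conv[of p k g] unfolding L_def I_def by auto
    have zeq: "z j = (\<lambda>s. conv (K j 1) (H 1) s + conv (K j 2) (H 2) s)" for j
      by (simp add: z_def kconv_def sum_2 H_def fun_eq_iff)
    have Lz: "L (z j) = L (K j 1) * L (H 1) + L (K j 2) * L (H 2)" for j
      unfolding zeq by (simp add: LIadd LIcv IK IH)
    have yeq: "y = (\<lambda>s. (A $ i $ 1 * z 1 s + A $ i $ 2 * z 2 s) + H i s)"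
      by (simp add: y_def sum_2)
    have Iy: "I y" unfolding yeq by (intro LIadd LImult Iz IH)
    have Ly: "L y = (A $ i $ 1 * L (z 1) + A $ i $ 2 * L (z 2)) + L (H i)"
      unfolding yeq by (simp add: LIadd LImult Iz IH)
    have Irk: "I (rl_kernel (\<alpha> $ i))" and Lrk: "L (rl_kernel (\<alpha> $ i)) = p powr (- (\<alpha> $ i))"
      unfolding I_def L_def using laplace_rl_kernel[of "\<alpha> $ i" p] \<alpha>_pos p by auto
    have R: "p powr (\<alpha> $ i) * L (K i j) - (A $ i $ 1 * L (K 1 j) + A $ i $ 2 * L (K 2 j)) = (if i = j then 1 else 0)" for j
      using K_laplace[of p i j] p by (simp add: L_def sum_2)
    have "p powr (\<alpha> $ i) * L (z i) - L y
       = (p powr (\<alpha> $ i) * L (K i 1) - (A $ i $ 1 * L (K 1 1) + A $ i $ 2 * L (K 2 1))) * L (H 1)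
       + (p powr (\<alpha> $ i) * L (K i 2) - (A $ i $ 1 * L (K 1 2) + A $ i $ 2 * L (K 2 2))) * L (H 2) - L (H i)"
      unfolding Ly Lz by (simp add: algebra_simps)
    also have "\<dots> = 0" unfolding R using exhaust_2[of i] by auto
    finally have "p powr (- (\<alpha> $ i)) * L y = p powr (- (\<alpha> $ i)) * p powr (\<alpha> $ i) * L (z i)" by simp
    also have "p powr (- (\<alpha> $ i)) * p powr (\<alpha> $ i) = 1" using p by (simp flip: powr_add)
    finally have "L (conv (rl_kernel (\<alpha> $ i)) y) = L (z i)" by (simp add: LIcv(1)[OF Irk Iy] Lrk)
    moreover have "L u = L (z i) + (- 1) * L (conv (rl_kernel (\<alpha> $ i)) y)"
      using LIadd(1)[OF Iz LImult(2)[OF LIcv(2)[OF Irk Iy]], of i "- 1"] LImult(1)[OF LIcv(2)[OF Irk Iy], of "- 1"]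
      by (simp add: u_def)
    ultimately show "(LBINT s:{0..}. exp (- p * s) * u s) = 0" by (simp add: L_def)
  qed
  then show ?thesis
    by (simp add: u_def z_def y_def H_def matrix_vector_mult_def)
qed

end

section \<open>Uniqueness and stability\<close>

lemma norm_le_infnorm_2: "norm (x :: real^2) \<le> 2 * infnorm x"
  using norm_le_l1_cart[of x] component_le_infnorm_cart[of x 1] component_le_infnorm_cart[of x 2]
  by (simp add: sum_2)

text \<open>Passage from the maximum norm to the Euclidean one. A Euclidean ball lies in the
  maximum-norm ball of the same radius, and the norms differ by a factor of at most
  \<open>2\<close>, which is why \<open>\<eta> / 2\<close> is demanded of
  \<open>lip_const\<close>.\<close>

lemma lip_const_tendsto_0:
  assumes lim: "(lip_const f \<longlongrightarrow> 0) (at_right 0)" and \<Omega>: "open \<Omega>" "0 \<in> \<Omega>" and \<eta>: "\<eta> > 0"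
  obtains r where "r > 0" "\<And>x. norm x \<le> r \<Longrightarrow> x \<in> \<Omega>"
    "\<And>x y. norm x \<le> r \<Longrightarrow> norm y \<le> r \<Longrightarrow> norm (f x - f y) \<le> \<eta> * norm (x - y)"
proof -
  obtain e where e: "e > 0" "ball 0 e \<subseteq> \<Omega>" using \<Omega> open_contains_ball by blast
  have "\<forall>\<^sub>F r in at_right 0. lip_const f r < ereal (\<eta> / 2)"
    using lim \<eta> by (intro order_tendstoD) auto
  moreover have "\<forall>\<^sub>F r in at_right 0. 0 < r \<and> r < e"
    using eventually_at_right_less[of "0::real"] eventually_at_right_field[of "\<lambda>r. r < e" 0] e(1)
    by (auto intro!: eventually_conj exI[of _ e])
  ultimately have "\<forall>\<^sub>F r in at_right 0. lip_const f r < ereal (\<eta> / 2) \<and> 0 < r \<and> r < e"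
    by eventually_elim auto
  then obtain r where r: "lip_const f r < ereal (\<eta> / 2)" "0 < r" "r < e"
    using eventually_happens[of _ "at_right (0::real)"] by auto
  show ?thesis
  proof (rule that[of r])
    show "x \<in> \<Omega>" if "norm x \<le> r" for x using e(2) that r(3) by (auto simp: subset_iff)
    show "norm (f x - f y) \<le> \<eta> * norm (x - y)" if x: "norm x \<le> r" and y: "norm y \<le> r" for x y
    proof (cases "x = y")
      case False
      have "(x, y) \<in> {(x, y). x \<in> max_ball r \<and> y \<in> max_ball r \<and> x \<noteq> y}"
        using False x y infnorm_le_norm[of x] infnorm_le_norm[of y] by (auto simp: max_ball_def)
      then have "(case (x, y) of (x, y) \<Rightarrow> ereal (infnorm (f x - f y) / infnorm (x - y))) \<le> lip_const f r"
        unfolding lip_const_def by (rule SUP_upper)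
      then have "ereal (infnorm (f x - f y) / infnorm (x - y)) < ereal (\<eta> / 2)"
        unfolding prod.case using r(1) by (rule le_less_trans)
      then have "infnorm (f x - f y) / infnorm (x - y) < \<eta> / 2" unfolding less_ereal.simps .
      moreover have "infnorm (x - y) > 0" using False by (simp add: infnorm_pos_lt)
      ultimately have "infnorm (f x - f y) \<le> \<eta> / 2 * infnorm (x - y)" by (simp add: field_simps)
      also have "\<dots> \<le> \<eta> / 2 * norm (x - y)"
        using \<eta> infnorm_le_norm by (intro mult_left_mono) auto
      finally show ?thesis using norm_le_infnorm_2[of "f x - f y"] by simp
    qed simp
  qed (rule r(2))
qed

text \<open>The difference of the Volterra forms bounds each component by a fractional integral of
  \<open>norm (x t - y t)\<close> of its own order. Adding the components gives the inequality with
  two orders that \<open>fractional_gronwall_zero\<close> takes.\<close>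

lemma caputo_local_unique:
  fixes x y :: "real \<Rightarrow> real^2"
  assumes \<alpha>: "\<And>i. \<alpha> $ i > 0" "\<And>i. \<alpha> $ i \<le> 1" and L: "L \<ge> 0"
    and lip: "\<And>u v. norm u \<le> r \<Longrightarrow> norm v \<le> r \<Longrightarrow> norm (F u - F v) \<le> L * norm (u - v)"
    and cont: "continuous_on {0..b} x" "continuous_on {0..b} y"
    and bd: "\<And>t. t \<in> {0..b} \<Longrightarrow> norm (x t) \<le> r" "\<And>t. t \<in> {0..b} \<Longrightarrow> norm (y t) \<le> r"
    and init: "x 0 = y 0"
    and Dx: "\<And>t i. 0 < t \<Longrightarrow> t < b \<Longrightarrow> has_caputo_derivative (\<alpha> $ i) (\<lambda>\<tau>. x \<tau> $ i) (F (x t) $ i) t"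
    and Dy: "\<And>t i. 0 < t \<Longrightarrow> t < b \<Longrightarrow> has_caputo_derivative (\<alpha> $ i) (\<lambda>\<tau>. y \<tau> $ i) (F (y t) $ i) t"
    and t: "t \<in> {0..b}"
  shows "x t = y t"
proof -
  have "L-lipschitz_on {u. norm u \<le> r} F"
    using L lip by (intro lipschitz_onI) (auto simp: dist_norm)
  then have F: "continuous_on {u. norm u \<le> r} F" by (rule lipschitz_on_continuous_on)
  have Fx: "continuous_on {0..b} (\<lambda>t. F (x t))" "continuous_on {0..b} (\<lambda>t. F (y t))"
    by (rule continuous_on_compose2[OF F cont(1)] continuous_on_compose2[OF F cont(2)]; use bd in auto)+
  define U where "U = (\<lambda>t. norm (x t - y t))"
  have U: "continuous_on {0..b} U" unfolding U_def by (intro continuous_intros cont)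
  have comp: "\<bar>x t $ i - y t $ i\<bar> \<le> L * conv (rl_kernel (\<alpha> $ i)) U t" if t: "t \<in> {0..b}" for t i
  proof -
    have sub: "continuous_on {0..t} (\<lambda>s. F (x s) $ i)" "continuous_on {0..t} (\<lambda>s. F (y s) $ i)" "continuous_on {0..t} U"
      using t by (auto intro!: continuous_on_component continuous_on_subset[OF Fx(1)] continuous_on_subset[OF Fx(2)] continuous_on_subset[OF U])
    have "x t $ i = x 0 $ i + conv (rl_kernel (\<alpha> $ i)) (\<lambda>s. F (x s) $ i) t"
      by (rule volterra_of_caputo[where b=b]) (use \<alpha> Fx cont Dx t in \<open>auto intro!: continuous_on_component\<close>)
    moreover have "y t $ i = y 0 $ i + conv (rl_kernel (\<alpha> $ i)) (\<lambda>s. F (y s) $ i) t"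
      by (rule volterra_of_caputo[where b=b]) (use \<alpha> Fx cont Dy t in \<open>auto intro!: continuous_on_component\<close>)
    ultimately have "x t $ i - y t $ i = conv (rl_kernel (\<alpha> $ i)) (\<lambda>s. F (x s) $ i - F (y s) $ i) t"
      using init \<alpha> sub by (simp add: conv_diff rl_kernel_integrable)
    also have "\<bar>\<dots>\<bar> \<le> conv (rl_kernel (\<alpha> $ i)) (\<lambda>s. L * U s) t"
    proof (rule conv_bound)
      show "\<bar>F (x s) $ i - F (y s) $ i\<bar> \<le> L * U s" if "0 \<le> s" "s \<le> t" for s
        using component_le_norm_cart[of "F (x s) - F (y s)" i] lip[of "x s" "y s"] bd[of s] that t
        by (simp add: U_def)
    qed (use \<alpha> rl_kernel_nonneg sub in \<open>auto intro!: rl_kernel_integrable continuous_intros\<close>)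
    finally show ?thesis by (simp add: conv_cmult)
  qed
  have "U t = 0"
  proof (rule fractional_gronwall_zero[OF \<alpha>(1)[of 1] \<alpha>(1)[of 2] L U _ _ t])
    show "0 \<le> U t" for t by (simp add: U_def)
    show "U t \<le> L * (conv (rl_kernel (\<alpha> $ 1)) U t + conv (rl_kernel (\<alpha> $ 2)) U t)" if "t \<in> {0..b}" for t
      using norm_le_l1_cart[of "x t - y t"] comp[OF that, of 1] comp[OF that, of 2]
      by (simp add: U_def sum_2 distrib_left)
  qed
  then show ?thesis by (simp add: U_def)
qed

text \<open>\<open>F\<close> is Lipschitz on the ball of radius \<open>r\<close> only, and a
  competing solution \<open>\<psi>\<close> might leave that ball inside \<open>\<Omega>\<close>. At
  the infimum \<open>s\<close> of the times of disagreement both solutions still coincide and have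
  norm at most \<open>\<rho> < r\<close>. By continuity \<open>\<psi>\<close> remains in the ball a
  little longer, and local uniqueness there contradicts the choice of \<open>s\<close>.\<close>

lemma caputo_unique:
  fixes \<phi> :: "real \<Rightarrow> real^2"
  assumes \<alpha>: "\<And>i. \<alpha> $ i > 0" "\<And>i. \<alpha> $ i \<le> 1" and L: "L \<ge> 0"
    and lip: "\<And>u v. norm u \<le> r \<Longrightarrow> norm v \<le> r \<Longrightarrow> norm (F u - F v) \<le> L * norm (u - v)"
    and \<phi>: "caputo_solution \<alpha> \<Omega> F x\<^sub>0 \<infinity> \<phi>"
    and bd: "\<And>t. 0 \<le> t \<Longrightarrow> norm (\<phi> t) \<le> \<rho>" and \<rho>: "\<rho> < r"
  shows "unique_global_solution \<alpha> \<Omega> F x\<^sub>0 \<phi>"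
  unfolding unique_global_solution_def
proof (intro conjI allI impI \<phi>, elim conjE, rule ccontr)
  fix T \<psi> t1
  assume \<psi>: "caputo_solution \<alpha> \<Omega> F x\<^sub>0 T \<psi>" and t1: "0 \<le> t1" "ereal t1 < T" and ne: "\<psi> t1 \<noteq> \<phi> t1"
  have tT: "ereal t < T" if "t \<le> t1" for t using that t1(2) by (meson ereal_less_eq(3) le_less_trans)
  have c\<psi>: "continuous_on {0..t1} \<psi>"
    using \<psi> tT unfolding caputo_solution_def by (auto intro: continuous_on_subset)
  have c\<phi>: "continuous_on {0..t1} \<phi>"
    using \<phi> unfolding caputo_solution_def by (auto intro: continuous_on_subset)
  have init: "\<psi> 0 = \<phi> 0" using \<phi> \<psi> by (simp add: caputo_solution_def)
  have D\<psi>: "has_caputo_derivative (\<alpha> $ i) (\<lambda>\<tau>. \<psi> \<tau> $ i) (F (\<psi> t) $ i) t" if "0 < t" "t \<le> t1" for t i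
    using \<psi> that tT by (simp add: caputo_solution_def)
  have D\<phi>: "has_caputo_derivative (\<alpha> $ i) (\<lambda>\<tau>. \<phi> \<tau> $ i) (F (\<phi> t) $ i) t" if "0 < t" for t i
    using \<phi> that by (simp add: caputo_solution_def)
  define D where "D = {t \<in> {0..t1}. \<psi> t \<noteq> \<phi> t}"
  define E where "E = {t \<in> {0..t1}. \<psi> t - \<phi> t = 0}"
  have D1: "t1 \<in> D" using t1 ne by (simp add: D_def)
  have Db: "bdd_below D" by (rule bdd_belowI[of _ 0]) (auto simp: D_def)
  define s where "s = Inf D"
  have s: "0 \<le> s" "s \<le> t1"
    using D1 Db unfolding s_def by (auto intro!: cInf_greatest cInf_lower simp: D_def)
  have before: "\<psi> t = \<phi> t" if "0 \<le> t" "t < s" for t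
    using that s cInf_lower[OF _ Db, of t] by (force simp: s_def D_def)
  have at_s: "\<psi> s = \<phi> s"
  proof (cases "s = 0")
    case False
    have "closed E" unfolding E_def
      by (intro continuous_closed_preimage_constant continuous_intros c\<psi> c\<phi>)
    moreover have "{0..<s} \<subseteq> E" using before s by (auto simp: E_def)
    ultimately have "closure {0..<s} \<subseteq> E" by (intro closure_minimal)
    then show ?thesis using False s by (auto simp: E_def)
  qed (use init in simp)
  have "s \<noteq> t1" using at_s ne by auto
  with s have st: "s < t1" by simp
  have "continuous (at s within {0..t1}) \<psi>"
    using c\<psi> s by (simp add: continuous_on_eq_continuous_within)
  then obtain d where d: "d > 0" "\<And>t. t \<in> {0..t1} \<Longrightarrow> dist t s < d \<Longrightarrow> dist (\<psi> t) (\<psi> s) < r - \<rho>"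
    using \<rho> unfolding continuous_within_eps_delta by (metis diff_gt_0_iff_gt)
  define b where "b = min (s + d / 2) t1"
  have b: "s < b" "b \<le> t1" using st d by (auto simp: b_def)
  have small: "norm (\<psi> t) \<le> r" if t: "t \<in> {0..b}" for t
  proof (cases "t < s")
    case True
    then show ?thesis using before[of t] bd[of t] t \<rho> by simp
  next
    case False
    then have "dist (\<psi> t) (\<psi> s) < r - \<rho>" using t b d(1) by (intro d(2)) (auto simp: b_def dist_real_def)
    moreover have "norm (\<psi> t) \<le> norm (\<psi> s) + dist (\<psi> t) (\<psi> s)"
      unfolding dist_norm by (metis norm_triangle_sub)
    ultimately show ?thesis using bd[OF s(1)] at_s by simp
  qed
  have eq: "\<psi> t = \<phi> t" if "t \<in> {0..b}" for t
  proof (rule caputo_local_unique[where x=\<psi> and y=\<phi> and F=F and \<alpha>=\<alpha> and L=L and r=r and b=b])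
    show "continuous_on {0..b} \<psi>" "continuous_on {0..b} \<phi>"
      using b by (auto intro: continuous_on_subset[OF c\<psi>] continuous_on_subset[OF c\<phi>])
    show "norm (\<phi> t) \<le> r" if "t \<in> {0..b}" for t using bd[of t] that \<rho> by simp
    show "has_caputo_derivative (\<alpha> $ i) (\<lambda>\<tau>. \<psi> \<tau> $ i) (F (\<psi> t) $ i) t" if "0 < t" "t < b" for t i
      using that b by (intro D\<psi>) auto
  qed (fact \<alpha> L init that | rule lip D\<phi> small, assumption+)+
  have "b \<le> Inf D"
  proof (rule cInf_greatest)
    show "b \<le> t" if "t \<in> D" for t using that eq[of t] by (force simp: D_def)
  qed (use D1 in auto)
  then show False using b by (simp add: s_def)
qed

lemma (in resolvent) stability:
  fixes f :: "real^2 \<Rightarrow> real^2"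
  assumes \<alpha>1: "\<And>i. \<alpha> $ i \<le> 1" and \<Omega>: "open \<Omega>" "0 \<in> \<Omega>" and f0: "f 0 = 0"
    and lim: "(lip_const f \<longlongrightarrow> 0) (at_right 0)"
  shows "\<exists>\<delta>>0. \<exists>\<rho>>0. \<forall>x\<^sub>0. infnorm x\<^sub>0 \<le> \<delta> \<longrightarrow>
    (\<exists>\<phi>. unique_global_solution \<alpha> \<Omega> (\<lambda>x. A *v x + f x) x\<^sub>0 \<phi> \<and> (\<forall>t\<ge>0. norm (\<phi> t) \<le> \<rho> * weight \<nu> t))"
proof -
  \<comment> \<open>The contraction condition of \<open>mild_solution\<close>; the added
    \<open>1\<close> covers \<open>M = 0\<close>.\<close>
  define \<eta> where "\<eta> = 1 / (8 * M + 1)"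
  have \<eta>: "\<eta> > 0" "8 * M * \<eta> \<le> 1" using M_nonneg by (auto simp: \<eta>_def)
  obtain r where r: "r > 0" "\<And>x. norm x \<le> r \<Longrightarrow> x \<in> \<Omega>"
    and lip: "\<And>x y. norm x \<le> r \<Longrightarrow> norm y \<le> r \<Longrightarrow> norm (f x - f y) \<le> \<eta> * norm (x - y)"
    using lip_const_tendsto_0[OF lim \<Omega> \<eta>(1)] by metis
  obtain N where N: "N > 0" "\<And>x. norm (A *v x) \<le> norm x * N"
    using bounded_linear.pos_bounded[OF matrix_vector_mul_bounded_linear[of A]] by auto
  \<comment> \<open>Half of the radius keeps the solution strictly inside the ball on which
    \<open>f\<close> is Lipschitz, the margin that \<open>caputo_unique\<close> relies on.\<close>
  define \<rho> where "\<rho> = r / 2"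
  have \<rho>: "\<rho> > 0" "\<rho> < r" using r by (auto simp: \<rho>_def)
  \<comment> \<open>The number \<open>16\<close> is the \<open>8\<close> of
    \<open>mild_solution\<close> times the factor \<open>2\<close> between the Euclidean and the
    maximum norm, and \<open>N\<close> bounds \<open>A\<close>.\<close>
  define \<delta> where "\<delta> = \<rho> / (16 * M * N + 1)"
  have den: "16 * M * N + 1 > 0" using M_nonneg N by (simp add: add_nonneg_pos)
  have \<delta>: "\<delta> > 0" using \<rho> den by (simp add: \<delta>_def)
  have lipF: "norm ((A *v u + f u) - (A *v v + f v)) \<le> (N + \<eta>) * norm (u - v)"
    if "norm u \<le> r" "norm v \<le> r" for u v
  proof -
    have eq: "(A *v u + f u) - (A *v v + f v) = A *v (u - v) + (f u - f v)"
      by (simp add: matrix_vector_mult_diff_distrib)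
    have "norm ((A *v u + f u) - (A *v v + f v)) \<le> norm (A *v (u - v)) + norm (f u - f v)"
      unfolding eq by (rule norm_triangle_ineq)
    also have "\<dots> \<le> (N + \<eta>) * norm (u - v)"
      using N(2)[of "u - v"] lip[OF that] by (simp add: algebra_simps)
    finally show ?thesis .
  qed
  have sol: "\<exists>\<phi>. unique_global_solution \<alpha> \<Omega> (\<lambda>x. A *v x + f x) x\<^sub>0 \<phi> \<and> (\<forall>t\<ge>0. norm (\<phi> t) \<le> \<rho> * weight \<nu> t)"
    if x0: "infnorm x\<^sub>0 \<le> \<delta>" for x\<^sub>0
  proof -
    have "norm (A *v x\<^sub>0) \<le> (2 * \<delta>) * N"
      using N norm_le_infnorm_2[of x\<^sub>0] x0 by (intro order_trans[OF N(2)] mult_right_mono) auto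
    then have "8 * M * norm (A *v x\<^sub>0) \<le> 8 * M * ((2 * \<delta>) * N)"
      using M_nonneg by (intro mult_left_mono) auto
    also have "\<dots> = (16 * M * N) * \<delta>" by simp
    also have "\<dots> \<le> (16 * M * N + 1) * \<delta>" using \<delta> by (intro mult_right_mono) auto
    also have "\<dots> = \<rho>" using den by (simp add: \<delta>_def)
    finally have x0': "8 * M * norm (A *v x\<^sub>0) \<le> \<rho>" .
    have lip': "norm (f x - f y) \<le> \<eta> * norm (x - y)" if "norm x \<le> \<rho>" "norm y \<le> \<rho>" for x y
      using that \<rho> by (intro lip) auto
    obtain x where x: "continuous_on {0..} x" "\<And>t. 0 \<le> t \<Longrightarrow> norm (x t) \<le> \<rho> * weight \<nu> t"
      and fp: "\<And>t. 0 \<le> t \<Longrightarrow> x t = x\<^sub>0 + kconv (\<lambda>s. A *v x\<^sub>0 + f (x s)) t"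
      using mild_solution[OF f0 \<rho>(1) less_imp_le[OF \<eta>(1)] \<eta>(2) lip' x0'] by metis
    have xb: "norm (x t) \<le> \<rho>" if "0 \<le> t" for t
      using order_trans[OF x(2)[OF that] mult_left_le[OF weight_le_1]] \<rho> \<nu>_pos by simp
    have "\<eta>-lipschitz_on {x. norm x \<le> r} f"
      using \<eta> lip by (intro lipschitz_onI) (auto simp: dist_norm)
    then have fc: "continuous_on {x. norm x \<le> r} f" by (rule lipschitz_on_continuous_on)
    have fx: "continuous_on {0..} (\<lambda>s. f (x s))"
      by (rule continuous_on_compose2[OF fc x(1)]) (use xb \<rho> in force)
    define h where "h = (\<lambda>s. A *v x\<^sub>0 + f (x s))"
    define F where "F = (\<lambda>x. A *v x + f x)"
    have h: "continuous_on {0..} h" unfolding h_def by (intro continuous_intros fx)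
    have Fx: "continuous_on {0..} (\<lambda>s. F (x s))"
      unfolding F_def
      by (intro continuous_intros fx linear_continuous_on_compose[OF x(1)] matrix_vector_mul_linear)
    have zx: "kconv h t = x t - x\<^sub>0" if "0 \<le> t" for t using fp[OF that] by (simp add: h_def)
    define B where "B = norm (A *v x\<^sub>0) + \<eta> * \<rho> + \<rho> + norm x\<^sub>0"
    have fb: "norm (f (x t)) \<le> \<eta> * \<rho>" if "0 \<le> t" for t
    proof -
      have "norm (f (x t)) \<le> \<eta> * norm (x t)"
        using lip[of "x t" 0] xb[OF that] \<rho> by (simp add: f0)
      also have "\<dots> \<le> \<eta> * \<rho>" using xb[OF that] \<eta> by (intro mult_left_mono) auto
      finally show ?thesis .
    qed
    have hB: "norm (h t) \<le> B" if "0 \<le> t" for t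
      using norm_triangle_ineq[of "A *v x\<^sub>0" "f (x t)"] fb[OF that] \<rho> norm_ge_zero[of x\<^sub>0]
      unfolding h_def B_def by linarith
    have kB: "norm (kconv h t) \<le> B" if "0 \<le> t" for t
    proof -
      have "norm (kconv h t) \<le> norm (x t) + norm x\<^sub>0" unfolding zx[OF that] by (rule norm_triangle_ineq4)
      moreover have "0 \<le> norm (A *v x\<^sub>0) + \<eta> * \<rho>" using \<eta> \<rho> by simp
      ultimately show ?thesis using xb[OF that] unfolding B_def by linarith
    qed
    have volt: "x t $ i = x\<^sub>0 $ i + conv (rl_kernel (\<alpha> $ i)) (\<lambda>s. F (x s) $ i) t" if t: "0 \<le> t" for t i
    proof -
      have "kconv h t $ i = conv (rl_kernel (\<alpha> $ i)) (\<lambda>s. (A *v kconv h s + h s) $ i) t"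
        by (rule volterra_of_mild[OF h hB kB t])
      also have "\<dots> = conv (rl_kernel (\<alpha> $ i)) (\<lambda>s. F (x s) $ i) t"
      proof (rule conv_cong)
        show "(A *v kconv h s + h s) $ i = F (x s) $ i" if "0 \<le> s" for s
          unfolding zx[OF that] by (simp add: h_def F_def matrix_vector_mult_diff_distrib)
      qed
      finally show ?thesis using zx[OF t] by simp
    qed
    have "caputo_solution \<alpha> \<Omega> F x\<^sub>0 \<infinity> x"
      unfolding caputo_solution_def
    proof (intro conjI allI impI; (elim conjE)?)
      have "{t. 0 \<le> t \<and> ereal t < \<infinity>} = {0..}" by auto
      then show "continuous_on {t. 0 \<le> t \<and> ereal t < \<infinity>} x" using x(1) by simp
      show "x 0 = x\<^sub>0" using volt[of 0] by (simp add: vec_eq_iff)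
      show "x t \<in> \<Omega>" if "0 \<le> t" for t using xb[OF that] \<rho> by (intro r(2)) simp
      show "has_caputo_derivative (\<alpha> $ i) (\<lambda>\<tau>. x \<tau> $ i) (F (x t) $ i) t" if "0 < t" for t i
        by (rule caputo_of_volterra[OF \<alpha>_pos \<alpha>1 continuous_on_component[OF Fx] volt that])
    qed
    then have "unique_global_solution \<alpha> \<Omega> F x\<^sub>0 x"
      using \<eta> N xb \<rho> lipF unfolding F_def
      by (intro caputo_unique[OF \<alpha>_pos \<alpha>1, of "N + \<eta>" r]) auto
    then show ?thesis using x(2) unfolding F_def by blast
  qed
  show ?thesis using \<delta> \<rho>(1) sol by blast
qed

theorem theorem5p4:
  fixes \<alpha> :: "real ^ 2" and A :: "real ^ 2 ^ 2"
    and \<Omega> :: "(real ^ 2) set" and f :: "real ^ 2 \<Rightarrow> real ^ 2"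
  assumes "\<alpha> $ 1 \<in> {0<..1}" and "\<alpha> $ 2 \<in> {0<..1}"
    and "open \<Omega>" and "0 \<in> \<Omega>"
    and "locally_lipschitz_at_origin \<Omega> f" and "f 0 = 0"
    and "(lip_const f \<longlongrightarrow> 0) (at_right 0)"
    and "\<forall>s :: complex. char_fun \<alpha> A s = 0 \<longrightarrow> Re s < 0"
  shows "mittag_leffler_stable \<alpha> \<Omega> (\<lambda>x. A *v x + f x) \<and>
    (\<exists>\<delta> > 0. \<exists>\<epsilon> > 0. \<forall>x\<^sub>0. infnorm x\<^sub>0 < \<delta> \<longrightarrow>
       (\<exists>\<phi>. unique_global_solution \<alpha> \<Omega> (\<lambda>x. A *v x + f x) x\<^sub>0 \<phi> \<and>
          (SUP t \<in> {1..}. ereal (t powr min (\<alpha> $ 1) (\<alpha> $ 2) * infnorm (\<phi> t))) \<le> ereal \<epsilon>))"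
proof -
  define \<nu> where "\<nu> = min (\<alpha> $ 1) (\<alpha> $ 2)"
  have \<nu>: "\<nu> > 0" using assms(1,2) by (simp add: \<nu>_def)
  have \<alpha>: "\<alpha> $ i > 0" "\<alpha> $ i \<le> 1" for i using assms(1,2) exhaust_2[of i] by auto
  obtain K M where res: "resolvent \<alpha> A K M \<nu>"
    unfolding \<nu>_def by (rule resolvent_kernels[OF assms(1,2,8)])
  obtain \<delta> \<rho> where \<delta>: "\<delta> > 0" "\<rho> > 0" and sol:
    "\<And>x\<^sub>0. infnorm x\<^sub>0 \<le> \<delta> \<Longrightarrow> \<exists>\<phi>. unique_global_solution \<alpha> \<Omega> (\<lambda>x. A *v x + f x) x\<^sub>0 \<phi> \<and>
       (\<forall>t\<ge>0. norm (\<phi> t) \<le> \<rho> * weight \<nu> t)"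
    using resolvent.stability[OF res \<alpha>(2) assms(3,4,6,7)] by blast
  have inf1: "infnorm (\<phi> t) \<le> \<rho>" if "\<forall>t\<ge>0. norm (\<phi> t) \<le> \<rho> * weight \<nu> t" "0 \<le> t" for \<phi> :: "real \<Rightarrow> real^2" and t
  proof -
    have "infnorm (\<phi> t) \<le> norm (\<phi> t)" by (rule infnorm_le_norm)
    also have "\<dots> \<le> \<rho> * weight \<nu> t" using that by blast
    also have "\<dots> \<le> \<rho>" using weight_le_1[of \<nu> t] \<delta> \<nu> by (intro mult_left_le) auto
    finally show ?thesis .
  qed
  have inf2: "t powr \<nu> * infnorm (\<phi> t) \<le> \<rho>" if b: "\<forall>t\<ge>0. norm (\<phi> t) \<le> \<rho> * weight \<nu> t" and t: "1 \<le> t" for \<phi> :: "real \<Rightarrow> real^2" and t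
  proof -
    have "t powr \<nu> * infnorm (\<phi> t) \<le> t powr \<nu> * (\<rho> * weight \<nu> t)"
      using b t infnorm_le_norm[of "\<phi> t"] by (intro mult_left_mono) (auto intro: order_trans)
    also have "\<dots> \<le> t powr \<nu> * (\<rho> * t powr (- \<nu>))"
      using t \<nu> \<delta> by (intro mult_left_mono) (auto simp: weight_def intro!: powr_mono2')
    also have "\<dots> = \<rho>" using t by (simp add: powr_minus_divide)
    finally show ?thesis .
  qed
  \<comment> \<open>The weight is at most \<open>1\<close> and at most
    \<open>t powr (- \<nu>)\<close>, so the one constant \<open>\<rho>\<close> serves as
    \<open>m\<close> here and as \<open>\<epsilon>\<close> below, with the rate \<open>\<nu>\<close>
    both times.\<close>
  have "mittag_leffler_stable \<alpha> \<Omega> (\<lambda>x. A *v x + f x)"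
    unfolding mittag_leffler_stable_def
  proof (rule exI[of _ \<nu>], rule conjI[OF \<nu>], rule exI[of _ \<rho>], rule conjI[OF \<delta>(2)],
      rule exI[of _ \<delta>], rule conjI[OF \<delta>(1)], rule ballI)
    fix x\<^sub>0 assume "x\<^sub>0 \<in> max_ball \<delta>"
    then obtain \<phi> where \<phi>: "unique_global_solution \<alpha> \<Omega> (\<lambda>x. A *v x + f x) x\<^sub>0 \<phi>" "\<forall>t\<ge>0. norm (\<phi> t) \<le> \<rho> * weight \<nu> t"
      using sol[of x\<^sub>0] by (auto simp: max_ball_def)
    have "max (SUP t \<in> {0..1}. ereal (infnorm (\<phi> t))) (SUP t \<in> {1..}. ereal (t powr \<nu> * infnorm (\<phi> t))) \<le> ereal \<rho>"
      using inf1[OF \<phi>(2)] inf2[OF \<phi>(2)] by (intro max.boundedI SUP_least) auto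
    then show "\<exists>\<phi>. unique_global_solution \<alpha> \<Omega> (\<lambda>x. A *v x + f x) x\<^sub>0 \<phi> \<and>
        max (SUP t \<in> {0..1}. ereal (infnorm (\<phi> t)))
            (SUP t \<in> {1..}. ereal (t powr \<nu> * infnorm (\<phi> t))) \<le> ereal \<rho>"
      using \<phi>(1) by blast
  qed
  moreover have "\<exists>\<phi>. unique_global_solution \<alpha> \<Omega> (\<lambda>x. A *v x + f x) x\<^sub>0 \<phi> \<and>
      (SUP t \<in> {1..}. ereal (t powr min (\<alpha> $ 1) (\<alpha> $ 2) * infnorm (\<phi> t))) \<le> ereal \<rho>"
    if x0: "infnorm x\<^sub>0 < \<delta>" for x\<^sub>0
  proof -
    obtain \<phi> where \<phi>: "unique_global_solution \<alpha> \<Omega> (\<lambda>x. A *v x + f x) x\<^sub>0 \<phi>" "\<forall>t\<ge>0. norm (\<phi> t) \<le> \<rho> * weight \<nu> t"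
      using sol[of x\<^sub>0] x0 by auto
    have "(SUP t \<in> {1..}. ereal (t powr \<nu> * infnorm (\<phi> t))) \<le> ereal \<rho>"
      using inf2[OF \<phi>(2)] by (intro SUP_least) auto
    then show ?thesis using \<phi>(1) unfolding \<nu>_def by blast
  qed
  ultimately show ?thesis using \<delta> by blast
qed

end
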